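(* Let $H$ be a Hopf algebra over a field $k$ which is a domain. If $H$ has a $\Phi$-set theoretic basis $\mathcal B$, then for each $b\in\mathcal B$ we have $\Delta_H(b)=\varepsilon_H(b)^{-1}\,b\otimes b$. Consequently, if $\mathfrak g$ is a finite dimensional Lie algebra, then $U(\mathfrak g)$ has no $\Phi$-set theoretic basis.
   Context: For a Hopf algebra $H$ over a field $k$ with comultiplication $\Delta_H$ and counit $\varepsilon_H$, let $\Phi_H$ be the linear map on $H\otimes H$ given by $\Phi_H(x\otimes y)=x_{(1)}\otimes x_{(2)}y$, in Sweedler notation $\Delta_H(x)=x_{(1)}\otimes x_{(2)}$. A $k$-basis $\mathcal B$ of $H$ is $\Phi$-set theoretic if for all $b,c\in\mathcal B$ the element $\Phi_H(b\otimes c)$ is a pure tensor $b'\otimes c'$ with $b',c'\in\mathcal B$. $U(\mathfrak g)$ denotes the universal enveloping algebra of the Lie algebra $\mathfrak g$ over $k$, with its usual Hopf algebra structure in which the elements of $\mathfrak g$ are primitive.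
   Formalization: The second claim is stated for nonzero finite dimensional Lie algebras only: for g = 0 one has U(g) = k, and {1} is a Φ-set theoretic basis, so the claim fails there. *)

theory Defs
  imports "HOL-Algebra.Module" "HOL-Algebra.QuotRing"
begin

section \<open>Linear algebra over modules\<close>

definition module_span ::
  "('k, 'r) ring_scheme \<Rightarrow> ('k, 'a, 's) module_scheme \<Rightarrow> 'a set \<Rightarrow> 'a set" where
  "module_span K M S =
     {\<Oplus>\<^bsub>M\<^esub> v \<in> A. c v \<odot>\<^bsub>M\<^esub> v | A c. finite A \<and> A \<subseteq> S \<and> c \<in> A \<rightarrow> carrier K}"

definition lin_independent ::
  "('k, 'r) ring_scheme \<Rightarrow> ('k, 'a, 's) module_scheme \<Rightarrow> 'a set \<Rightarrow> bool" where
  "lin_independent K M B \<longleftrightarrow>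
     (\<forall>A c. finite A \<and> A \<subseteq> B \<and> c \<in> A \<rightarrow> carrier K \<and>
        (\<Oplus>\<^bsub>M\<^esub> v \<in> A. c v \<odot>\<^bsub>M\<^esub> v) = \<zero>\<^bsub>M\<^esub> \<longrightarrow> (\<forall>v\<in>A. c v = \<zero>\<^bsub>K\<^esub>))"

definition linear_basis ::
  "('k, 'r) ring_scheme \<Rightarrow> ('k, 'a, 's) module_scheme \<Rightarrow> 'a set \<Rightarrow> bool" where
  "linear_basis K M B \<longleftrightarrow>
     B \<subseteq> carrier M \<and> lin_independent K M B \<and> module_span K M B = carrier M"

definition finite_dimensional ::
  "('k, 'r) ring_scheme \<Rightarrow> ('k, 'a, 's) module_scheme \<Rightarrow> bool" where
  "finite_dimensional K M \<longleftrightarrow>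
     (\<exists>S. finite S \<and> S \<subseteq> carrier M \<and> module_span K M S = carrier M)"

definition linear_maps ::
  "('k, 'r) ring_scheme \<Rightarrow> ('k, 'a, 's) module_scheme \<Rightarrow> ('k, 'b, 't) module_scheme
     \<Rightarrow> ('a \<Rightarrow> 'b) set" where
  "linear_maps K M N =
     {f \<in> carrier M \<rightarrow> carrier N.
        (\<forall>x\<in>carrier M. \<forall>y\<in>carrier M. f (x \<oplus>\<^bsub>M\<^esub> y) = f x \<oplus>\<^bsub>N\<^esub> f y) \<and>
        (\<forall>a\<in>carrier K. \<forall>x\<in>carrier M. f (a \<odot>\<^bsub>M\<^esub> x) = a \<odot>\<^bsub>N\<^esub> f x)}"


section \<open>Monoid algebras and quotients\<close>

text \<open>
  The monoid algebra \<open>K[G]\<close>: finitely supported functions with the convolution product.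
  As a module it is the free module on \<^term>\<open>carrier G\<close>, with basis the
  \<open>single_fun K x\<close> for \<^term>\<open>x \<in> carrier G\<close>.
\<close>

definition fun_support :: "('k, 'r) ring_scheme \<Rightarrow> ('x \<Rightarrow> 'k) \<Rightarrow> 'x set" where
  "fun_support K f = {x. f x \<noteq> \<zero>\<^bsub>K\<^esub>}"

definition single_fun :: "('k, 'r) ring_scheme \<Rightarrow> 'x \<Rightarrow> 'x \<Rightarrow> 'k" where
  "single_fun K x = (\<lambda>y. if y = x then \<one>\<^bsub>K\<^esub> else \<zero>\<^bsub>K\<^esub>)"

definition monoid_algebra ::
  "('k, 'r) ring_scheme \<Rightarrow> ('x, 'n) monoid_scheme \<Rightarrow> ('k, 'x \<Rightarrow> 'k) module" where
  "monoid_algebra K G =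
     \<lparr>carrier = {f. range f \<subseteq> carrier K \<and> finite (fun_support K f) \<and> fun_support K f \<subseteq> carrier G},
      mult = (\<lambda>f g z. \<Oplus>\<^bsub>K\<^esub> p \<in> {p \<in> fun_support K f \<times> fun_support K g. fst p \<otimes>\<^bsub>G\<^esub> snd p = z}.
                f (fst p) \<otimes>\<^bsub>K\<^esub> g (snd p)),
      one = single_fun K \<one>\<^bsub>G\<^esub>,
      zero = (\<lambda>_. \<zero>\<^bsub>K\<^esub>),
      add = (\<lambda>f g x. f x \<oplus>\<^bsub>K\<^esub> g x),
      smult = (\<lambda>a f x. a \<otimes>\<^bsub>K\<^esub> f x)\<rparr>"

text \<open>The first five fields are those of \<^term>\<open>A Quot N\<close>.\<close>

definition quot_module ::
  "('k, 'a, 's) module_scheme \<Rightarrow> 'a set \<Rightarrow> ('k, 'a set) module" where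
  "quot_module A N =
     \<lparr>carrier = a_rcosets\<^bsub>A\<^esub> N,
      mult = rcoset_mult A N,
      one = N +>\<^bsub>A\<^esub> \<one>\<^bsub>A\<^esub>,
      zero = N,
      add = set_add A,
      smult = (\<lambda>a C. \<Union>x\<in>C. N +>\<^bsub>A\<^esub> (a \<odot>\<^bsub>A\<^esub> x))\<rparr>"

text \<open>
  For a coset \<open>C\<close> of finitely supported functions on \<open>'x\<close>, \<open>lin_ext K P \<phi> C\<close> evaluates the
  linear extension of \<open>\<phi>\<close> at a representative of \<open>C\<close>; it does not depend on the representative
  whenever that extension vanishes on the submodule by which one divides.
\<close>

definition lin_ext ::
  "('k, 'r) ring_scheme \<Rightarrow> ('k, 'p, 't) module_scheme \<Rightarrow> ('x \<Rightarrow> 'p) \<Rightarrow> ('x \<Rightarrow> 'k) set \<Rightarrow> 'p" where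
  "lin_ext K P \<phi> C =
     (let u = (SOME u. u \<in> C) in \<Oplus>\<^bsub>P\<^esub> x \<in> fun_support K u. u x \<odot>\<^bsub>P\<^esub> \<phi> x)"


section \<open>Tensor products\<close>

text \<open>
  \<open>M \<otimes> N\<close> is the free module on \<^term>\<open>carrier M \<times> carrier N\<close> modulo the bilinearity relations.
  When \<open>M\<close> and \<open>N\<close> are algebras, the span of the relations is an ideal of the monoid algebra of
  \<^term>\<open>M \<times>\<times> N\<close> (the product of the multiplicative monoids), so that the quotient carries the
  product \<open>(x \<otimes> y)(x' \<otimes> y') = xx' \<otimes> yy'\<close> and the unit \<open>1 \<otimes> 1\<close>.
\<close>

definition tensor_free ::
  "('k, 'r) ring_scheme \<Rightarrow> ('k, 'a, 's) module_scheme \<Rightarrow> ('k, 'b, 't) module_scheme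
     \<Rightarrow> ('k, 'a \<times> 'b \<Rightarrow> 'k) module" where
  "tensor_free K M N = monoid_algebra K (M \<times>\<times> N)"

definition tensor_rels ::
  "('k, 'r) ring_scheme \<Rightarrow> ('k, 'a, 's) module_scheme \<Rightarrow> ('k, 'b, 't) module_scheme
     \<Rightarrow> ('a \<times> 'b \<Rightarrow> 'k) set" where
  "tensor_rels K M N = (let F = tensor_free K M N in
     {single_fun K (x \<oplus>\<^bsub>M\<^esub> x', y) \<ominus>\<^bsub>F\<^esub> (single_fun K (x, y) \<oplus>\<^bsub>F\<^esub> single_fun K (x', y)) | x x' y.
        x \<in> carrier M \<and> x' \<in> carrier M \<and> y \<in> carrier N} \<union>
     {single_fun K (x, y \<oplus>\<^bsub>N\<^esub> y') \<ominus>\<^bsub>F\<^esub> (single_fun K (x, y) \<oplus>\<^bsub>F\<^esub> single_fun K (x, y')) | x y y'.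
        x \<in> carrier M \<and> y \<in> carrier N \<and> y' \<in> carrier N} \<union>
     {single_fun K (a \<odot>\<^bsub>M\<^esub> x, y) \<ominus>\<^bsub>F\<^esub> a \<odot>\<^bsub>F\<^esub> single_fun K (x, y) | a x y.
        a \<in> carrier K \<and> x \<in> carrier M \<and> y \<in> carrier N} \<union>
     {single_fun K (x, a \<odot>\<^bsub>N\<^esub> y) \<ominus>\<^bsub>F\<^esub> a \<odot>\<^bsub>F\<^esub> single_fun K (x, y) | a x y.
        a \<in> carrier K \<and> x \<in> carrier M \<and> y \<in> carrier N})"

definition tensor_null ::
  "('k, 'r) ring_scheme \<Rightarrow> ('k, 'a, 's) module_scheme \<Rightarrow> ('k, 'b, 't) module_scheme
     \<Rightarrow> ('a \<times> 'b \<Rightarrow> 'k) set" where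
  "tensor_null K M N = module_span K (tensor_free K M N) (tensor_rels K M N)"

definition tensor ::
  "('k, 'r) ring_scheme \<Rightarrow> ('k, 'a, 's) module_scheme \<Rightarrow> ('k, 'b, 't) module_scheme
     \<Rightarrow> ('k, ('a \<times> 'b \<Rightarrow> 'k) set) module" where
  "tensor K M N = quot_module (tensor_free K M N) (tensor_null K M N)"

definition pure_tensor ::
  "('k, 'r) ring_scheme \<Rightarrow> ('k, 'a, 's) module_scheme \<Rightarrow> ('k, 'b, 't) module_scheme
     \<Rightarrow> 'a \<Rightarrow> 'b \<Rightarrow> ('a \<times> 'b \<Rightarrow> 'k) set" where
  "pure_tensor K M N x y = tensor_null K M N +>\<^bsub>tensor_free K M N\<^esub> single_fun K (x, y)"

text \<open>
  The linear map \<open>M \<otimes> N \<rightarrow> P\<close> induced by a bilinear map \<open>f\<close>. In Sweedler notation,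
  \<open>tensor_lift K P f (\<Delta> x)\<close> is \<open>f(x\<^sub>(\<^sub>1\<^sub>), x\<^sub>(\<^sub>2\<^sub>))\<close>.
\<close>

definition tensor_lift ::
  "('k, 'r) ring_scheme \<Rightarrow> ('k, 'p, 't) module_scheme \<Rightarrow> ('a \<Rightarrow> 'b \<Rightarrow> 'p)
     \<Rightarrow> ('a \<times> 'b \<Rightarrow> 'k) set \<Rightarrow> 'p" where
  "tensor_lift K P f = lin_ext K P (\<lambda>(x, y). f x y)"


section \<open>Hopf algebras\<close>

record ('k, 'h) hopf = "('k, 'h) module" +
  comult :: "'h \<Rightarrow> ('h \<times> 'h \<Rightarrow> 'k) set"
  counit :: "'h \<Rightarrow> 'k"
  antipode :: "'h \<Rightarrow> 'h"

locale hopf_algebra = module K H + field K + ring H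
  for K (structure) and H :: "('k, 'h, 's) hopf_scheme" (structure) +
  assumes smult_mult_left:
      "\<lbrakk>a \<in> carrier K; x \<in> carrier H; y \<in> carrier H\<rbrakk> \<Longrightarrow>
        (a \<odot>\<^bsub>H\<^esub> x) \<otimes>\<^bsub>H\<^esub> y = a \<odot>\<^bsub>H\<^esub> (x \<otimes>\<^bsub>H\<^esub> y)"
    and smult_mult_right:
      "\<lbrakk>a \<in> carrier K; x \<in> carrier H; y \<in> carrier H\<rbrakk> \<Longrightarrow>
        x \<otimes>\<^bsub>H\<^esub> (a \<odot>\<^bsub>H\<^esub> y) = a \<odot>\<^bsub>H\<^esub> (x \<otimes>\<^bsub>H\<^esub> y)"
    and comult_linear: "comult H \<in> linear_maps K H (tensor K H H)"
    and comult_hom: "comult H \<in> ring_hom H (tensor K H H)"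
    and counit_hom: "counit H \<in> ring_hom H K"
    and counit_smult:
      "\<lbrakk>a \<in> carrier K; x \<in> carrier H\<rbrakk> \<Longrightarrow> counit H (a \<odot>\<^bsub>H\<^esub> x) = a \<otimes> counit H x"
    and coassoc:
      "x \<in> carrier H \<Longrightarrow>
        tensor_lift K (tensor K H (tensor K H H))
          (\<lambda>y z. tensor_lift K (tensor K H (tensor K H H))
             (\<lambda>y1 y2. pure_tensor K H (tensor K H H) y1 (pure_tensor K H H y2 z))
             (comult H y))
          (comult H x) =
        tensor_lift K (tensor K H (tensor K H H))
          (\<lambda>y z. pure_tensor K H (tensor K H H) y (comult H z)) (comult H x)"
    and counit_left:
      "x \<in> carrier H \<Longrightarrow> tensor_lift K H (\<lambda>y z. counit H y \<odot>\<^bsub>H\<^esub> z) (comult H x) = x"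
    and counit_right:
      "x \<in> carrier H \<Longrightarrow> tensor_lift K H (\<lambda>y z. counit H z \<odot>\<^bsub>H\<^esub> y) (comult H x) = x"
    and antipode_linear: "antipode H \<in> linear_maps K H H"
    and antipode_left:
      "x \<in> carrier H \<Longrightarrow>
        tensor_lift K H (\<lambda>y z. antipode H y \<otimes>\<^bsub>H\<^esub> z) (comult H x) = counit H x \<odot>\<^bsub>H\<^esub> \<one>\<^bsub>H\<^esub>"
    and antipode_right:
      "x \<in> carrier H \<Longrightarrow>
        tensor_lift K H (\<lambda>y z. y \<otimes>\<^bsub>H\<^esub> antipode H z) (comult H x) = counit H x \<odot>\<^bsub>H\<^esub> \<one>\<^bsub>H\<^esub>"

text \<open>The library's \<^const>\<open>domain\<close> includes commutativity of the multiplication.\<close>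

definition noncomm_domain :: "('a, 'n) ring_scheme \<Rightarrow> bool" where
  "noncomm_domain R \<longleftrightarrow>
     ring R \<and> \<one>\<^bsub>R\<^esub> \<noteq> \<zero>\<^bsub>R\<^esub> \<and>
     (\<forall>x\<in>carrier R. \<forall>y\<in>carrier R. x \<otimes>\<^bsub>R\<^esub> y = \<zero>\<^bsub>R\<^esub> \<longrightarrow> x = \<zero>\<^bsub>R\<^esub> \<or> y = \<zero>\<^bsub>R\<^esub>)"

definition hopf_Phi ::
  "('k, 'r) ring_scheme \<Rightarrow> ('k, 'h, 's) hopf_scheme
     \<Rightarrow> ('h \<times> 'h \<Rightarrow> 'k) set \<Rightarrow> ('h \<times> 'h \<Rightarrow> 'k) set" where
  "hopf_Phi K H =
     tensor_lift K (tensor K H H)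
       (\<lambda>x y. tensor_lift K (tensor K H H)
          (\<lambda>x1 x2. pure_tensor K H H x1 (x2 \<otimes>\<^bsub>H\<^esub> y)) (comult H x))"

definition Phi_set_theoretic_basis ::
  "('k, 'r) ring_scheme \<Rightarrow> ('k, 'h, 's) hopf_scheme \<Rightarrow> 'h set \<Rightarrow> bool" where
  "Phi_set_theoretic_basis K H B \<longleftrightarrow>
     linear_basis K H B \<and>
     (\<forall>b\<in>B. \<forall>c\<in>B. \<exists>b'\<in>B. \<exists>c'\<in>B.
        hopf_Phi K H (pure_tensor K H H b c) = pure_tensor K H H b' c')"


section \<open>Universal enveloping algebras\<close>

record ('k, 'g) lie = "('k, 'g) module" +
  bracket :: "'g \<Rightarrow> 'g \<Rightarrow> 'g"

text \<open>The fields \<^const>\<open>mult\<close> and \<^const>\<open>one\<close> of \<open>L\<close> play no role.\<close>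

locale lie_algebra = module K L + field K
  for K (structure) and L :: "('k, 'g, 's) lie_scheme" (structure) +
  assumes bracket_linear_left:
      "y \<in> carrier L \<Longrightarrow> (\<lambda>x. bracket L x y) \<in> linear_maps K L L"
    and bracket_linear_right:
      "x \<in> carrier L \<Longrightarrow> (\<lambda>y. bracket L x y) \<in> linear_maps K L L"
    and bracket_self: "x \<in> carrier L \<Longrightarrow> bracket L x x = \<zero>\<^bsub>L\<^esub>"
    and jacobi:
      "\<lbrakk>x \<in> carrier L; y \<in> carrier L; z \<in> carrier L\<rbrakk> \<Longrightarrow>
        bracket L x (bracket L y z) \<oplus>\<^bsub>L\<^esub> bracket L y (bracket L z x)
          \<oplus>\<^bsub>L\<^esub> bracket L z (bracket L x y) = \<zero>\<^bsub>L\<^esub>"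

text \<open>
  The enveloping algebra is presented as the free associative algebra on the underlying set
  of \<open>L\<close> (the monoid algebra of words) modulo the two-sided ideal generated by the linear
  relations, which turn it into the tensor algebra \<open>T(L)\<close>, and \<open>xy - yx - [x,y]\<close>.
\<close>

definition word_monoid :: "'g set \<Rightarrow> 'g list monoid" where
  "word_monoid S = \<lparr>carrier = lists S, mult = (@), one = []\<rparr>"

definition word_algebra ::
  "('k, 'r) ring_scheme \<Rightarrow> ('k, 'g, 's) lie_scheme \<Rightarrow> ('k, 'g list \<Rightarrow> 'k) module" where
  "word_algebra K L = monoid_algebra K (word_monoid (carrier L))"

definition env_rels ::
  "('k, 'r) ring_scheme \<Rightarrow> ('k, 'g, 's) lie_scheme \<Rightarrow> ('g list \<Rightarrow> 'k) set" where
  "env_rels K L = (let F = word_algebra K L in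
     {single_fun K [x \<oplus>\<^bsub>L\<^esub> y] \<ominus>\<^bsub>F\<^esub> (single_fun K [x] \<oplus>\<^bsub>F\<^esub> single_fun K [y]) | x y.
        x \<in> carrier L \<and> y \<in> carrier L} \<union>
     {single_fun K [a \<odot>\<^bsub>L\<^esub> x] \<ominus>\<^bsub>F\<^esub> a \<odot>\<^bsub>F\<^esub> single_fun K [x] | a x.
        a \<in> carrier K \<and> x \<in> carrier L} \<union>
     {(single_fun K [x, y] \<ominus>\<^bsub>F\<^esub> single_fun K [y, x]) \<ominus>\<^bsub>F\<^esub> single_fun K [bracket L x y] | x y.
        x \<in> carrier L \<and> y \<in> carrier L})"

definition env_ideal ::
  "('k, 'r) ring_scheme \<Rightarrow> ('k, 'g, 's) lie_scheme \<Rightarrow> ('g list \<Rightarrow> 'k) set" where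
  "env_ideal K L = Idl\<^bsub>word_algebra K L\<^esub> (env_rels K L)"

definition env_algebra ::
  "('k, 'r) ring_scheme \<Rightarrow> ('k, 'g, 's) lie_scheme \<Rightarrow> ('k, ('g list \<Rightarrow> 'k) set) module" where
  "env_algebra K L = quot_module (word_algebra K L) (env_ideal K L)"

definition env_word ::
  "('k, 'r) ring_scheme \<Rightarrow> ('k, 'g, 's) lie_scheme \<Rightarrow> 'g list \<Rightarrow> ('g list \<Rightarrow> 'k) set" where
  "env_word K L w = env_ideal K L +>\<^bsub>word_algebra K L\<^esub> single_fun K w"

text \<open>
  On a word \<open>x\<^sub>1\<dots>x\<^sub>n\<close> with letters in \<open>L\<close>, the coproduct is the product of the
  \<open>x\<^sub>i \<otimes> 1 + 1 \<otimes> x\<^sub>i\<close>, the counit is \<open>0\<close> unless \<open>n = 0\<close>, and the antipode is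
  \<open>(-1)\<^sup>n x\<^sub>n\<dots>x\<^sub>1\<close>.
\<close>

definition env_comult_word ::
  "('k, 'r) ring_scheme \<Rightarrow> ('k, 'g, 's) lie_scheme \<Rightarrow> 'g list
     \<Rightarrow> (('g list \<Rightarrow> 'k) set \<times> ('g list \<Rightarrow> 'k) set \<Rightarrow> 'k) set" where
  "env_comult_word K L w = (let U = env_algebra K L; T = tensor K U U in
     foldr (\<lambda>x t. (pure_tensor K U U (env_word K L [x]) \<one>\<^bsub>U\<^esub>
                     \<oplus>\<^bsub>T\<^esub> pure_tensor K U U \<one>\<^bsub>U\<^esub> (env_word K L [x])) \<otimes>\<^bsub>T\<^esub> t)
       w \<one>\<^bsub>T\<^esub>)"

definition enveloping_algebra ::
  "('k, 'r) ring_scheme \<Rightarrow> ('k, 'g, 's) lie_scheme \<Rightarrow> ('k, ('g list \<Rightarrow> 'k) set) hopf" where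
  "enveloping_algebra K L = (let U = env_algebra K L in
     module.extend U (hopf.fields
       (lin_ext K (tensor K U U) (env_comult_word K L))
       (\<lambda>C. (SOME u. u \<in> C) [])
       (lin_ext K U (\<lambda>w. ((\<ominus>\<^bsub>K\<^esub> \<one>\<^bsub>K\<^esub>) [^]\<^bsub>K\<^esub> length w) \<odot>\<^bsub>U\<^esub> env_word K L (rev w)))))"

end

theory Submission
  imports Defs "HOL-Library.Multiset_Order"
begin

text \<open>
  Write \<open>\<beta>\<^sup>*\<close> for the coordinate functionals of \<open>B\<close> and \<open>\<Delta> b = \<Sum>\<^sub>\<beta> \<beta> \<otimes> h\<^sub>\<beta>\<close>. Since
  \<open>\<Phi>(b \<otimes> c) = \<Sum>\<^sub>\<beta> \<beta> \<otimes> h\<^sub>\<beta> c\<close> is a pure tensor of basis elements and \<open>H\<close> has no zero divisors, exactly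
  one \<open>h\<^sub>\<beta>\<close> is nonzero. So \<open>\<Delta> b = \<beta> \<otimes> h\<close>, and the two counit axioms give \<open>\<epsilon>(h) \<beta> = b = \<epsilon>(\<beta>) h\<close>,
  hence \<open>\<beta> = b\<close> and \<open>h = \<epsilon>(b)\<^sup>-\<^sup>1 b\<close>.

  Under such a basis every primitive \<open>x\<close> vanishes: applying \<open>\<beta>\<^sup>* \<otimes> id\<close> to \<open>\<Delta> x = x \<otimes> 1 + 1 \<otimes> x\<close>
  gives \<open>\<beta>\<^sup>*(x) \<epsilon>(\<beta>)\<^sup>-\<^sup>1 \<beta> = \<beta>\<^sup>*(x) 1 + \<beta>\<^sup>*(1) x\<close>, and the same with \<open>\<Delta> 1 = 1 \<otimes> 1\<close> gives
  \<open>\<epsilon>(\<beta>)\<^sup>-\<^sup>1 \<beta> = 1\<close> whenever \<open>\<beta>\<^sup>*(1) \<noteq> 0\<close>; together these force \<open>x = 0\<close>. For \<open>U(L)\<close> this contradicts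
  the Poincare-Birkhoff-Witt theorem, which also shows that \<open>U(L)\<close> has no zero divisors. The theorem is
  obtained from an action of \<open>L\<close> on the polynomials in a basis of \<open>L\<close>, in which a word acts on a
  monomial by multiplication up to terms of lower degree.
\<close>

section \<open>Linear combinations and linear maps\<close>

text \<open>All algebras here are quotients of monoid algebras. A map out of one is evaluated at a
  chosen representative, so independence of the choice has to be settled before any Hopf algebra
  appears. The basis may be infinite, so the coefficients \<open>h_\<beta>\<close> are obtained as
  contractions of a tensor: linear maps that commute with multiplication in the second factor and
  jointly separate tensors. They isolate one \<open>h_\<beta>\<close> because
  \<open>\<Phi>(b \<otimes> c)\<close> is \<open>\<Delta>(b)(1 \<otimes> c)\<close>. For the
  polynomial action, the recursion builds in the commutation rule only for an index and a smaller
  one that is least in the monomial. Its validity for all pairs is where the Jacobi identity enters.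
  Zero divisors in \<open>U(L)\<close> are excluded by leading monomials, ordered by size and then
  by the multiset order: if \<open>p\<close> and \<open>q\<close> have leading monomials
  \<open>a\<close> and \<open>b\<close>, then the action of \<open>p\<close> on \<open>q\<close> has
  at \<open>a + b\<close> the product of the leading coefficients.\<close>

definition fin_funs :: "('k, 'r) ring_scheme \<Rightarrow> 'x set \<Rightarrow> ('x \<Rightarrow> 'k) set" where
  "fin_funs K S = {u. range u \<subseteq> carrier K \<and> finite (fun_support K u) \<and> fun_support K u \<subseteq> S}"

text \<open>With a chosen representative in place of \<open>u\<close> this is the body of
  \<open>lin_ext\<close>; with the identity as \<open>\<phi>\<close> it is an ordinary linear
  combination of vectors. The coefficients range over \<open>fin_funs K S\<close> for any set
  \<open>S\<close>, so that bases and sets of monomials of bounded degree fit as well as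
  monoids.\<close>

definition lin_comb ::
  "('k, 'r) ring_scheme \<Rightarrow> ('k, 'p, 't) module_scheme \<Rightarrow> ('x \<Rightarrow> 'p) \<Rightarrow> ('x \<Rightarrow> 'k) \<Rightarrow> 'p" where
  "lin_comb K P \<phi> u = (\<Oplus>\<^bsub>P\<^esub> x \<in> fun_support K u. u x \<odot>\<^bsub>P\<^esub> \<phi> x)"

lemma linear_mapsI:
  assumes "\<And>x. x \<in> carrier M \<Longrightarrow> f x \<in> carrier N"
    and "\<And>x y. x \<in> carrier M \<Longrightarrow> y \<in> carrier M \<Longrightarrow> f (x \<oplus>\<^bsub>M\<^esub> y) = f x \<oplus>\<^bsub>N\<^esub> f y"
    and "\<And>a x. a \<in> carrier K \<Longrightarrow> x \<in> carrier M \<Longrightarrow> f (a \<odot>\<^bsub>M\<^esub> x) = a \<odot>\<^bsub>N\<^esub> f x"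
  shows "f \<in> linear_maps K M N"
  using assms by (auto simp: linear_maps_def)

lemma linear_mapsD:
  assumes "f \<in> linear_maps K M N"
  shows "x \<in> carrier M \<Longrightarrow> f x \<in> carrier N"
    and "x \<in> carrier M \<Longrightarrow> y \<in> carrier M \<Longrightarrow> f (x \<oplus>\<^bsub>M\<^esub> y) = f x \<oplus>\<^bsub>N\<^esub> f y"
    and "a \<in> carrier K \<Longrightarrow> x \<in> carrier M \<Longrightarrow> f (a \<odot>\<^bsub>M\<^esub> x) = a \<odot>\<^bsub>N\<^esub> f x"
  using assms by (auto simp: linear_maps_def)

lemma linear_maps_comp:
  assumes "f \<in> linear_maps K M N" "g \<in> linear_maps K N P"
  shows "(\<lambda>x. g (f x)) \<in> linear_maps K M P"
  using assms by (auto simp: linear_maps_def Pi_iff)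

lemma linear_maps_zero:
  assumes "module K M" "module K N" "f \<in> linear_maps K M N"
  shows "f \<zero>\<^bsub>M\<^esub> = \<zero>\<^bsub>N\<^esub>"
proof -
  interpret M: module K M by fact
  interpret N: module K N by fact
  have "f (\<zero>\<^bsub>K\<^esub> \<odot>\<^bsub>M\<^esub> \<zero>\<^bsub>M\<^esub>) = \<zero>\<^bsub>K\<^esub> \<odot>\<^bsub>N\<^esub> f \<zero>\<^bsub>M\<^esub>"
    using assms(3) by (intro linear_mapsD(3)) auto
  then show ?thesis
    using linear_mapsD(1)[OF assms(3), of "\<zero>\<^bsub>M\<^esub>"] by simp
qed

lemma linear_maps_minus:
  assumes "module K M" "module K N" "f \<in> linear_maps K M N" "x \<in> carrier M" "y \<in> carrier M"
  shows "f (x \<ominus>\<^bsub>M\<^esub> y) = f x \<ominus>\<^bsub>N\<^esub> f y"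
proof -
  interpret M: module K M by fact
  interpret N: module K N by fact
  have *: "f ((\<ominus>\<^bsub>K\<^esub> \<one>\<^bsub>K\<^esub>) \<odot>\<^bsub>M\<^esub> y) = (\<ominus>\<^bsub>K\<^esub> \<one>\<^bsub>K\<^esub>) \<odot>\<^bsub>N\<^esub> f y"
    using assms(3-5) by (intro linear_mapsD(3)) auto
  then have "f (\<ominus>\<^bsub>M\<^esub> y) = \<ominus>\<^bsub>N\<^esub> f y"
    using assms(3-5) by (simp add: M.smult_l_minus N.smult_l_minus linear_mapsD(1)[OF assms(3)])
  then show ?thesis
    using assms(4,5) linear_mapsD[OF assms(3)] by (simp add: a_minus_def)
qed

lemma linear_maps_finsum:
  assumes "module K M" "module K N" "f \<in> linear_maps K M N" "g \<in> A \<rightarrow> carrier M"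
  shows "f (\<Oplus>\<^bsub>M\<^esub>x\<in>A. g x) = (\<Oplus>\<^bsub>N\<^esub>x\<in>A. f (g x))"
  using assms(4)
proof (induction A rule: infinite_finite_induct)
  case (insert a A)
  interpret M: module K M by fact
  interpret N: module K N by fact
  have "g \<in> A \<rightarrow> carrier M" "g a \<in> carrier M" using insert.prems by auto
  moreover from this have "(\<lambda>x. f (g x)) \<in> A \<rightarrow> carrier N" "f (g a) \<in> carrier N"
    using linear_mapsD(1)[OF assms(3)] by auto
  ultimately show ?case
    using insert by (simp add: linear_mapsD(2)[OF assms(3)])
qed (use linear_maps_zero[OF assms(1-3)] assms(1,2) in
    \<open>simp_all add: abelian_monoid.finsum_empty abelian_monoid.finsum_infinite module_def abelian_group_def\<close>)

lemma linear_maps_kernel: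
  assumes "module K M" "module K N" "f \<in> linear_maps K M N"
  shows "submodule {x \<in> carrier M. f x = \<zero>\<^bsub>N\<^esub>} K M"
proof -
  interpret M: module K M by fact
  interpret N: module K N by fact
  have neg: "f (\<ominus>\<^bsub>M\<^esub> x) = \<ominus>\<^bsub>N\<^esub> f x" if "x \<in> carrier M" for x
    using linear_maps_minus[OF assms, of "\<zero>\<^bsub>M\<^esub>" x] linear_maps_zero[OF assms] that
      linear_mapsD(1)[OF assms(3)]
    by (simp add: a_minus_def)
  show ?thesis
    by (rule M.submoduleI)
      (auto simp: linear_mapsD[OF assms(3)] linear_maps_zero[OF assms] neg)
qed

lemma fin_funsD:
  assumes "u \<in> fin_funs K S"
  shows "u x \<in> carrier K" "finite (fun_support K u)" "fun_support K u \<subseteq> S" "range u \<subseteq> carrier K"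
    "x \<notin> S \<Longrightarrow> u x = \<zero>\<^bsub>K\<^esub>"
  using assms by (auto simp: fin_funs_def fun_support_def)

lemma fin_funsI:
  assumes "\<And>x. u x \<in> carrier K" "finite A" "A \<subseteq> S" "\<And>x. x \<notin> A \<Longrightarrow> u x = \<zero>\<^bsub>K\<^esub>"
  shows "u \<in> fin_funs K S"
proof -
  have "fun_support K u \<subseteq> A" using assms(4) by (auto simp: fun_support_def)
  then show ?thesis using assms by (auto simp: fin_funs_def intro: finite_subset)
qed

context module
begin

lemma lin_comb_eq:
  assumes "u \<in> fin_funs R S" "finite A" "fun_support R u \<subseteq> A" "\<phi> \<in> A \<rightarrow> carrier M"
  shows "lin_comb R M \<phi> u = (\<Oplus>\<^bsub>M\<^esub>x\<in>A. u x \<odot>\<^bsub>M\<^esub> \<phi> x)"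
  unfolding lin_comb_def
  using assms fin_funsD(1)[OF assms(1)]
  by (intro add.finprod_mono_neutral_cong_left)
    (auto simp: fun_support_def Pi_iff)

lemma lin_comb_closed:
  assumes "u \<in> fin_funs R S" "\<phi> \<in> S \<rightarrow> carrier M"
  shows "lin_comb R M \<phi> u \<in> carrier M"
  unfolding lin_comb_def
  using assms fin_funsD[OF assms(1)] by (intro finsum_closed) (auto simp: Pi_iff)

lemma fin_funs_add:
  assumes "u \<in> fin_funs R S" "v \<in> fin_funs R S"
  shows "(\<lambda>x. u x \<oplus> v x) \<in> fin_funs R S"
  using fin_funsD[OF assms(1)] fin_funsD[OF assms(2)]
  by (intro fin_funsI[of _ _ "fun_support R u \<union> fun_support R v"]) (auto simp: fun_support_def)

lemma fin_funs_smult: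
  assumes "u \<in> fin_funs R S" "a \<in> carrier R"
  shows "(\<lambda>x. a \<otimes> u x) \<in> fin_funs R S"
  using fin_funsD[OF assms(1)] assms(2)
  by (intro fin_funsI[of _ _ "fun_support R u"]) (auto simp: fun_support_def)

lemma fin_funs_zero: "(\<lambda>x. \<zero>) \<in> fin_funs R S"
  by (auto simp: fin_funs_def fun_support_def)

lemma single_fin_funs: "x \<in> S \<Longrightarrow> single_fun R x \<in> fin_funs R S"
  by (rule fin_funsI[of _ _ "{x}"]) (auto simp: single_fun_def)

lemma lin_comb_add:
  assumes "u \<in> fin_funs R S" "v \<in> fin_funs R S" "\<phi> \<in> S \<rightarrow> carrier M"
  shows "lin_comb R M \<phi> (\<lambda>x. u x \<oplus> v x) = lin_comb R M \<phi> u \<oplus>\<^bsub>M\<^esub> lin_comb R M \<phi> v"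
proof -
  let ?A = "fun_support R u \<union> fun_support R v"
  note D = fin_funsD[OF assms(1)] fin_funsD[OF assms(2)]
  have A: "finite ?A" "\<phi> \<in> ?A \<rightarrow> carrier M" using D assms(3) by auto
  have "lin_comb R M \<phi> (\<lambda>x. u x \<oplus> v x) = (\<Oplus>\<^bsub>M\<^esub>x\<in>?A. (u x \<oplus> v x) \<odot>\<^bsub>M\<^esub> \<phi> x)"
    by (rule lin_comb_eq[OF fin_funs_add[OF assms(1,2)] A(1) _ A(2)])
      (auto simp: fun_support_def)
  also have "\<dots> = (\<Oplus>\<^bsub>M\<^esub>x\<in>?A. u x \<odot>\<^bsub>M\<^esub> \<phi> x \<oplus>\<^bsub>M\<^esub> v x \<odot>\<^bsub>M\<^esub> \<phi> x)"
    using A D by (intro finsum_cong') (auto simp: smult_l_distr Pi_iff)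
  also have "\<dots> = (\<Oplus>\<^bsub>M\<^esub>x\<in>?A. u x \<odot>\<^bsub>M\<^esub> \<phi> x) \<oplus>\<^bsub>M\<^esub> (\<Oplus>\<^bsub>M\<^esub>x\<in>?A. v x \<odot>\<^bsub>M\<^esub> \<phi> x)"
    using A D by (intro finsum_addf) (auto simp: Pi_iff)
  also have "(\<Oplus>\<^bsub>M\<^esub>x\<in>?A. u x \<odot>\<^bsub>M\<^esub> \<phi> x) = lin_comb R M \<phi> u"
    by (rule lin_comb_eq[OF assms(1) A(1) _ A(2), symmetric]) auto
  also have "(\<Oplus>\<^bsub>M\<^esub>x\<in>?A. v x \<odot>\<^bsub>M\<^esub> \<phi> x) = lin_comb R M \<phi> v"
    by (rule lin_comb_eq[OF assms(2) A(1) _ A(2), symmetric]) auto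
  finally show ?thesis .
qed

lemma lin_comb_smult:
  assumes "u \<in> fin_funs R S" "a \<in> carrier R" "\<phi> \<in> S \<rightarrow> carrier M"
  shows "lin_comb R M \<phi> (\<lambda>x. a \<otimes> u x) = a \<odot>\<^bsub>M\<^esub> lin_comb R M \<phi> u"
proof -
  let ?A = "fun_support R u"
  note D = fin_funsD[OF assms(1)]
  have A: "finite ?A" "\<phi> \<in> ?A \<rightarrow> carrier M" using D assms(3) by auto
  have "lin_comb R M \<phi> (\<lambda>x. a \<otimes> u x) = (\<Oplus>\<^bsub>M\<^esub>x\<in>?A. (a \<otimes> u x) \<odot>\<^bsub>M\<^esub> \<phi> x)"
    by (rule lin_comb_eq[OF fin_funs_smult[OF assms(1,2)] A(1) _ A(2)])
      (use assms(2) in \<open>auto simp: fun_support_def\<close>)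
  also have "\<dots> = (\<Oplus>\<^bsub>M\<^esub>x\<in>?A. a \<odot>\<^bsub>M\<^esub> (u x \<odot>\<^bsub>M\<^esub> \<phi> x))"
    using A D assms(2) by (intro finsum_cong') (auto simp: smult_assoc1 Pi_iff)
  also have "\<dots> = a \<odot>\<^bsub>M\<^esub> (\<Oplus>\<^bsub>M\<^esub>x\<in>?A. u x \<odot>\<^bsub>M\<^esub> \<phi> x)"
    using A D assms(2) by (intro finsum_smult_ldistr[symmetric]) (auto simp: Pi_iff)
  finally show ?thesis by (simp add: lin_comb_def)
qed

lemma lin_comb_single:
  assumes "\<phi> x \<in> carrier M"
  shows "lin_comb R M \<phi> (single_fun R x) = \<phi> x"
proof -
  have "lin_comb R M \<phi> (single_fun R x) = (\<Oplus>\<^bsub>M\<^esub>y\<in>{x}. single_fun R x y \<odot>\<^bsub>M\<^esub> \<phi> y)"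
    using assms by (intro lin_comb_eq[OF single_fin_funs[of x UNIV]])
      (auto simp: fun_support_def single_fun_def)
  then show ?thesis using assms by (simp add: single_fun_def)
qed

lemma lin_comb_zero: "lin_comb R M \<phi> (\<lambda>x. \<zero>) = \<zero>\<^bsub>M\<^esub>"
  by (simp add: lin_comb_def fun_support_def)

lemma lin_comb_cong:
  assumes "u \<in> fin_funs R S" "\<psi> \<in> S \<rightarrow> carrier M" "\<And>x. x \<in> S \<Longrightarrow> \<phi> x = \<psi> x"
  shows "lin_comb R M \<phi> u = lin_comb R M \<psi> u"
  unfolding lin_comb_def using assms fin_funsD[OF assms(1)]
  by (intro finsum_cong') (auto simp: Pi_iff)

lemma linear_maps_lin_comb:
  assumes "module R N" "f \<in> linear_maps R M N" "u \<in> fin_funs R S" "\<phi> \<in> S \<rightarrow> carrier M"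
  shows "f (lin_comb R M \<phi> u) = lin_comb R N (\<lambda>x. f (\<phi> x)) u"
proof -
  interpret N: module R N by fact
  note D = fin_funsD[OF assms(3)]
  have "f (lin_comb R M \<phi> u) = (\<Oplus>\<^bsub>N\<^esub>x\<in>fun_support R u. f (u x \<odot>\<^bsub>M\<^esub> \<phi> x))"
    unfolding lin_comb_def using D assms
    by (intro linear_maps_finsum[OF _ assms(1,2)] module_axioms) (auto simp: Pi_iff)
  also have "\<dots> = lin_comb R N (\<lambda>x. f (\<phi> x)) u"
    unfolding lin_comb_def using D assms
    by (intro N.finsum_cong') (auto simp: Pi_iff linear_mapsD[OF assms(2)] subset_iff)
  finally show ?thesis .
qed

text \<open>Erasing one point of the support shrinks it. In a monoid algebra the new function is
  \<open>a \<odot> single_fun R x \<oplus> v\<close>, so linear maps can be applied to it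
  directly.\<close>

lemma fin_funs_induct [consumes 1, case_names zero add]:
  assumes "u \<in> fin_funs R S"
    and zero: "Q (\<lambda>x. \<zero>)"
    and add: "\<And>a x v. a \<in> carrier R \<Longrightarrow> x \<in> S \<Longrightarrow> v \<in> fin_funs R S \<Longrightarrow> Q v \<Longrightarrow>
      Q (\<lambda>y. a \<otimes> single_fun R x y \<oplus> v y)"
  shows "Q u"
proof -
  have "finite (fun_support R u)" using assms(1) by (simp add: fin_funs_def)
  then show ?thesis using assms(1)
  proof (induction "fun_support R u" arbitrary: u rule: finite_psubset_induct)
    case (psubset u)
    note D = fin_funsD[OF psubset.prems]
    show ?case
    proof (cases "fun_support R u = {}")
      case True
      then have "u = (\<lambda>x. \<zero>)" by (auto simp: fun_support_def)
      then show ?thesis using zero by simp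
    next
      case False
      then obtain x where x: "x \<in> fun_support R u" by auto
      define v where "v = u(x := \<zero>)"
      have v: "v \<in> fin_funs R S"
        using D x by (intro fin_funsI[of _ _ "fun_support R u"]) (auto simp: v_def fun_support_def)
      have "fun_support R v \<subset> fun_support R u" using x by (auto simp: v_def fun_support_def)
      then have "Q v" using psubset.hyps v by blast
      then have "Q (\<lambda>y. u x \<otimes> single_fun R x y \<oplus> v y)" using D x v by (intro add) auto
      moreover have "(\<lambda>y. u x \<otimes> single_fun R x y \<oplus> v y) = u"
        using D by (auto simp: v_def single_fun_def)
      ultimately show ?thesis by simp
    qed
  qed
qed

text \<open>Extending the coefficients by zero replaces a finite set together with coefficients on
  it by one function; adding two combinations then amounts to adding functions, with no merging of
  index sets.\<close>

lemma module_span_eq: "module_span R M S = {lin_comb R M (\<lambda>x. x) u | u. u \<in> fin_funs R S}"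
  if "S \<subseteq> carrier M"
proof (intro equalityI subsetI)
  fix x assume "x \<in> module_span R M S"
  then obtain A c where A: "finite A" "A \<subseteq> S" "c \<in> A \<rightarrow> carrier R"
    and x: "x = (\<Oplus>\<^bsub>M\<^esub>v\<in>A. c v \<odot>\<^bsub>M\<^esub> v)"
    unfolding module_span_def by blast
  let ?u = "\<lambda>v. if v \<in> A then c v else \<zero>"
  have u: "?u \<in> fin_funs R S" using A by (intro fin_funsI[of _ _ A]) auto
  have "lin_comb R M (\<lambda>x. x) ?u = (\<Oplus>\<^bsub>M\<^esub>v\<in>A. ?u v \<odot>\<^bsub>M\<^esub> v)"
    by (rule lin_comb_eq[OF u A(1)]) (use A that in \<open>auto simp: fun_support_def split: if_splits\<close>)
  also have "\<dots> = x" unfolding x using A that by (intro finsum_cong') auto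
  finally show "x \<in> {lin_comb R M (\<lambda>x. x) u | u. u \<in> fin_funs R S}" using u by blast
next
  fix x assume "x \<in> {lin_comb R M (\<lambda>x. x) u | u. u \<in> fin_funs R S}"
  then obtain u where "u \<in> fin_funs R S" "x = lin_comb R M (\<lambda>x. x) u" by blast
  then show "x \<in> module_span R M S"
    using fin_funsD[of u R S] unfolding module_span_def lin_comb_def by blast
qed

section \<open>Spans as smallest submodules\<close>

lemma span_superset: "S \<subseteq> module_span R M S" if "S \<subseteq> carrier M"
proof
  fix x assume x: "x \<in> S"
  then have "lin_comb R M (\<lambda>x. x) (single_fun R x) = x" using that by (intro lin_comb_single) auto
  with single_fin_funs[OF x] show "x \<in> module_span R M S"
    unfolding module_span_eq[OF that] by (metis (mono_tags, lifting) mem_Collect_eq)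
qed

lemma submodule_span:
  assumes "S \<subseteq> carrier M"
  shows "submodule (module_span R M S) R M"
proof -
  have S: "(\<lambda>x. x) \<in> S \<rightarrow> carrier M" using assms by auto
  have mem: "lin_comb R M (\<lambda>x. x) u \<in> module_span R M S" if "u \<in> fin_funs R S" for u
    using that unfolding module_span_eq[OF assms] by blast
  have E: "\<exists>u\<in>fin_funs R S. x = lin_comb R M (\<lambda>x. x) u" if "x \<in> module_span R M S" for x
    using that unfolding module_span_eq[OF assms] by blast
  have smult: "a \<odot>\<^bsub>M\<^esub> x \<in> module_span R M S"
    if a: "a \<in> carrier R" and x: "x \<in> module_span R M S" for a x
  proof -
    obtain u where u: "u \<in> fin_funs R S" "x = lin_comb R M (\<lambda>x. x) u" using E[OF x] by blast
    show ?thesis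
      using mem[OF fin_funs_smult[OF u(1) a]] lin_comb_smult[OF u(1) a S] u(2) by simp
  qed
  have carr: "module_span R M S \<subseteq> carrier M"
    using E lin_comb_closed[OF _ S] by blast
  show ?thesis
  proof (rule submoduleI)
    show "\<zero>\<^bsub>M\<^esub> \<in> module_span R M S"
      using mem[OF fin_funs_zero] by (simp add: lin_comb_zero)
    show "\<ominus>\<^bsub>M\<^esub> x \<in> module_span R M S" if "x \<in> module_span R M S" for x
      using smult[OF _ that, of "\<ominus> \<one>"] that carr by (auto simp: smult_l_minus subset_iff)
    show "x \<oplus>\<^bsub>M\<^esub> y \<in> module_span R M S"
      if x: "x \<in> module_span R M S" and y: "y \<in> module_span R M S" for x y
    proof -
      obtain u where u: "u \<in> fin_funs R S" "x = lin_comb R M (\<lambda>x. x) u" using E[OF x] by blast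
      obtain v where v: "v \<in> fin_funs R S" "y = lin_comb R M (\<lambda>x. x) v" using E[OF y] by blast
      show ?thesis
        using mem[OF fin_funs_add[OF u(1) v(1)]] lin_comb_add[OF u(1) v(1) S] u(2) v(2) by simp
    qed
  qed (use smult carr in auto)
qed

lemma span_minimal:
  assumes "submodule V R M" "S \<subseteq> V"
  shows "module_span R M S \<subseteq> V"
proof
  fix x assume "x \<in> module_span R M S"
  then obtain A c where A: "finite A" "A \<subseteq> S" "c \<in> A \<rightarrow> carrier R"
    and x: "x = (\<Oplus>\<^bsub>M\<^esub>v\<in>A. c v \<odot>\<^bsub>M\<^esub> v)"
    unfolding module_span_def by blast
  note V = submoduleE[OF assms(1)]
  have z: "\<zero>\<^bsub>M\<^esub> \<in> V"
    using subgroup.one_closed[OF submodule.axioms(1)[OF assms(1)]] by simp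
  have "(\<Oplus>\<^bsub>M\<^esub>v\<in>A. c v \<odot>\<^bsub>M\<^esub> v) \<in> V" using A
  proof (induction rule: finite_induct)
    case (insert v A)
    then have "v \<in> V" "c v \<odot>\<^bsub>M\<^esub> v \<in> V" using V assms(2) by auto
    moreover have "(\<lambda>v. c v \<odot>\<^bsub>M\<^esub> v) \<in> A \<rightarrow> carrier M"
      using insert V(1) assms(2) by (auto simp: Pi_iff subset_iff)
    ultimately show ?case using insert V by (auto simp: subset_iff)
  qed (use z in simp)
  then show "x \<in> V" using x by simp
qed

end

section \<open>Algebras, monoid algebras and quotients\<close>

locale kalgebra = module K A + A?: ring A for K (structure) and A (structure) +
  assumes smult_mult_left:
      "\<lbrakk>a \<in> carrier K; x \<in> carrier A; y \<in> carrier A\<rbrakk> \<Longrightarrow>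
        (a \<odot>\<^bsub>A\<^esub> x) \<otimes>\<^bsub>A\<^esub> y = a \<odot>\<^bsub>A\<^esub> (x \<otimes>\<^bsub>A\<^esub> y)"
    and smult_mult_right:
      "\<lbrakk>a \<in> carrier K; x \<in> carrier A; y \<in> carrier A\<rbrakk> \<Longrightarrow>
        x \<otimes>\<^bsub>A\<^esub> (a \<odot>\<^bsub>A\<^esub> y) = a \<odot>\<^bsub>A\<^esub> (x \<otimes>\<^bsub>A\<^esub> y)"

lemma kalgebraI:
  assumes "module K A" "Group.monoid A"
    and "\<And>x y z. \<lbrakk>x \<in> carrier A; y \<in> carrier A; z \<in> carrier A\<rbrakk> \<Longrightarrow>
      (x \<oplus>\<^bsub>A\<^esub> y) \<otimes>\<^bsub>A\<^esub> z = x \<otimes>\<^bsub>A\<^esub> z \<oplus>\<^bsub>A\<^esub> y \<otimes>\<^bsub>A\<^esub> z"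
    and "\<And>x y z. \<lbrakk>x \<in> carrier A; y \<in> carrier A; z \<in> carrier A\<rbrakk> \<Longrightarrow>
      z \<otimes>\<^bsub>A\<^esub> (x \<oplus>\<^bsub>A\<^esub> y) = z \<otimes>\<^bsub>A\<^esub> x \<oplus>\<^bsub>A\<^esub> z \<otimes>\<^bsub>A\<^esub> y"
    and "\<And>a x y. \<lbrakk>a \<in> carrier K; x \<in> carrier A; y \<in> carrier A\<rbrakk> \<Longrightarrow>
        (a \<odot>\<^bsub>A\<^esub> x) \<otimes>\<^bsub>A\<^esub> y = a \<odot>\<^bsub>A\<^esub> (x \<otimes>\<^bsub>A\<^esub> y)"
    and "\<And>a x y. \<lbrakk>a \<in> carrier K; x \<in> carrier A; y \<in> carrier A\<rbrakk> \<Longrightarrow>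
        x \<otimes>\<^bsub>A\<^esub> (a \<odot>\<^bsub>A\<^esub> y) = a \<odot>\<^bsub>A\<^esub> (x \<otimes>\<^bsub>A\<^esub> y)"
  shows "kalgebra K A"
proof -
  interpret module K A by fact
  have "ring A" using assms(2-4) by (intro ringI abelian_group_axioms)
  then show ?thesis
    using assms by (intro kalgebra.intro kalgebra_axioms.intro)
qed

section \<open>Monoid algebras as modules\<close>

lemma monoid_algebra_simps:
  "carrier (monoid_algebra K G) = fin_funs K (carrier G)"
  "\<one>\<^bsub>monoid_algebra K G\<^esub> = single_fun K \<one>\<^bsub>G\<^esub>"
  "\<zero>\<^bsub>monoid_algebra K G\<^esub> = (\<lambda>_. \<zero>\<^bsub>K\<^esub>)"
  "f \<oplus>\<^bsub>monoid_algebra K G\<^esub> g = (\<lambda>x. f x \<oplus>\<^bsub>K\<^esub> g x)"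
  "a \<odot>\<^bsub>monoid_algebra K G\<^esub> f = (\<lambda>x. a \<otimes>\<^bsub>K\<^esub> f x)"
  by (simp_all add: monoid_algebra_def fin_funs_def)

lemma module_monoid_algebra:
  assumes "cring K"
  shows "module K (monoid_algebra K G)"
proof -
  interpret K: cring K by fact
  have add: "(\<lambda>x. u x \<oplus>\<^bsub>K\<^esub> v x) \<in> fin_funs K S"
    if "u \<in> fin_funs K S" "v \<in> fin_funs K S" for u v and S :: "'c set"
    using fin_funsD[OF that(1)] fin_funsD[OF that(2)]
    by (intro fin_funsI[of _ _ "fun_support K u \<union> fun_support K v"]) (auto simp: fun_support_def)
  have smult: "(\<lambda>x. a \<otimes>\<^bsub>K\<^esub> u x) \<in> fin_funs K S"
    if "u \<in> fin_funs K S" "a \<in> carrier K" for a u and S :: "'c set"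
    using fin_funsD[OF that(1)] that(2)
    by (intro fin_funsI[of _ _ "fun_support K u"]) (auto simp: fun_support_def)
  have zero: "(\<lambda>x. \<zero>\<^bsub>K\<^esub>) \<in> fin_funs K S" for S :: "'c set"
    by (auto simp: fin_funs_def fun_support_def)
  show ?thesis
  proof (rule moduleI)
    show "abelian_group (monoid_algebra K G)"
    proof (rule abelian_groupI)
      fix u assume u: "u \<in> carrier (monoid_algebra K G)"
      have "(\<lambda>x. (\<ominus>\<^bsub>K\<^esub> \<one>\<^bsub>K\<^esub>) \<otimes>\<^bsub>K\<^esub> u x) \<oplus>\<^bsub>monoid_algebra K G\<^esub> u = \<zero>\<^bsub>monoid_algebra K G\<^esub>"
        using fin_funsD(1)[of u K "carrier G"] u
        by (auto simp: monoid_algebra_simps K.l_minus K.l_neg)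
      then show "\<exists>y\<in>carrier (monoid_algebra K G). y \<oplus>\<^bsub>monoid_algebra K G\<^esub> u = \<zero>\<^bsub>monoid_algebra K G\<^esub>"
        using smult[of u _ "\<ominus>\<^bsub>K\<^esub> \<one>\<^bsub>K\<^esub>"] u
        by (intro bexI[where x = "\<lambda>x. (\<ominus>\<^bsub>K\<^esub> \<one>\<^bsub>K\<^esub>) \<otimes>\<^bsub>K\<^esub> u x"]) (simp_all add: monoid_algebra_simps(1))
    qed (auto simp: monoid_algebra_simps add zero fin_funsD(1) K.a_ac)
  qed (auto simp: monoid_algebra_simps smult fin_funsD(1) K.l_distr K.r_distr K.m_assoc assms)
qed

text \<open>Evaluation at \<open>z\<close> is additive. For infinite \<open>A\<close> both sums take
  the default value zero, so finiteness is not assumed.\<close>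

lemma monoid_algebra_finsum:
  assumes "cring K" "h \<in> A \<rightarrow> fin_funs K (carrier G)"
  shows "(\<Oplus>\<^bsub>monoid_algebra K G\<^esub>x\<in>A. h x) z = (\<Oplus>\<^bsub>K\<^esub>x\<in>A. h x z)"
  using assms(2)
proof (induction A rule: infinite_finite_induct)
  case (infinite A)
  interpret K: cring K by fact
  interpret F: module K "monoid_algebra K G" by (rule module_monoid_algebra[OF assms(1)])
  show ?case using infinite by (simp add: monoid_algebra_simps)
next
  case empty
  interpret K: cring K by fact
  interpret F: module K "monoid_algebra K G" by (rule module_monoid_algebra[OF assms(1)])
  show ?case by (simp add: monoid_algebra_simps)
next
  case (insert x A)
  interpret K: cring K by fact
  interpret F: module K "monoid_algebra K G" by (rule module_monoid_algebra[OF assms(1)])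
  have h: "h \<in> A \<rightarrow> carrier (monoid_algebra K G)" "h x \<in> carrier (monoid_algebra K G)"
    using insert.prems by (auto simp: monoid_algebra_simps)
  have hz: "(\<lambda>x. h x z) \<in> A \<rightarrow> carrier K" "h x z \<in> carrier K"
    using insert.prems by (auto simp: Pi_iff intro: fin_funsD(1)[of _ K "carrier G"])
  have "(\<Oplus>\<^bsub>monoid_algebra K G\<^esub>y\<in>insert x A. h y) z =
      (h x \<oplus>\<^bsub>monoid_algebra K G\<^esub> (\<Oplus>\<^bsub>monoid_algebra K G\<^esub>y\<in>A. h y)) z"
    using insert h by simp
  also have "\<dots> = h x z \<oplus>\<^bsub>K\<^esub> (\<Oplus>\<^bsub>K\<^esub>y\<in>A. h y z)"
    using insert by (simp add: monoid_algebra_simps(4) del: funcset_to_empty_iff)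
  also have "\<dots> = (\<Oplus>\<^bsub>K\<^esub>y\<in>insert x A. h y z)" using insert hz by simp
  finally show ?case .
qed

lemma (in module) lin_comb_linear:
  assumes "\<phi> \<in> carrier G \<rightarrow> carrier M"
  shows "lin_comb R M \<phi> \<in> linear_maps R (monoid_algebra R G) M"
  using assms
  by (intro linear_mapsI) (auto simp: monoid_algebra_simps lin_comb_closed lin_comb_add lin_comb_smult)

text \<open>Restricting to a subset \<open>S\<close> of the monoid is meant for inductions on the
  degree: with \<open>S\<close> the monomials below a bound, a hypothesis on those monomials passes
  to all polynomials of lower degree.\<close>

lemma (in module) linear_maps_eq_on_fin_funs:
  assumes "f \<in> linear_maps R (monoid_algebra R G) M" "g \<in> linear_maps R (monoid_algebra R G) M"
    and "S \<subseteq> carrier G" "\<And>x. x \<in> S \<Longrightarrow> f (single_fun R x) = g (single_fun R x)"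
    and "u \<in> fin_funs R S"
  shows "f u = g u"
proof -
  let ?F = "monoid_algebra R G"
  interpret F: module R ?F by (rule module_monoid_algebra[OF R.is_cring])
  show ?thesis
    using assms(5)
  proof (induction rule: fin_funs_induct)
    case zero
    show ?case
      using linear_maps_zero[OF F.module_axioms module_axioms assms(1)]
        linear_maps_zero[OF F.module_axioms module_axioms assms(2)]
      by (simp add: monoid_algebra_simps)
  next
    case (add a x v)
    have s: "single_fun R x \<in> carrier ?F" "v \<in> carrier ?F"
      using add assms(3) single_fin_funs[of x "carrier G"]
      by (auto simp: monoid_algebra_simps fin_funs_def)
    have eq: "(\<lambda>y. a \<otimes> single_fun R x y \<oplus> v y) = a \<odot>\<^bsub>?F\<^esub> single_fun R x \<oplus>\<^bsub>?F\<^esub> v"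
      by (simp add: monoid_algebra_simps)
    show ?case
      unfolding eq using s add assms(4)[OF add.hyps(2)]
      by (simp add: linear_mapsD[OF assms(1)] linear_mapsD[OF assms(2)])
  qed
qed

lemma (in module) linear_maps_eq_on_singles:
  assumes "f \<in> linear_maps R (monoid_algebra R G) M" "g \<in> linear_maps R (monoid_algebra R G) M"
    and "\<And>x. x \<in> carrier G \<Longrightarrow> f (single_fun R x) = g (single_fun R x)"
    and "u \<in> carrier (monoid_algebra R G)"
  shows "f u = g u"
  by (rule linear_maps_eq_on_fin_funs[OF assms(1,2) order_refl])
    (use assms in \<open>simp_all add: monoid_algebra_simps\<close>)

locale monoid_alg = cring K + G: Group.monoid G for K (structure) and G
begin

abbreviation "F \<equiv> monoid_algebra K G"

interpretation F: module K F by (rule module_monoid_algebra[OF is_cring])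

lemma single_closed: "x \<in> carrier G \<Longrightarrow> single_fun K x \<in> carrier F"
  by (simp add: monoid_algebra_simps F.single_fin_funs)

text \<open>The sum may run over any finite box containing both supports. Products whose factors
  have different supports can then be compared term by term over one common box.\<close>

lemma mult_eq_finsum:
  assumes "f \<in> carrier F" "g \<in> carrier F"
    and "finite A" "fun_support K f \<subseteq> A" "A \<subseteq> carrier G"
    and "finite B" "fun_support K g \<subseteq> B" "B \<subseteq> carrier G"
  shows "f \<otimes>\<^bsub>F\<^esub> g = (\<Oplus>\<^bsub>F\<^esub>p\<in>A \<times> B. (f (fst p) \<otimes> g (snd p)) \<odot>\<^bsub>F\<^esub> single_fun K (fst p \<otimes>\<^bsub>G\<^esub> snd p))"
    (is "_ = finsum F ?h _")
proof
  fix z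
  have f: "f x \<in> carrier K" and g: "g x \<in> carrier K" for x
    using assms(1,2) fin_funsD(1) by (auto simp: monoid_algebra_simps)
  have h: "?h \<in> A \<times> B \<rightarrow> carrier F"
    using f g assms(5,8) by (auto simp: single_closed subset_iff)
  have "(f \<otimes>\<^bsub>F\<^esub> g) z = (\<Oplus>p\<in>{p \<in> fun_support K f \<times> fun_support K g. fst p \<otimes>\<^bsub>G\<^esub> snd p = z}.
      f (fst p) \<otimes> g (snd p))"
    by (simp add: monoid_algebra_def)
  also have "\<dots> = (\<Oplus>p\<in>A \<times> B. ?h p z)"
    using assms f g
    by (intro add.finprod_mono_neutral_cong_left)
      (auto simp: monoid_algebra_simps single_fun_def fun_support_def)
  also have "\<dots> = finsum F ?h (A \<times> B) z"
    using h by (intro monoid_algebra_finsum[symmetric] is_cring) (auto simp: monoid_algebra_simps(1))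
  finally show "(f \<otimes>\<^bsub>F\<^esub> g) z = finsum F ?h (A \<times> B) z" .
qed

lemma carrierD:
  assumes "f \<in> carrier F"
  shows "f x \<in> carrier K" "finite (fun_support K f)" "fun_support K f \<subseteq> carrier G"
  using fin_funsD[OF assms[unfolded monoid_algebra_simps(1)]] by auto

lemma mult_closed:
  assumes "f \<in> carrier F" "g \<in> carrier F"
  shows "f \<otimes>\<^bsub>F\<^esub> g \<in> carrier F"
  using carrierD[OF assms(1)] carrierD[OF assms(2)] assms
  by (subst mult_eq_finsum[of f g "fun_support K f" "fun_support K g"])
    (auto simp: subset_iff intro!: F.finsum_closed single_closed F.smult_closed)

lemma single_mult:
  assumes "x \<in> carrier G" "y \<in> carrier G"
  shows "single_fun K x \<otimes>\<^bsub>F\<^esub> single_fun K y = single_fun K (x \<otimes>\<^bsub>G\<^esub> y)"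
proof -
  have 1: "single_fun K z z = \<one>" "fun_support K (single_fun K z) \<subseteq> {z}" for z
    by (auto simp: single_fun_def fun_support_def)
  show ?thesis
    using assms
    by (subst mult_eq_finsum[of _ _ "{x}" "{y}"]) (auto simp: single_closed 1)
qed

lemma eval_simps: "(f \<oplus>\<^bsub>F\<^esub> g) x = f x \<oplus> g x" "(a \<odot>\<^bsub>F\<^esub> f) x = a \<otimes> f x"
  by (simp_all add: monoid_algebra_simps)

lemma mult_l_distr:
  assumes "f \<in> carrier F" "g \<in> carrier F" "h \<in> carrier F"
  shows "(f \<oplus>\<^bsub>F\<^esub> g) \<otimes>\<^bsub>F\<^esub> h = f \<otimes>\<^bsub>F\<^esub> h \<oplus>\<^bsub>F\<^esub> g \<otimes>\<^bsub>F\<^esub> h"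
proof -
  let ?A = "fun_support K f \<union> fun_support K g" and ?B = "fun_support K h"
  note D = carrierD[OF assms(1)] carrierD[OF assms(2)] carrierD[OF assms(3)]
  let ?s = "\<lambda>p. single_fun K (fst p \<otimes>\<^bsub>G\<^esub> snd p)"
  have fg: "f \<oplus>\<^bsub>F\<^esub> g \<in> carrier F" using assms by simp
  have s: "?s p \<in> carrier F" if "p \<in> ?A \<times> ?B" for p
    using that D by (intro single_closed) (auto simp: subset_iff)
  have "(f \<oplus>\<^bsub>F\<^esub> g) \<otimes>\<^bsub>F\<^esub> h = (\<Oplus>\<^bsub>F\<^esub>p\<in>?A \<times> ?B. ((f \<oplus>\<^bsub>F\<^esub> g) (fst p) \<otimes> h (snd p)) \<odot>\<^bsub>F\<^esub> ?s p)"
    using D by (intro mult_eq_finsum[OF fg assms(3)]) (auto simp: fun_support_def monoid_algebra_simps(4))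
  also have "\<dots> = (\<Oplus>\<^bsub>F\<^esub>p\<in>?A \<times> ?B. (f (fst p) \<otimes> h (snd p)) \<odot>\<^bsub>F\<^esub> ?s p
      \<oplus>\<^bsub>F\<^esub> (g (fst p) \<otimes> h (snd p)) \<odot>\<^bsub>F\<^esub> ?s p)"
    using D s by (intro F.finsum_cong' refl Pi_I) (simp_all add: eval_simps l_distr F.smult_l_distr)
  also have "\<dots> = (\<Oplus>\<^bsub>F\<^esub>p\<in>?A \<times> ?B. (f (fst p) \<otimes> h (snd p)) \<odot>\<^bsub>F\<^esub> ?s p)
      \<oplus>\<^bsub>F\<^esub> (\<Oplus>\<^bsub>F\<^esub>p\<in>?A \<times> ?B. (g (fst p) \<otimes> h (snd p)) \<odot>\<^bsub>F\<^esub> ?s p)"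
    using D s by (intro F.finsum_addf Pi_I F.smult_closed) auto
  also have "(\<Oplus>\<^bsub>F\<^esub>p\<in>?A \<times> ?B. (f (fst p) \<otimes> h (snd p)) \<odot>\<^bsub>F\<^esub> ?s p) = f \<otimes>\<^bsub>F\<^esub> h"
    using D by (intro mult_eq_finsum[symmetric] assms) auto
  also have "(\<Oplus>\<^bsub>F\<^esub>p\<in>?A \<times> ?B. (g (fst p) \<otimes> h (snd p)) \<odot>\<^bsub>F\<^esub> ?s p) = g \<otimes>\<^bsub>F\<^esub> h"
    using D by (intro mult_eq_finsum[symmetric] assms) auto
  finally show ?thesis .
qed

lemma mult_r_distr:
  assumes "f \<in> carrier F" "g \<in> carrier F" "h \<in> carrier F"
  shows "h \<otimes>\<^bsub>F\<^esub> (f \<oplus>\<^bsub>F\<^esub> g) = h \<otimes>\<^bsub>F\<^esub> f \<oplus>\<^bsub>F\<^esub> h \<otimes>\<^bsub>F\<^esub> g"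
proof -
  let ?A = "fun_support K f \<union> fun_support K g" and ?B = "fun_support K h"
  note D = carrierD[OF assms(1)] carrierD[OF assms(2)] carrierD[OF assms(3)]
  let ?s = "\<lambda>p. single_fun K (fst p \<otimes>\<^bsub>G\<^esub> snd p)"
  have fg: "f \<oplus>\<^bsub>F\<^esub> g \<in> carrier F" using assms by simp
  have s: "?s p \<in> carrier F" if "p \<in> ?B \<times> ?A" for p
    using that D by (intro single_closed) (auto simp: subset_iff)
  have "h \<otimes>\<^bsub>F\<^esub> (f \<oplus>\<^bsub>F\<^esub> g) = (\<Oplus>\<^bsub>F\<^esub>p\<in>?B \<times> ?A. (h (fst p) \<otimes> (f \<oplus>\<^bsub>F\<^esub> g) (snd p)) \<odot>\<^bsub>F\<^esub> ?s p)"
    using D by (intro mult_eq_finsum[OF assms(3) fg]) (auto simp: fun_support_def monoid_algebra_simps(4))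
  also have "\<dots> = (\<Oplus>\<^bsub>F\<^esub>p\<in>?B \<times> ?A. (h (fst p) \<otimes> f (snd p)) \<odot>\<^bsub>F\<^esub> ?s p
      \<oplus>\<^bsub>F\<^esub> (h (fst p) \<otimes> g (snd p)) \<odot>\<^bsub>F\<^esub> ?s p)"
    using D s by (intro F.finsum_cong' refl Pi_I) (simp_all add: eval_simps r_distr F.smult_l_distr)
  also have "\<dots> = (\<Oplus>\<^bsub>F\<^esub>p\<in>?B \<times> ?A. (h (fst p) \<otimes> f (snd p)) \<odot>\<^bsub>F\<^esub> ?s p)
      \<oplus>\<^bsub>F\<^esub> (\<Oplus>\<^bsub>F\<^esub>p\<in>?B \<times> ?A. (h (fst p) \<otimes> g (snd p)) \<odot>\<^bsub>F\<^esub> ?s p)"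
    using D s by (intro F.finsum_addf Pi_I F.smult_closed) auto
  also have "(\<Oplus>\<^bsub>F\<^esub>p\<in>?B \<times> ?A. (h (fst p) \<otimes> f (snd p)) \<odot>\<^bsub>F\<^esub> ?s p) = h \<otimes>\<^bsub>F\<^esub> f"
    using D by (intro mult_eq_finsum[symmetric] assms) auto
  also have "(\<Oplus>\<^bsub>F\<^esub>p\<in>?B \<times> ?A. (h (fst p) \<otimes> g (snd p)) \<odot>\<^bsub>F\<^esub> ?s p) = h \<otimes>\<^bsub>F\<^esub> g"
    using D by (intro mult_eq_finsum[symmetric] assms) auto
  finally show ?thesis .
qed

lemma mult_smult:
  assumes "a \<in> carrier K" "f \<in> carrier F" "g \<in> carrier F"
  shows "(a \<odot>\<^bsub>F\<^esub> f) \<otimes>\<^bsub>F\<^esub> g = a \<odot>\<^bsub>F\<^esub> (f \<otimes>\<^bsub>F\<^esub> g)" "f \<otimes>\<^bsub>F\<^esub> (a \<odot>\<^bsub>F\<^esub> g) = a \<odot>\<^bsub>F\<^esub> (f \<otimes>\<^bsub>F\<^esub> g)"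
proof -
  let ?A = "fun_support K f" and ?B = "fun_support K g"
  note D = carrierD[OF assms(2)] carrierD[OF assms(3)]
  let ?s = "\<lambda>p. single_fun K (fst p \<otimes>\<^bsub>G\<^esub> snd p)"
  have s: "?s p \<in> carrier F" if "p \<in> ?A \<times> ?B" for p
    using that D by (intro single_closed) (auto simp: subset_iff)
  have af: "a \<odot>\<^bsub>F\<^esub> f \<in> carrier F" and ag: "a \<odot>\<^bsub>F\<^esub> g \<in> carrier F" using assms by simp_all
  have R: "a \<odot>\<^bsub>F\<^esub> (f \<otimes>\<^bsub>F\<^esub> g) = (\<Oplus>\<^bsub>F\<^esub>p\<in>?A \<times> ?B. a \<odot>\<^bsub>F\<^esub> ((f (fst p) \<otimes> g (snd p)) \<odot>\<^bsub>F\<^esub> ?s p))"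
    using D s assms
    by (subst mult_eq_finsum[of f g ?A ?B], simp_all)
      (intro F.finsum_smult_ldistr Pi_I F.smult_closed, simp_all)
  have "(a \<odot>\<^bsub>F\<^esub> f) \<otimes>\<^bsub>F\<^esub> g = (\<Oplus>\<^bsub>F\<^esub>p\<in>?A \<times> ?B. ((a \<odot>\<^bsub>F\<^esub> f) (fst p) \<otimes> g (snd p)) \<odot>\<^bsub>F\<^esub> ?s p)"
    using D assms(1)
    by (intro mult_eq_finsum[OF af assms(3)]) (auto simp: fun_support_def monoid_algebra_simps(5))
  also have "\<dots> = (\<Oplus>\<^bsub>F\<^esub>p\<in>?A \<times> ?B. a \<odot>\<^bsub>F\<^esub> ((f (fst p) \<otimes> g (snd p)) \<odot>\<^bsub>F\<^esub> ?s p))"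
    using D s assms(1)
    by (intro F.finsum_cong' refl Pi_I) (simp_all add: eval_simps m_assoc F.smult_assoc1[symmetric])
  finally show "(a \<odot>\<^bsub>F\<^esub> f) \<otimes>\<^bsub>F\<^esub> g = a \<odot>\<^bsub>F\<^esub> (f \<otimes>\<^bsub>F\<^esub> g)" using R by simp
  have "f \<otimes>\<^bsub>F\<^esub> (a \<odot>\<^bsub>F\<^esub> g) = (\<Oplus>\<^bsub>F\<^esub>p\<in>?A \<times> ?B. (f (fst p) \<otimes> (a \<odot>\<^bsub>F\<^esub> g) (snd p)) \<odot>\<^bsub>F\<^esub> ?s p)"
    using D assms(1)
    by (intro mult_eq_finsum[OF assms(2) ag]) (auto simp: fun_support_def monoid_algebra_simps(5))
  also have "\<dots> = (\<Oplus>\<^bsub>F\<^esub>p\<in>?A \<times> ?B. a \<odot>\<^bsub>F\<^esub> ((f (fst p) \<otimes> g (snd p)) \<odot>\<^bsub>F\<^esub> ?s p))"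
    using D s assms(1)
    by (intro F.finsum_cong' refl Pi_I) (simp_all add: eval_simps m_lcomm F.smult_assoc1[symmetric])
  finally show "f \<otimes>\<^bsub>F\<^esub> (a \<odot>\<^bsub>F\<^esub> g) = a \<odot>\<^bsub>F\<^esub> (f \<otimes>\<^bsub>F\<^esub> g)" using R by simp
qed

lemma mult_linear:
  assumes "f \<in> carrier F"
  shows "(\<lambda>g. f \<otimes>\<^bsub>F\<^esub> g) \<in> linear_maps K F F" "(\<lambda>g. g \<otimes>\<^bsub>F\<^esub> f) \<in> linear_maps K F F"
  using assms by (auto intro!: linear_mapsI mult_closed simp: mult_l_distr mult_r_distr mult_smult)

text \<open>Both sides are linear in each factor, so the claim spreads from singles, where it is
  associativity in \<open>G\<close>, to arbitrary \<open>h\<close>, then \<open>g\<close>, then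
  \<open>f\<close>.\<close>

lemma mult_assoc:
  assumes "f \<in> carrier F" "g \<in> carrier F" "h \<in> carrier F"
  shows "(f \<otimes>\<^bsub>F\<^esub> g) \<otimes>\<^bsub>F\<^esub> h = f \<otimes>\<^bsub>F\<^esub> (g \<otimes>\<^bsub>F\<^esub> h)"
proof -
  have 1: "(single_fun K x \<otimes>\<^bsub>F\<^esub> single_fun K y) \<otimes>\<^bsub>F\<^esub> h = single_fun K x \<otimes>\<^bsub>F\<^esub> (single_fun K y \<otimes>\<^bsub>F\<^esub> h)"
    if x: "x \<in> carrier G" and y: "y \<in> carrier G" and h: "h \<in> carrier F" for x y h
  proof (rule F.linear_maps_eq_on_singles[of "\<lambda>h. (single_fun K x \<otimes>\<^bsub>F\<^esub> single_fun K y) \<otimes>\<^bsub>F\<^esub> h" G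
          "\<lambda>h. single_fun K x \<otimes>\<^bsub>F\<^esub> (single_fun K y \<otimes>\<^bsub>F\<^esub> h)"])
    show "(\<lambda>h. single_fun K x \<otimes>\<^bsub>F\<^esub> (single_fun K y \<otimes>\<^bsub>F\<^esub> h)) \<in> linear_maps K F F"
      by (rule linear_maps_comp[OF mult_linear(1) mult_linear(1)]) (use x y single_closed in auto)
    show "(\<lambda>h. (single_fun K x \<otimes>\<^bsub>F\<^esub> single_fun K y) \<otimes>\<^bsub>F\<^esub> h) \<in> linear_maps K F F"
      using x y by (intro mult_linear(1) mult_closed single_closed)
  qed (use x y h in \<open>auto simp: single_mult G.m_assoc\<close>)
  have 2: "(single_fun K x \<otimes>\<^bsub>F\<^esub> g) \<otimes>\<^bsub>F\<^esub> h = single_fun K x \<otimes>\<^bsub>F\<^esub> (g \<otimes>\<^bsub>F\<^esub> h)"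
    if x: "x \<in> carrier G" and g: "g \<in> carrier F" and h: "h \<in> carrier F" for x g h
  proof (rule F.linear_maps_eq_on_singles[of "\<lambda>g. (single_fun K x \<otimes>\<^bsub>F\<^esub> g) \<otimes>\<^bsub>F\<^esub> h" G
          "\<lambda>g. single_fun K x \<otimes>\<^bsub>F\<^esub> (g \<otimes>\<^bsub>F\<^esub> h)"])
    show "(\<lambda>g. (single_fun K x \<otimes>\<^bsub>F\<^esub> g) \<otimes>\<^bsub>F\<^esub> h) \<in> linear_maps K F F"
      by (rule linear_maps_comp[OF mult_linear(1)[OF single_closed[OF x]] mult_linear(2)[OF h]])
    show "(\<lambda>g. single_fun K x \<otimes>\<^bsub>F\<^esub> (g \<otimes>\<^bsub>F\<^esub> h)) \<in> linear_maps K F F"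
      by (rule linear_maps_comp[OF mult_linear(2)[OF h] mult_linear(1)[OF single_closed[OF x]]])
  qed (use x g h 1 in auto)
  show ?thesis
  proof (rule F.linear_maps_eq_on_singles[of "\<lambda>f. (f \<otimes>\<^bsub>F\<^esub> g) \<otimes>\<^bsub>F\<^esub> h" G
          "\<lambda>f. f \<otimes>\<^bsub>F\<^esub> (g \<otimes>\<^bsub>F\<^esub> h)"])
    show "(\<lambda>f. (f \<otimes>\<^bsub>F\<^esub> g) \<otimes>\<^bsub>F\<^esub> h) \<in> linear_maps K F F"
      by (rule linear_maps_comp[OF mult_linear(2)[OF assms(2)] mult_linear(2)[OF assms(3)]])
    show "(\<lambda>f. f \<otimes>\<^bsub>F\<^esub> (g \<otimes>\<^bsub>F\<^esub> h)) \<in> linear_maps K F F"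
      by (rule mult_linear(2)[OF mult_closed[OF assms(2,3)]])
  qed (use assms 2 in auto)
qed

lemma id_linear: "(\<lambda>x. x) \<in> linear_maps K M M"
  by (auto simp: linear_maps_def)

lemma kalgebra: "kalgebra K F"
proof (rule kalgebraI)
  show "Group.monoid F"
  proof (rule monoidI)
    show "\<one>\<^bsub>F\<^esub> \<in> carrier F" by (simp add: monoid_algebra_simps(2) single_closed)
    show "\<one>\<^bsub>F\<^esub> \<otimes>\<^bsub>F\<^esub> f = f" if "f \<in> carrier F" for f
      using that
      by (intro F.linear_maps_eq_on_singles[of _ G "\<lambda>x. x" f] mult_linear id_linear)
        (auto simp: monoid_algebra_simps(2) single_mult single_closed)
    show "f \<otimes>\<^bsub>F\<^esub> \<one>\<^bsub>F\<^esub> = f" if "f \<in> carrier F" for f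
      using that
      by (intro F.linear_maps_eq_on_singles[of "\<lambda>f. f \<otimes>\<^bsub>F\<^esub> \<one>\<^bsub>F\<^esub>" G "\<lambda>x. x" f] mult_linear id_linear)
        (auto simp: monoid_algebra_simps(2) single_mult single_closed)
  qed (simp_all add: mult_closed mult_assoc)
qed (simp_all add: F.module_axioms mult_l_distr mult_r_distr mult_smult)

end

section \<open>Quotients by submodules and ideals, and maps out of them\<close>

lemma mem_a_r_coset: "y \<in> N +>\<^bsub>A\<^esub> x \<longleftrightarrow> (\<exists>h\<in>N. y = h \<oplus>\<^bsub>A\<^esub> x)"
  by (simp add: a_r_coset_def r_coset_def)

lemma (in module) minus_zero_right: "x \<in> carrier M \<Longrightarrow> x \<ominus>\<^bsub>M\<^esub> \<zero>\<^bsub>M\<^esub> = x"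
  using M.minus_equality[of "\<zero>\<^bsub>M\<^esub>" "\<zero>\<^bsub>M\<^esub>"] by (simp add: a_minus_def)

locale quotient_of_module = module K A for K (structure) and A (structure) and N +
  assumes submodule: "submodule N K A"
begin

abbreviation "Q \<equiv> quot_module A N"
abbreviation "cls x \<equiv> N +>\<^bsub>A\<^esub> x"

lemma abelian_subgroup: "abelian_subgroup N A"
  using submodule
  by (intro abelian_subgroupI3 additive_subgroup.intro abelian_group_axioms) (simp add: submodule_def)

interpretation abelian_subgroup N A by (rule abelian_subgroup)

lemma carrier_quot: "carrier Q = cls ` carrier A"
  by (auto simp: quot_module_def A_RCOSETS_def')

lemma quot_cases:
  assumes "c \<in> carrier Q"
  obtains x where "x \<in> carrier A" "c = cls x"
  using assms by (auto simp: carrier_quot)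

lemma cls_closed: "x \<in> carrier A \<Longrightarrow> cls x \<in> carrier Q"
  by (auto simp: carrier_quot)

lemma cls_eq_iff:
  assumes "x \<in> carrier A" "y \<in> carrier A"
  shows "cls x = cls y \<longleftrightarrow> x \<ominus>\<^bsub>A\<^esub> y \<in> N"
proof -
  have "cls x = cls y \<longleftrightarrow> x \<in> cls y"
    using assms a_repr_independence'[of x y] a_rcos_self[of x] by auto
  then show ?thesis using assms by (simp add: a_rcos_module a_minus_def)
qed

lemma cls_zero: "x \<in> N \<Longrightarrow> cls x = \<zero>\<^bsub>Q\<^esub>"
  by (simp add: quot_module_def a_rcos_const)

lemma zero_quot: "\<zero>\<^bsub>Q\<^esub> = cls \<zero>\<^bsub>A\<^esub>"
  using cls_zero[of "\<zero>\<^bsub>A\<^esub>"] by simp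

lemma cls_eq_zero_iff: "x \<in> carrier A \<Longrightarrow> cls x = \<zero>\<^bsub>Q\<^esub> \<longleftrightarrow> x \<in> N"
  by (simp add: zero_quot cls_eq_iff minus_zero_right)

lemma cls_add: "x \<in> carrier A \<Longrightarrow> y \<in> carrier A \<Longrightarrow> cls x \<oplus>\<^bsub>Q\<^esub> cls y = cls (x \<oplus>\<^bsub>A\<^esub> y)"
  by (simp add: quot_module_def a_rcos_sum)

text \<open>The scalar action on the quotient is a union over all representatives. Because
  \<open>N\<close> is closed under scalars, every representative contributes the same coset, and the
  union collapses.\<close>

lemma cls_smult:
  assumes "a \<in> carrier K" "x \<in> carrier A"
  shows "a \<odot>\<^bsub>Q\<^esub> cls x = cls (a \<odot>\<^bsub>A\<^esub> x)"
proof -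
  have "cls (a \<odot>\<^bsub>A\<^esub> y) = cls (a \<odot>\<^bsub>A\<^esub> x)" if y: "y \<in> cls x" for y
  proof -
    obtain h where h: "h \<in> N" "y = h \<oplus>\<^bsub>A\<^esub> x" using y unfolding mem_a_r_coset by auto
    then have "a \<odot>\<^bsub>A\<^esub> y = a \<odot>\<^bsub>A\<^esub> h \<oplus>\<^bsub>A\<^esub> a \<odot>\<^bsub>A\<^esub> x"
      using assms by (simp add: smult_r_distr)
    moreover have "a \<odot>\<^bsub>A\<^esub> h \<in> N" using h assms submoduleE(4)[OF submodule] by simp
    ultimately have "a \<odot>\<^bsub>A\<^esub> y \<in> cls (a \<odot>\<^bsub>A\<^esub> x)" by (auto simp: mem_a_r_coset)
    then show ?thesis using a_repr_independence'[of "a \<odot>\<^bsub>A\<^esub> y" "a \<odot>\<^bsub>A\<^esub> x"] assms by simp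
  qed
  then have "(\<Union>y\<in>cls x. cls (a \<odot>\<^bsub>A\<^esub> y)) = (\<Union>y\<in>cls x. cls (a \<odot>\<^bsub>A\<^esub> x))" by (rule SUP_cong[OF refl])
  also have "\<dots> = cls (a \<odot>\<^bsub>A\<^esub> x)" using a_rcos_self[OF assms(2)] by (intro UN_constant[THEN trans]) auto
  finally show ?thesis by (simp add: quot_module_def)
qed

lemma module_quot: "module K Q"
proof (rule moduleI)
  show "cring K" by (rule R.is_cring)
  show "abelian_group Q"
  proof (rule abelian_groupI)
    fix c assume "c \<in> carrier Q"
    then obtain x where x: "x \<in> carrier A" "c = cls x" by (rule quot_cases)
    then show "\<exists>d\<in>carrier Q. d \<oplus>\<^bsub>Q\<^esub> c = \<zero>\<^bsub>Q\<^esub>"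
      by (intro bexI[of _ "cls (\<ominus>\<^bsub>A\<^esub> x)"]) (simp_all add: cls_add cls_closed zero_quot M.l_neg)
  qed (auto elim!: quot_cases simp: cls_add cls_closed zero_quot M.a_ac)
qed (auto elim!: quot_cases simp: cls_smult cls_add cls_closed smult_l_distr smult_r_distr smult_assoc1)

lemma cls_linear: "cls \<in> linear_maps K A Q"
  by (intro linear_mapsI) (simp_all add: cls_add cls_smult cls_closed)

lemma kalgebra_quot:
  assumes "kalgebra K A" "ideal N A"
  shows "kalgebra K Q"
    and "x \<in> carrier A \<Longrightarrow> y \<in> carrier A \<Longrightarrow> cls x \<otimes>\<^bsub>Q\<^esub> cls y = cls (x \<otimes>\<^bsub>A\<^esub> y)"
    and "\<one>\<^bsub>Q\<^esub> = cls \<one>\<^bsub>A\<^esub>"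
proof -
  interpret A: kalgebra K A by fact
  have mult: "cls x \<otimes>\<^bsub>Q\<^esub> cls y = cls (x \<otimes>\<^bsub>A\<^esub> y)" if "x \<in> carrier A" "y \<in> carrier A" for x y
    using ideal.rcoset_mult_add[OF assms(2) that] by (simp add: quot_module_def)
  then show "x \<in> carrier A \<Longrightarrow> y \<in> carrier A \<Longrightarrow> cls x \<otimes>\<^bsub>Q\<^esub> cls y = cls (x \<otimes>\<^bsub>A\<^esub> y)" by simp
  show one: "\<one>\<^bsub>Q\<^esub> = cls \<one>\<^bsub>A\<^esub>" by (simp add: quot_module_def)
  show "kalgebra K Q"
    by (rule kalgebraI[OF module_quot], rule monoidI)
      (auto elim!: quot_cases simp: one mult cls_closed cls_add cls_smult A.l_distr A.r_distr
        A.m_assoc A.smult_mult_left A.smult_mult_right)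
qed

end

text \<open>The representative chosen by \<open>SOME\<close> differs from \<open>u\<close> by an
  element of \<open>N\<close>, where the linear extension vanishes. All maps out of tensor products,
  and the coproduct of \<open>U(L)\<close>, are well defined through this.\<close>

lemma lin_ext_cls:
  assumes "module K P" "submodule N K (monoid_algebra K G)" "\<phi> \<in> carrier G \<rightarrow> carrier P"
    and "\<And>u. u \<in> N \<Longrightarrow> lin_comb K P \<phi> u = \<zero>\<^bsub>P\<^esub>"
    and "u \<in> carrier (monoid_algebra K G)"
  shows "lin_ext K P \<phi> (N +>\<^bsub>monoid_algebra K G\<^esub> u) = lin_comb K P \<phi> u"
proof -
  let ?F = "monoid_algebra K G"
  interpret P: module K P by fact
  interpret F: module K ?F by (rule module_monoid_algebra[OF P.R.is_cring])
  interpret quotient_of_module K ?F N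
    by (intro quotient_of_module.intro quotient_of_module_axioms.intro F.module_axioms assms(2))
  define v where "v = (SOME v. v \<in> N +>\<^bsub>?F\<^esub> u)"
  have "u \<in> N +>\<^bsub>?F\<^esub> u"
    using abelian_subgroup.a_rcos_self[OF abelian_subgroup assms(5)] .
  then have "v \<in> N +>\<^bsub>?F\<^esub> u" unfolding v_def by (rule someI[where P = "\<lambda>v. v \<in> cls u"])
  then obtain h where h: "h \<in> N" "v = h \<oplus>\<^bsub>?F\<^esub> u" unfolding mem_a_r_coset by auto
  have "h \<in> carrier ?F" using F.submoduleE(1)[OF assms(2)] h by auto
  then have "lin_comb K P \<phi> v = lin_comb K P \<phi> h \<oplus>\<^bsub>P\<^esub> lin_comb K P \<phi> u"
    using linear_mapsD(2)[OF P.lin_comb_linear[OF assms(3)]] h assms(5) by simp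
  also have "\<dots> = lin_comb K P \<phi> u"
    using assms(4)[OF h(1)] linear_mapsD(1)[OF P.lin_comb_linear[OF assms(3)] assms(5)] by simp
  finally show ?thesis
    by (simp add: lin_ext_def lin_comb_def v_def[symmetric] Let_def)
qed

text \<open>Multiplication is linear in each factor, so closure need only be tested on generators of
  the span against generators of the algebra.\<close>

lemma (in monoid_alg) ideal_span:
  assumes S: "S \<subseteq> carrier F"
    and l: "\<And>x s. x \<in> carrier G \<Longrightarrow> s \<in> S \<Longrightarrow> single_fun K x \<otimes>\<^bsub>F\<^esub> s \<in> module_span K F S"
    and r: "\<And>x s. x \<in> carrier G \<Longrightarrow> s \<in> S \<Longrightarrow> s \<otimes>\<^bsub>F\<^esub> single_fun K x \<in> module_span K F S"
  shows "ideal (module_span K F S) F"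
proof -
  interpret F: kalgebra K F by (rule kalgebra)
  let ?N = "module_span K F S"
  have sub: "submodule ?N K F" by (rule F.submodule_span[OF S])
  note N = F.submoduleE[OF sub]
  have N0: "\<zero>\<^bsub>F\<^esub> \<in> ?N" using subgroup.one_closed[OF submodule.axioms(1)[OF sub]] by simp
  \<comment> \<open>The elements that \<open>f\<close> sends into the span form a submodule, so it
    is enough that \<open>f\<close> sends the generators there.\<close>
  have vanish: "?N \<subseteq> {u \<in> carrier F. f u \<in> ?N}"
    if f: "f \<in> linear_maps K F F" and S': "\<And>s. s \<in> S \<Longrightarrow> f s \<in> ?N" for f
  proof (rule F.span_minimal)
    have "f (\<ominus>\<^bsub>F\<^esub> u) = \<ominus>\<^bsub>F\<^esub> f u" if "u \<in> carrier F" for u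
      using linear_maps_minus[OF F.module_axioms F.module_axioms f F.zero_closed that]
        linear_maps_zero[OF F.module_axioms F.module_axioms f] that linear_mapsD(1)[OF f]
      by (simp add: a_minus_def)
    then show "submodule {u \<in> carrier F. f u \<in> ?N} K F"
      using N linear_mapsD[OF f] linear_maps_zero[OF F.module_axioms F.module_axioms f] N0
      by (intro F.submoduleI) auto
  qed (use S S' in auto)
  have lN: "single_fun K x \<otimes>\<^bsub>F\<^esub> u \<in> ?N" if "x \<in> carrier G" "u \<in> ?N" for x u
    using vanish[OF mult_linear(1)[OF single_closed[OF that(1)]]] l that by auto
  have rN: "u \<otimes>\<^bsub>F\<^esub> single_fun K x \<in> ?N" if "x \<in> carrier G" "u \<in> ?N" for x u
    using vanish[OF mult_linear(2)[OF single_closed[OF that(1)]]] r that by auto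
  have "f \<otimes>\<^bsub>F\<^esub> u \<in> ?N \<and> u \<otimes>\<^bsub>F\<^esub> f \<in> ?N" if f: "f \<in> carrier F" and u: "u \<in> ?N" for f u
  proof -
    have u': "u \<in> carrier F" using N(1) u by auto
    from f have "f \<in> fin_funs K (carrier G)" by (simp add: monoid_algebra_simps(1))
    then show ?thesis
    proof (induction rule: F.fin_funs_induct)
      case zero
      show ?case using N0 u' by (simp add: monoid_algebra_simps(3)[of K G, symmetric])
    next
      case (add a x v)
      have v: "v \<in> carrier F" using add by (simp add: monoid_algebra_simps(1))
      have "(\<lambda>y. a \<otimes> single_fun K x y \<oplus> v y) = a \<odot>\<^bsub>F\<^esub> single_fun K x \<oplus>\<^bsub>F\<^esub> v"
        by (simp add: monoid_algebra_simps)
      then show ?case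
        using add v u' u N lN[OF add.hyps(2) u] rN[OF add.hyps(2) u]
        by (simp add: F.l_distr F.r_distr F.smult_mult_left F.smult_mult_right single_closed)
    qed
  qed
  then show ?thesis
    using submodule.axioms(1)[OF sub] by (intro idealI F.ring_axioms) auto
qed

section \<open>Tensor products of algebras\<close>

definition bilinear ::
  "('k, 'r) ring_scheme \<Rightarrow> ('k, 'a, 's) module_scheme \<Rightarrow> ('k, 'b, 't) module_scheme
     \<Rightarrow> ('k, 'p, 'u) module_scheme \<Rightarrow> ('a \<Rightarrow> 'b \<Rightarrow> 'p) \<Rightarrow> bool" where
  "bilinear K M N P f \<longleftrightarrow>
     (\<forall>y\<in>carrier N. (\<lambda>x. f x y) \<in> linear_maps K M P) \<and>
     (\<forall>x\<in>carrier M. (\<lambda>y. f x y) \<in> linear_maps K N P)"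

lemma bilinearD:
  assumes "bilinear K M N P f"
  shows "x \<in> carrier M \<Longrightarrow> y \<in> carrier N \<Longrightarrow> f x y \<in> carrier P"
    and "y \<in> carrier N \<Longrightarrow> (\<lambda>x. f x y) \<in> linear_maps K M P"
    and "x \<in> carrier M \<Longrightarrow> (\<lambda>y. f x y) \<in> linear_maps K N P"
  using assms by (auto simp: bilinear_def linear_maps_def)

lemma bilinearI:
  assumes "\<And>x y. x \<in> carrier M \<Longrightarrow> y \<in> carrier N \<Longrightarrow> f x y \<in> carrier P"
    and "\<And>x x' y. \<lbrakk>x \<in> carrier M; x' \<in> carrier M; y \<in> carrier N\<rbrakk> \<Longrightarrow> f (x \<oplus>\<^bsub>M\<^esub> x') y = f x y \<oplus>\<^bsub>P\<^esub> f x' y"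
    and "\<And>x y y'. \<lbrakk>x \<in> carrier M; y \<in> carrier N; y' \<in> carrier N\<rbrakk> \<Longrightarrow> f x (y \<oplus>\<^bsub>N\<^esub> y') = f x y \<oplus>\<^bsub>P\<^esub> f x y'"
    and "\<And>a x y. \<lbrakk>a \<in> carrier K; x \<in> carrier M; y \<in> carrier N\<rbrakk> \<Longrightarrow> f (a \<odot>\<^bsub>M\<^esub> x) y = a \<odot>\<^bsub>P\<^esub> f x y"
    and "\<And>a x y. \<lbrakk>a \<in> carrier K; x \<in> carrier M; y \<in> carrier N\<rbrakk> \<Longrightarrow> f x (a \<odot>\<^bsub>N\<^esub> y) = a \<odot>\<^bsub>P\<^esub> f x y"
  shows "bilinear K M N P f"
  using assms by (auto simp: bilinear_def linear_maps_def)

locale tensor_algebra = A: kalgebra K A + B: kalgebra K B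
  for K :: "('k, 'r) ring_scheme" (structure) and A :: "('k, 'a, 's) module_scheme"
    and B :: "('k, 'b, 't) module_scheme"
begin

abbreviation "T \<equiv> tensor K A B"
abbreviation "TF \<equiv> tensor_free K A B"
abbreviation "pt \<equiv> pure_tensor K A B"

lemma prod_monoid: "Group.monoid (A \<times>\<times> B)"
  by (rule DirProd_monoid[OF A.monoid_axioms B.monoid_axioms])

lemma monoid_alg: "monoid_alg K (A \<times>\<times> B)"
  by (intro monoid_alg.intro A.R.is_cring prod_monoid)

interpretation G: monoid_alg K "A \<times>\<times> B" by (rule monoid_alg)

interpretation F: kalgebra K TF
  using G.kalgebra by (simp add: tensor_free_def)

lemma single_in_free: "x \<in> carrier A \<Longrightarrow> y \<in> carrier B \<Longrightarrow> single_fun K (x, y) \<in> carrier TF"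
  using G.single_closed[of "(x, y)"] by (simp add: tensor_free_def)

lemma single_mult_free:
  "\<lbrakk>x \<in> carrier A; y \<in> carrier B; x' \<in> carrier A; y' \<in> carrier B\<rbrakk> \<Longrightarrow>
    single_fun K (x, y) \<otimes>\<^bsub>TF\<^esub> single_fun K (x', y') = single_fun K (x \<otimes>\<^bsub>A\<^esub> x', y \<otimes>\<^bsub>B\<^esub> y')"
  using G.single_mult[of "(x, y)" "(x', y')"] by (simp add: tensor_free_def)

lemma tensor_relsI:
  "\<lbrakk>x \<in> carrier A; x' \<in> carrier A; y \<in> carrier B\<rbrakk> \<Longrightarrow>
    single_fun K (x \<oplus>\<^bsub>A\<^esub> x', y) \<ominus>\<^bsub>TF\<^esub> (single_fun K (x, y) \<oplus>\<^bsub>TF\<^esub> single_fun K (x', y)) \<in> tensor_rels K A B"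
  "\<lbrakk>x \<in> carrier A; y \<in> carrier B; y' \<in> carrier B\<rbrakk> \<Longrightarrow>
    single_fun K (x, y \<oplus>\<^bsub>B\<^esub> y') \<ominus>\<^bsub>TF\<^esub> (single_fun K (x, y) \<oplus>\<^bsub>TF\<^esub> single_fun K (x, y')) \<in> tensor_rels K A B"
  "\<lbrakk>a \<in> carrier K; x \<in> carrier A; y \<in> carrier B\<rbrakk> \<Longrightarrow>
    single_fun K (a \<odot>\<^bsub>A\<^esub> x, y) \<ominus>\<^bsub>TF\<^esub> a \<odot>\<^bsub>TF\<^esub> single_fun K (x, y) \<in> tensor_rels K A B"
  "\<lbrakk>a \<in> carrier K; x \<in> carrier A; y \<in> carrier B\<rbrakk> \<Longrightarrow>
    single_fun K (x, a \<odot>\<^bsub>B\<^esub> y) \<ominus>\<^bsub>TF\<^esub> a \<odot>\<^bsub>TF\<^esub> single_fun K (x, y) \<in> tensor_rels K A B"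
  unfolding tensor_rels_def Let_def by blast+

lemma tensor_rels_cases:
  assumes "s \<in> tensor_rels K A B"
  obtains
    x x' y where "x \<in> carrier A" "x' \<in> carrier A" "y \<in> carrier B"
      "s = single_fun K (x \<oplus>\<^bsub>A\<^esub> x', y) \<ominus>\<^bsub>TF\<^esub> (single_fun K (x, y) \<oplus>\<^bsub>TF\<^esub> single_fun K (x', y))"
  | x y y' where "x \<in> carrier A" "y \<in> carrier B" "y' \<in> carrier B"
      "s = single_fun K (x, y \<oplus>\<^bsub>B\<^esub> y') \<ominus>\<^bsub>TF\<^esub> (single_fun K (x, y) \<oplus>\<^bsub>TF\<^esub> single_fun K (x, y'))"
  | a x y where "a \<in> carrier K" "x \<in> carrier A" "y \<in> carrier B"
      "s = single_fun K (a \<odot>\<^bsub>A\<^esub> x, y) \<ominus>\<^bsub>TF\<^esub> a \<odot>\<^bsub>TF\<^esub> single_fun K (x, y)"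
  | a x y where "a \<in> carrier K" "x \<in> carrier A" "y \<in> carrier B"
      "s = single_fun K (x, a \<odot>\<^bsub>B\<^esub> y) \<ominus>\<^bsub>TF\<^esub> a \<odot>\<^bsub>TF\<^esub> single_fun K (x, y)"
  using assms unfolding tensor_rels_def Let_def
  by (elim UnE CollectE exE conjE)
    ((rule that(1); assumption), (rule that(2); assumption),
      (rule that(3); assumption), (rule that(4); assumption))

lemma tensor_rels_carrier: "tensor_rels K A B \<subseteq> carrier TF"
  by (rule subsetI, erule tensor_rels_cases) (simp_all add: single_in_free)

text \<open>Since the products of \<open>A\<close> and \<open>B\<close> are bilinear, a bilinearity
  relation multiplied by a generator is again a bilinearity relation of the same kind.\<close>

lemma ideal_null: "ideal (tensor_null K A B) TF"
proof -
  have sub: "tensor_rels K A B \<subseteq> tensor_null K A B"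
    unfolding tensor_null_def by (rule F.span_superset[OF tensor_rels_carrier])
  have l: "single_fun K p \<otimes>\<^bsub>TF\<^esub> s \<in> tensor_rels K A B"
    if p: "p \<in> carrier (A \<times>\<times> B)" and s: "s \<in> tensor_rels K A B" for p s
  proof -
    obtain u v where p: "p = (u, v)" "u \<in> carrier A" "v \<in> carrier B" using p by (auto simp: DirProd_def)
    show ?thesis
      using s p
      by (cases rule: tensor_rels_cases)
        (simp_all add: a_minus_def F.r_distr F.r_minus single_mult_free single_in_free
          F.smult_mult_right A.r_distr B.r_distr A.smult_mult_right B.smult_mult_right
          tensor_relsI[unfolded a_minus_def])
  qed
  have r: "s \<otimes>\<^bsub>TF\<^esub> single_fun K p \<in> tensor_rels K A B"
    if p: "p \<in> carrier (A \<times>\<times> B)" and s: "s \<in> tensor_rels K A B" for p s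
  proof -
    obtain u v where p: "p = (u, v)" "u \<in> carrier A" "v \<in> carrier B" using p by (auto simp: DirProd_def)
    show ?thesis
      using s p
      by (cases rule: tensor_rels_cases)
        (simp_all add: a_minus_def F.l_distr F.l_minus single_mult_free single_in_free
          F.smult_mult_left A.l_distr B.l_distr A.smult_mult_left B.smult_mult_left
          tensor_relsI[unfolded a_minus_def])
  qed
  have sub': "tensor_rels K A B \<subseteq> module_span K G.F (tensor_rels K A B)"
    using sub unfolding tensor_null_def tensor_free_def .
  show ?thesis
    unfolding tensor_null_def tensor_free_def
  proof (rule G.ideal_span)
    show "tensor_rels K A B \<subseteq> carrier G.F" using tensor_rels_carrier by (simp add: tensor_free_def)
  qed (use l r sub' in \<open>simp_all add: tensor_free_def subset_iff\<close>)
qed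

lemma submodule_null: "submodule (tensor_null K A B) K TF"
  unfolding tensor_null_def by (rule F.submodule_span[OF tensor_rels_carrier])

interpretation Q: quotient_of_module K TF "tensor_null K A B"
  by (intro quotient_of_module.intro quotient_of_module_axioms.intro F.module_axioms submodule_null)

lemma kalgebra_tensor: "kalgebra K T"
  unfolding tensor_def by (rule Q.kalgebra_quot(1)[OF F.kalgebra_axioms ideal_null])

interpretation T: kalgebra K T by (rule kalgebra_tensor)

lemma pure_closed: "x \<in> carrier A \<Longrightarrow> y \<in> carrier B \<Longrightarrow> pt x y \<in> carrier T"
  by (simp add: tensor_def pure_tensor_def Q.cls_closed single_in_free)

lemma pure_mult:
  "\<lbrakk>x \<in> carrier A; y \<in> carrier B; x' \<in> carrier A; y' \<in> carrier B\<rbrakk> \<Longrightarrow>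
    pt x y \<otimes>\<^bsub>T\<^esub> pt x' y' = pt (x \<otimes>\<^bsub>A\<^esub> x') (y \<otimes>\<^bsub>B\<^esub> y')"
  by (simp add: tensor_def pure_tensor_def Q.kalgebra_quot(2)[OF F.kalgebra_axioms ideal_null]
      single_in_free single_mult_free)

lemma one_tensor: "\<one>\<^bsub>T\<^esub> = pt \<one>\<^bsub>A\<^esub> \<one>\<^bsub>B\<^esub>"
  by (simp add: tensor_def pure_tensor_def Q.kalgebra_quot(3)[OF F.kalgebra_axioms ideal_null])
    (simp add: tensor_free_def monoid_algebra_simps(2))

lemma pure_bilinear: "bilinear K A B T pt"
proof -
  have rel: "Q.cls s = Q.cls t" if "s \<ominus>\<^bsub>TF\<^esub> t \<in> tensor_rels K A B" "s \<in> carrier TF" "t \<in> carrier TF" for s t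
    using that F.span_superset[OF tensor_rels_carrier, folded tensor_null_def]
    by (simp add: Q.cls_eq_iff subset_iff)
  show ?thesis
    unfolding tensor_def pure_tensor_def
    by (intro bilinearI)
      (simp_all add: Q.cls_closed Q.cls_add Q.cls_smult single_in_free rel tensor_relsI)
qed

lemma pure_linear:
  "y \<in> carrier B \<Longrightarrow> (\<lambda>x. pt x y) \<in> linear_maps K A T"
  "x \<in> carrier A \<Longrightarrow> (\<lambda>y. pt x y) \<in> linear_maps K B T"
  using bilinearD(2,3)[OF pure_bilinear] by auto

text \<open>The universal property of the tensor product: the kernel of the linear extension is a
  submodule, and bilinearity of \<open>f\<close> says exactly that it contains the four kinds of
  relations.\<close>

lemma lift_null:
  assumes "module K P" "bilinear K A B P f" "u \<in> tensor_null K A B"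
  shows "lin_comb K P (\<lambda>(x, y). f x y) u = \<zero>\<^bsub>P\<^esub>"
proof -
  interpret P: module K P by fact
  let ?h = "lin_comb K P (\<lambda>(x, y). f x y)"
  note B = bilinearD[OF assms(2)]
  have lin: "?h \<in> linear_maps K TF P"
    unfolding tensor_free_def using B(1) by (intro P.lin_comb_linear) auto
  have single: "?h (single_fun K (x, y)) = f x y" if "x \<in> carrier A" "y \<in> carrier B" for x y
    using P.lin_comb_single[of "\<lambda>(x, y). f x y" "(x, y)"] B(1) that by simp
  have "tensor_null K A B \<subseteq> {u \<in> carrier TF. ?h u = \<zero>\<^bsub>P\<^esub>}"
    unfolding tensor_null_def
  proof (rule F.span_minimal[OF linear_maps_kernel[OF F.module_axioms assms(1) lin]], rule subsetI)
    fix s assume s: "s \<in> tensor_rels K A B"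
    then have "?h s = \<zero>\<^bsub>P\<^esub>"
    proof (cases rule: tensor_rels_cases)
      case (1 x x' y)
      then show ?thesis
        using linear_mapsD(2)[OF B(2)[of y], of x x'] B(1)
        by (simp add: linear_maps_minus[OF F.module_axioms assms(1) lin] linear_mapsD[OF lin]
            single single_in_free P.M.r_neg a_minus_def[of P])
    next
      case (2 x y y')
      then show ?thesis
        using linear_mapsD(2)[OF B(3)[of x], of y y'] B(1)
        by (simp add: linear_maps_minus[OF F.module_axioms assms(1) lin] linear_mapsD[OF lin]
            single single_in_free P.M.r_neg a_minus_def[of P])
    next
      case (3 a x y)
      then show ?thesis
        using linear_mapsD(3)[OF B(2)[of y], of a x] B(1)
        by (simp add: linear_maps_minus[OF F.module_axioms assms(1) lin] linear_mapsD[OF lin]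
            single single_in_free P.M.r_neg a_minus_def[of P])
    next
      case (4 a x y)
      then show ?thesis
        using linear_mapsD(3)[OF B(3)[of x], of a y] B(1)
        by (simp add: linear_maps_minus[OF F.module_axioms assms(1) lin] linear_mapsD[OF lin]
            single single_in_free P.M.r_neg a_minus_def[of P])
    qed
    then show "s \<in> {u \<in> carrier TF. ?h u = \<zero>\<^bsub>P\<^esub>}" using s tensor_rels_carrier by auto
  qed
  then show ?thesis using assms(3) by auto
qed

lemma tensor_lift_cls:
  assumes "module K P" "bilinear K A B P f" "u \<in> carrier TF"
  shows "tensor_lift K P f (Q.cls u) = lin_comb K P (\<lambda>(x, y). f x y) u"
  using lift_null[OF assms(1,2)] bilinearD(1)[OF assms(2)] assms(3) submodule_null
  unfolding tensor_lift_def tensor_free_def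
  by (intro lin_ext_cls[OF assms(1)]) auto

lemma tensor_lift_linear:
  assumes "module K P" "bilinear K A B P f"
  shows "tensor_lift K P f \<in> linear_maps K T P"
proof -
  interpret P: module K P by fact
  have lin: "lin_comb K P (\<lambda>(x, y). f x y) \<in> linear_maps K TF P"
    unfolding tensor_free_def using bilinearD(1)[OF assms(2)] by (intro P.lin_comb_linear) auto
  show ?thesis
    unfolding tensor_def
    by (intro linear_mapsI)
      (auto elim!: Q.quot_cases simp: Q.cls_add Q.cls_smult tensor_lift_cls[OF assms] linear_mapsD[OF lin])
qed

lemma tensor_lift_pure:
  assumes "module K P" "bilinear K A B P f" "x \<in> carrier A" "y \<in> carrier B"
  shows "tensor_lift K P f (pt x y) = f x y"
proof -
  interpret P: module K P by fact
  show ?thesis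
    unfolding pure_tensor_def
    using tensor_lift_cls[OF assms(1,2) single_in_free[OF assms(3,4)]]
      P.lin_comb_single[of "\<lambda>(x, y). f x y" "(x, y)"] bilinearD(1)[OF assms(2-4)]
    by simp
qed

text \<open>Zero and scalar multiples need no cases of their own: a scalar is absorbed into the
  first factor of a pure tensor, and zero is the pure tensor of \<open>0\<close> and
  \<open>1\<close>.\<close>

lemma tensor_induct [consumes 1, case_names pure add]:
  assumes "t \<in> carrier T"
    and pure: "\<And>x y. x \<in> carrier A \<Longrightarrow> y \<in> carrier B \<Longrightarrow> R (pt x y)"
    and add: "\<And>s t. \<lbrakk>s \<in> carrier T; t \<in> carrier T; R s; R t\<rbrakk> \<Longrightarrow> R (s \<oplus>\<^bsub>T\<^esub> t)"
  shows "R t"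
proof -
  obtain u where u: "u \<in> carrier TF" "t = Q.cls u"
    using assms(1) unfolding tensor_def by (rule Q.quot_cases)
  have "u \<in> fin_funs K (carrier (A \<times>\<times> B))"
    using u by (simp add: tensor_free_def monoid_algebra_simps(1))
  then have "R (Q.cls u)"
  proof (induction rule: F.fin_funs_induct)
    case zero
    have "Q.cls (\<lambda>x. \<zero>) = \<zero>\<^bsub>T\<^esub>"
      by (simp add: Q.zero_quot tensor_def) (simp add: tensor_free_def monoid_algebra_simps(3))
    also have "\<dots> = \<zero> \<odot>\<^bsub>T\<^esub> pt \<one>\<^bsub>A\<^esub> \<one>\<^bsub>B\<^esub>" by (simp add: pure_closed)
    also have "\<dots> = pt (\<zero> \<odot>\<^bsub>A\<^esub> \<one>\<^bsub>A\<^esub>) \<one>\<^bsub>B\<^esub>"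
      using linear_mapsD(3)[OF pure_linear(1), of "\<one>\<^bsub>B\<^esub>" \<zero> "\<one>\<^bsub>A\<^esub>"] by simp
    finally show ?case using pure[of "\<zero> \<odot>\<^bsub>A\<^esub> \<one>\<^bsub>A\<^esub>" "\<one>\<^bsub>B\<^esub>"] by simp
  next
    case (add a p v)
    obtain x y where p: "p = (x, y)" "x \<in> carrier A" "y \<in> carrier B" using add.hyps by auto
    have v: "v \<in> carrier TF" using add by (simp add: tensor_free_def monoid_algebra_simps(1))
    have "(\<lambda>y. a \<otimes> single_fun K p y \<oplus> v y) = a \<odot>\<^bsub>TF\<^esub> single_fun K p \<oplus>\<^bsub>TF\<^esub> v"
      by (simp add: tensor_free_def monoid_algebra_simps)
    then have "Q.cls (\<lambda>y. a \<otimes> single_fun K p y \<oplus> v y) = a \<odot>\<^bsub>T\<^esub> pt x y \<oplus>\<^bsub>T\<^esub> Q.cls v"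
      using p v add single_in_free
      by (simp add: tensor_def pure_tensor_def Q.cls_add Q.cls_smult)
    also have "a \<odot>\<^bsub>T\<^esub> pt x y = pt (a \<odot>\<^bsub>A\<^esub> x) y"
      using linear_mapsD(3)[OF pure_linear(1), of y a x] p add by simp
    finally show ?case
      using add p v Q.cls_closed assms(3)[of "pt (a \<odot>\<^bsub>A\<^esub> x) y" "Q.cls v"] pure[of "a \<odot>\<^bsub>A\<^esub> x" y]
        pure_closed[of "a \<odot>\<^bsub>A\<^esub> x" y]
      by (simp add: tensor_def)
  qed
  then show ?thesis using u by simp
qed

lemma tensor_linear_eq:
  assumes "f \<in> linear_maps K T P" "g \<in> linear_maps K T P" "t \<in> carrier T"
    and "\<And>x y. x \<in> carrier A \<Longrightarrow> y \<in> carrier B \<Longrightarrow> f (pt x y) = g (pt x y)"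
  shows "f t = g t"
  using assms(3)
  by (induction rule: tensor_induct) (simp_all add: assms(4) linear_mapsD[OF assms(1)] linear_mapsD[OF assms(2)])

end

section \<open>Coordinates with respect to a basis\<close>

text \<open>For fixed last argument \<open>\<beta>\<close> this is, as a function of
  \<open>x\<close>, the coordinate functional of \<open>\<beta>\<close>; for fixed \<open>x\<close>
  it is the coefficient function, which is zero outside \<open>B\<close>.\<close>

definition coord ::
  "('k, 'r) ring_scheme \<Rightarrow> ('k, 'a, 's) module_scheme \<Rightarrow> 'a set \<Rightarrow> 'a \<Rightarrow> 'a \<Rightarrow> 'k" where
  "coord K M B x = (THE u. u \<in> fin_funs K B \<and> lin_comb K M (\<lambda>x. x) u = x)"

lemma linear_maps_add:
  assumes "module K N" "f \<in> linear_maps K M N" "g \<in> linear_maps K M N"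
  shows "(\<lambda>x. f x \<oplus>\<^bsub>N\<^esub> g x) \<in> linear_maps K M N"
proof -
  interpret N: module K N by fact
  show ?thesis
    using linear_mapsD[OF assms(2)] linear_mapsD[OF assms(3)]
    by (intro linear_mapsI) (simp_all add: N.smult_r_distr N.M.a_ac)
qed

lemma linear_maps_smult:
  assumes "module K N" "f \<in> linear_maps K M N" "a \<in> carrier K"
  shows "(\<lambda>x. a \<odot>\<^bsub>N\<^esub> f x) \<in> linear_maps K M N"
proof -
  interpret N: module K N by fact
  show ?thesis
    using linear_mapsD[OF assms(2)] assms(3)
    by (intro linear_mapsI) (simp_all add: N.smult_r_distr N.smult_assoc1[symmetric] N.R.m_comm)
qed

context module
begin

text \<open>Serves the counit and the coordinate functionals alike. Linearity is spelled out in the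
  hypotheses because the ground ring carries no \<open>smult\<close> field, so that
  \<open>linear_maps\<close> cannot have it as a target.\<close>

lemma functional_bilinear:
  assumes "\<And>x. x \<in> carrier M \<Longrightarrow> f x \<in> carrier R"
    and "\<And>x y. \<lbrakk>x \<in> carrier M; y \<in> carrier M\<rbrakk> \<Longrightarrow> f (x \<oplus>\<^bsub>M\<^esub> y) = f x \<oplus> f y"
    and "\<And>a x. \<lbrakk>a \<in> carrier R; x \<in> carrier M\<rbrakk> \<Longrightarrow> f (a \<odot>\<^bsub>M\<^esub> x) = a \<otimes> f x"
  shows "bilinear R M M M (\<lambda>x y. f x \<odot>\<^bsub>M\<^esub> y)" "bilinear R M M M (\<lambda>x y. f y \<odot>\<^bsub>M\<^esub> x)"
  using assms
  by (auto intro!: bilinearI simp: smult_l_distr smult_r_distr smult_assoc1[symmetric] R.m_comm)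

lemma basis_unique:
  assumes "linear_basis R M B" "x \<in> carrier M"
  shows "\<exists>!u. u \<in> fin_funs R B \<and> lin_comb R M (\<lambda>x. x) u = x"
proof -
  have B: "B \<subseteq> carrier M" "lin_independent R M B" "module_span R M B = carrier M"
    using assms(1) by (auto simp: linear_basis_def)
  have i: "(\<lambda>x. x) \<in> B \<rightarrow> carrier M" using B by auto
  have "\<exists>u. u \<in> fin_funs R B \<and> lin_comb R M (\<lambda>x. x) u = x"
    using assms(2) module_span_eq[OF B(1)] B(3) by auto
  moreover have "u = v"
    if u: "u \<in> fin_funs R B" "lin_comb R M (\<lambda>x. x) u = x"
      and v: "v \<in> fin_funs R B" "lin_comb R M (\<lambda>x. x) v = x" for u v
  proof -
    \<comment> \<open>Independence is a statement about finite sets; it is applied to the support of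
      the difference of the two coefficient functions.\<close>
    define w where "w = (\<lambda>x. u x \<oplus> \<ominus> \<one> \<otimes> v x)"
    have m: "(\<lambda>x. \<ominus> \<one> \<otimes> v x) \<in> fin_funs R B" by (rule fin_funs_smult[OF v(1)]) simp
    have w: "w \<in> fin_funs R B" unfolding w_def by (rule fin_funs_add[OF u(1) m])
    have "lin_comb R M (\<lambda>x. x) w = x \<oplus>\<^bsub>M\<^esub> \<ominus> \<one> \<odot>\<^bsub>M\<^esub> x"
      unfolding w_def using u v
      by (subst lin_comb_add[OF u(1) m i], subst lin_comb_smult[OF v(1) _ i]) auto
    also have "\<dots> = \<zero>\<^bsub>M\<^esub>" using assms(2) by (simp add: smult_l_minus M.r_neg)
    finally have "(\<Oplus>\<^bsub>M\<^esub>y\<in>fun_support R w. w y \<odot>\<^bsub>M\<^esub> y) = \<zero>\<^bsub>M\<^esub>" by (simp add: lin_comb_def)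
    moreover have "finite (fun_support R w)" "fun_support R w \<subseteq> B" "w \<in> fun_support R w \<rightarrow> carrier R"
      using fin_funsD[OF w] by auto
    ultimately have "\<forall>y\<in>fun_support R w. w y = \<zero>"
      using B(2) unfolding lin_independent_def by blast
    then have w0: "w y = \<zero>" for y by (auto simp: fun_support_def)
    show "u = v"
    proof
      fix y
      have c: "u y \<in> carrier R" "v y \<in> carrier R" using fin_funsD(1) u v by auto
      have "u y \<oplus> \<ominus> v y = \<zero>" using w0[of y] c by (simp add: w_def R.l_minus)
      then show "u y = v y" using c by (metis R.add.inv_closed R.minus_equality R.minus_minus)
    qed
  qed
  ultimately show ?thesis by blast
qed

lemma coord_props:
  assumes "linear_basis R M B" "x \<in> carrier M"
  shows "coord R M B x \<in> fin_funs R B" "lin_comb R M (\<lambda>x. x) (coord R M B x) = x"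
  using theI'[OF basis_unique[OF assms]] unfolding coord_def by auto

lemma coord_eqI:
  assumes "linear_basis R M B" "u \<in> fin_funs R B" "lin_comb R M (\<lambda>x. x) u = x"
  shows "coord R M B x = u"
proof -
  have "(\<lambda>x. x) \<in> B \<rightarrow> carrier M" using assms(1) by (auto simp: linear_basis_def)
  then have "x \<in> carrier M" using lin_comb_closed[OF assms(2)] assms(3) by auto
  then show ?thesis
    unfolding coord_def using assms(2,3) by (intro the1_equality basis_unique[OF assms(1)]) auto
qed

lemma coord_closed: "linear_basis R M B \<Longrightarrow> x \<in> carrier M \<Longrightarrow> coord R M B x b \<in> carrier R"
  using fin_funsD(1)[OF coord_props(1)] .

lemma coord_add:
  assumes "linear_basis R M B" "x \<in> carrier M" "y \<in> carrier M"
  shows "coord R M B (x \<oplus>\<^bsub>M\<^esub> y) b = coord R M B x b \<oplus> coord R M B y b"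
proof -
  have i: "(\<lambda>x. x) \<in> B \<rightarrow> carrier M" using assms(1) by (auto simp: linear_basis_def)
  note x = coord_props[OF assms(1,2)] and y = coord_props[OF assms(1,3)]
  have "coord R M B (x \<oplus>\<^bsub>M\<^esub> y) = (\<lambda>b. coord R M B x b \<oplus> coord R M B y b)"
    by (rule coord_eqI[OF assms(1) fin_funs_add[OF x(1) y(1)]])
      (simp add: lin_comb_add[OF x(1) y(1) i] x y)
  then show ?thesis by simp
qed

lemma coord_smult:
  assumes "linear_basis R M B" "a \<in> carrier R" "x \<in> carrier M"
  shows "coord R M B (a \<odot>\<^bsub>M\<^esub> x) b = a \<otimes> coord R M B x b"
proof -
  have i: "(\<lambda>x. x) \<in> B \<rightarrow> carrier M" using assms(1) by (auto simp: linear_basis_def)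
  note x = coord_props[OF assms(1,3)]
  have "coord R M B (a \<odot>\<^bsub>M\<^esub> x) = (\<lambda>b. a \<otimes> coord R M B x b)"
    by (rule coord_eqI[OF assms(1) fin_funs_smult[OF x(1) assms(2)]])
      (simp add: lin_comb_smult[OF x(1) assms(2) i] x)
  then show ?thesis by simp
qed

lemma coord_basis:
  assumes "linear_basis R M B" "b \<in> B"
  shows "coord R M B b = single_fun R b"
  using assms single_fin_funs
  by (intro coord_eqI lin_comb_single) (auto simp: linear_basis_def)

lemma linear_maps_eq_on_basis:
  assumes "linear_basis R M B" "module R N" "f \<in> linear_maps R M N" "g \<in> linear_maps R M N"
    and "\<And>b. b \<in> B \<Longrightarrow> f b = g b" and "x \<in> carrier M"
  shows "f x = g x"
proof -
  interpret N: module R N by fact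
  have B: "B \<subseteq> carrier M" using assms(1) by (auto simp: linear_basis_def)
  then have i: "(\<lambda>x. x) \<in> B \<rightarrow> carrier M" by auto
  note x = coord_props[OF assms(1,6)]
  have "f (lin_comb R M (\<lambda>x. x) (coord R M B x)) = lin_comb R N (\<lambda>x. f x) (coord R M B x)"
    by (rule linear_maps_lin_comb[OF assms(2,3) x(1) i])
  also have "\<dots> = lin_comb R N (\<lambda>x. g x) (coord R M B x)"
    using B by (intro N.lin_comb_cong[OF x(1)] assms(5)) (auto simp: linear_mapsD(1)[OF assms(4)])
  also have "\<dots> = g (lin_comb R M (\<lambda>x. x) (coord R M B x))"
    by (rule linear_maps_lin_comb[OF assms(2,4) x(1) i, symmetric])
  finally show ?thesis by (simp add: x(2))
qed

end

section \<open>Set-theoretic bases of counital algebras without zero divisors\<close>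

text \<open>The common ground of arbitrary Hopf algebras and of \<open>U(L)\<close>: what is shown
  about set-theoretic bases here applies to the enveloping algebra as soon as these few axioms are
  verified for it.\<close>

locale counital_algebra = kalgebra K H + field K
  for K :: "('k, 'r) ring_scheme" (structure) and H :: "('k, 'h, 's) hopf_scheme" (structure) +
  assumes comult_linear: "comult H \<in> linear_maps K H (tensor K H H)"
    and comult_one: "comult H \<one>\<^bsub>H\<^esub> = pure_tensor K H H \<one>\<^bsub>H\<^esub> \<one>\<^bsub>H\<^esub>"
    and counit_closed: "x \<in> carrier H \<Longrightarrow> counit H x \<in> carrier K"
    and counit_add: "\<lbrakk>x \<in> carrier H; y \<in> carrier H\<rbrakk> \<Longrightarrow> counit H (x \<oplus>\<^bsub>H\<^esub> y) = counit H x \<oplus> counit H y"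
    and counit_smult:
      "\<lbrakk>a \<in> carrier K; x \<in> carrier H\<rbrakk> \<Longrightarrow> counit H (a \<odot>\<^bsub>H\<^esub> x) = a \<otimes> counit H x"
    and counit_left:
      "x \<in> carrier H \<Longrightarrow> tensor_lift K H (\<lambda>y z. counit H y \<odot>\<^bsub>H\<^esub> z) (comult H x) = x"
    and counit_right:
      "x \<in> carrier H \<Longrightarrow> tensor_lift K H (\<lambda>y z. counit H z \<odot>\<^bsub>H\<^esub> y) (comult H x) = x"
begin

sublocale T: tensor_algebra K H H
  by (intro tensor_algebra.intro kalgebra_axioms)

interpretation TM: kalgebra K "tensor K H H" by (rule T.kalgebra_tensor)

abbreviation "H2 \<equiv> tensor K H H"
abbreviation "pt \<equiv> pure_tensor K H H"

text \<open>Right multiplication by \<open>1 \<otimes> c\<close> in \<open>H \<otimes> H\<close>,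
  written as an induced map so that it matches the inner map in the definition of
  \<open>hopf_Phi\<close>.\<close>

definition mult_right :: "'h \<Rightarrow> ('h \<times> 'h \<Rightarrow> 'k) set \<Rightarrow> ('h \<times> 'h \<Rightarrow> 'k) set" where
  "mult_right c = tensor_lift K H2 (\<lambda>x y. pt x (y \<otimes>\<^bsub>H\<^esub> c))"

lemma mult_right_bilinear:
  assumes "c \<in> carrier H"
  shows "bilinear K H H H2 (\<lambda>x y. pt x (y \<otimes>\<^bsub>H\<^esub> c))"
  using assms linear_mapsD[OF T.pure_linear(1)] linear_mapsD[OF T.pure_linear(2)]
  by (intro bilinearI) (simp_all add: T.pure_closed A.l_distr smult_mult_left)

lemma mult_right_linear: "c \<in> carrier H \<Longrightarrow> mult_right c \<in> linear_maps K H2 H2"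
  unfolding mult_right_def by (rule T.tensor_lift_linear[OF TM.module_axioms mult_right_bilinear])

lemma mult_right_pure:
  "\<lbrakk>c \<in> carrier H; x \<in> carrier H; y \<in> carrier H\<rbrakk> \<Longrightarrow> mult_right c (pt x y) = pt x (y \<otimes>\<^bsub>H\<^esub> c)"
  unfolding mult_right_def by (rule T.tensor_lift_pure[OF TM.module_axioms mult_right_bilinear])

lemma mult_right_add:
  assumes "c \<in> carrier H" "d \<in> carrier H" "t \<in> carrier H2"
  shows "mult_right (c \<oplus>\<^bsub>H\<^esub> d) t = mult_right c t \<oplus>\<^bsub>H2\<^esub> mult_right d t"
  by (rule T.tensor_linear_eq[OF mult_right_linear[OF M.a_closed[OF assms(1,2)]]
        linear_maps_add[OF TM.module_axioms mult_right_linear[OF assms(1)] mult_right_linear[OF assms(2)]]])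
    (use assms in \<open>simp_all add: mult_right_pure A.r_distr linear_mapsD(2)[OF T.pure_linear(2)]\<close>)

lemma mult_right_smult:
  assumes "a \<in> carrier K" "c \<in> carrier H" "t \<in> carrier H2"
  shows "mult_right (a \<odot>\<^bsub>H\<^esub> c) t = a \<odot>\<^bsub>H2\<^esub> mult_right c t"
  by (rule T.tensor_linear_eq[OF mult_right_linear[OF smult_closed[OF assms(1,2)]]
        linear_maps_smult[OF TM.module_axioms mult_right_linear[OF assms(2)] assms(1)]])
    (use assms in \<open>simp_all add: mult_right_pure smult_mult_right linear_mapsD(3)[OF T.pure_linear(2)]\<close>)

text \<open>The inner map of \<open>hopf_Phi\<close> is \<open>\<Delta>(x)(1 \<otimes> y)\<close>.
  The outer one can be evaluated on \<open>b \<otimes> c\<close> because this expression is bilinear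
  in \<open>x\<close> and \<open>y\<close>.\<close>

lemma hopf_Phi_pure:
  assumes "b \<in> carrier H" "c \<in> carrier H"
  shows "hopf_Phi K H (pt b c) = mult_right c (comult H b)"
proof -
  have "bilinear K H H H2 (\<lambda>x y. mult_right y (comult H x))"
    using linear_mapsD[OF comult_linear] linear_mapsD[OF mult_right_linear]
    by (intro bilinearI) (simp_all add: mult_right_add mult_right_smult)
  then show ?thesis
    using T.tensor_lift_pure[OF TM.module_axioms _ assms, of "\<lambda>x y. mult_right y (comult H x)"]
    by (simp add: hopf_Phi_def mult_right_def)
qed

text \<open>The map \<open>\<beta>\<^sup>* \<otimes> id\<close>, where \<open>\<beta>\<^sup>*\<close> is the coordinate functional of \<open>\<beta> \<in> B\<close>.\<close>

definition contract :: "'h set \<Rightarrow> 'h \<Rightarrow> ('h \<times> 'h \<Rightarrow> 'k) set \<Rightarrow> 'h" where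
  "contract B \<beta> = tensor_lift K H (\<lambda>x y. coord K H B x \<beta> \<odot>\<^bsub>H\<^esub> y)"

definition expands :: "'h set \<Rightarrow> ('h \<times> 'h \<Rightarrow> 'k) set \<Rightarrow> 'h set \<Rightarrow> bool" where
  "expands B t A \<longleftrightarrow> t = (\<Oplus>\<^bsub>H2\<^esub>\<beta>\<in>A. pt \<beta> (contract B \<beta> t))"

context
  fixes B
  assumes B: "linear_basis K H B"
begin

lemma basis_carrier: "b \<in> B \<Longrightarrow> b \<in> carrier H"
  using B by (auto simp: linear_basis_def)

lemma contract_bilinear: "bilinear K H H H (\<lambda>x y. coord K H B x \<beta> \<odot>\<^bsub>H\<^esub> y)"
  by (rule functional_bilinear(1)[OF coord_closed[OF B] coord_add[OF B] coord_smult[OF B]])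

lemma contract_linear: "contract B \<beta> \<in> linear_maps K H2 H"
  unfolding contract_def by (rule T.tensor_lift_linear[OF module_axioms contract_bilinear])

lemma contract_pure:
  "\<lbrakk>x \<in> carrier H; y \<in> carrier H\<rbrakk> \<Longrightarrow> contract B \<beta> (pt x y) = coord K H B x \<beta> \<odot>\<^bsub>H\<^esub> y"
  unfolding contract_def by (rule T.tensor_lift_pure[OF module_axioms contract_bilinear])

lemma contract_basis:
  "\<lbrakk>b \<in> B; y \<in> carrier H\<rbrakk> \<Longrightarrow> contract B \<beta> (pt b y) = (if \<beta> = b then y else \<zero>\<^bsub>H\<^esub>)"
  by (simp add: contract_pure basis_carrier coord_basis[OF B] single_fun_def)

text \<open>The contraction reads off the first factor only, so a multiplication in the second
  factor passes through it. This is how the coefficients of \<open>\<Phi>(b \<otimes> c)\<close>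
  become the products \<open>h_\<beta> c\<close>.\<close>

lemma contract_mult_right:
  assumes "c \<in> carrier H" "t \<in> carrier H2"
  shows "contract B \<beta> (mult_right c t) = contract B \<beta> t \<otimes>\<^bsub>H\<^esub> c"
proof -
  have "(\<lambda>x. x \<otimes>\<^bsub>H\<^esub> c) \<in> linear_maps K H H"
    using assms(1) by (intro linear_mapsI) (simp_all add: A.l_distr smult_mult_left)
  from T.tensor_linear_eq[OF linear_maps_comp[OF mult_right_linear[OF assms(1)] contract_linear]
      linear_maps_comp[OF contract_linear this] assms(2)]
  show ?thesis
    using assms(1) by (simp add: mult_right_pure contract_pure smult_mult_left coord_closed[OF B])
qed

text \<open>Every tensor is \<open>\<Sum> \<beta> \<otimes> h_\<beta>\<close> with finitely many
  terms. Demanding the expansion over all larger finite sets as well is what makes the sum of two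
  tensors go through: both expand over the union of their sets.\<close>

lemma contract_expansion:
  assumes "t \<in> carrier H2"
  shows "\<exists>A. finite A \<and> A \<subseteq> B \<and> (\<forall>A'. finite A' \<and> A \<subseteq> A' \<and> A' \<subseteq> B \<longrightarrow> expands B t A')"
  using assms
proof (induction rule: T.tensor_induct)
  case (pure x y)
  note x = coord_props[OF B pure(1)]
  let ?A = "fun_support K (coord K H B x)"
  have "expands B (pt x y) A'"
    if A': "finite A'" "?A \<subseteq> A'" "A' \<subseteq> B" for A'
  proof -
    have c: "\<beta> \<in> carrier H" "coord K H B x \<beta> \<in> carrier K" if "\<beta> \<in> A'" for \<beta>
      using that A' basis_carrier coord_closed[OF B pure(1)] by auto
    have "x = (\<Oplus>\<^bsub>H\<^esub>\<beta>\<in>A'. coord K H B x \<beta> \<odot>\<^bsub>H\<^esub> \<beta>)"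
      using lin_comb_eq[OF x(1) A'(1,2), of "\<lambda>x. x"] c(1) x(2) by auto
    then have "pt x y = pt (\<Oplus>\<^bsub>H\<^esub>\<beta>\<in>A'. coord K H B x \<beta> \<odot>\<^bsub>H\<^esub> \<beta>) y" by simp
    also have "\<dots> = (\<Oplus>\<^bsub>H2\<^esub>\<beta>\<in>A'. pt (coord K H B x \<beta> \<odot>\<^bsub>H\<^esub> \<beta>) y)"
      using c by (intro linear_maps_finsum[OF module_axioms TM.module_axioms T.pure_linear(1)[OF pure(2)]]) auto
    also have "\<dots> = (\<Oplus>\<^bsub>H2\<^esub>\<beta>\<in>A'. pt \<beta> (contract B \<beta> (pt x y)))"
      using c pure
      by (intro TM.finsum_cong' refl Pi_I)
        (simp_all add: contract_pure T.pure_closed linear_mapsD(3)[OF T.pure_linear(1)] linear_mapsD(3)[OF T.pure_linear(2)])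
    finally show ?thesis unfolding expands_def .
  qed
  then show ?case using fin_funsD[OF x(1)] by (intro exI[of _ ?A]) auto
next
  case (add s t)
  obtain A1 where A1: "finite A1" "A1 \<subseteq> B"
    "\<And>A'. finite A' \<Longrightarrow> A1 \<subseteq> A' \<Longrightarrow> A' \<subseteq> B \<Longrightarrow> expands B s A'"
    using add.IH(1) by (elim exE conjE) (rule that, assumption, assumption, simp)
  obtain A2 where A2: "finite A2" "A2 \<subseteq> B"
    "\<And>A'. finite A' \<Longrightarrow> A2 \<subseteq> A' \<Longrightarrow> A' \<subseteq> B \<Longrightarrow> expands B t A'"
    using add.IH(2) by (elim exE conjE) (rule that, assumption, assumption, simp)
  have "expands B (s \<oplus>\<^bsub>H2\<^esub> t) A'"
    if A': "finite A'" "A1 \<union> A2 \<subseteq> A'" "A' \<subseteq> B" for A'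
  proof -
    have c: "\<beta> \<in> carrier H" if "\<beta> \<in> A'" for \<beta> using that A' basis_carrier by auto
    note cl = linear_mapsD(1)[OF contract_linear]
    have "(\<Oplus>\<^bsub>H2\<^esub>\<beta>\<in>A'. pt \<beta> (contract B \<beta> (s \<oplus>\<^bsub>H2\<^esub> t))) =
        (\<Oplus>\<^bsub>H2\<^esub>\<beta>\<in>A'. pt \<beta> (contract B \<beta> s) \<oplus>\<^bsub>H2\<^esub> pt \<beta> (contract B \<beta> t))"
      using c add.hyps cl
      by (intro TM.finsum_cong' refl Pi_I)
        (simp_all add: T.pure_closed linear_mapsD(2)[OF T.pure_linear(2)] linear_mapsD(2)[OF contract_linear])
    also have "\<dots> = (\<Oplus>\<^bsub>H2\<^esub>\<beta>\<in>A'. pt \<beta> (contract B \<beta> s)) \<oplus>\<^bsub>H2\<^esub> (\<Oplus>\<^bsub>H2\<^esub>\<beta>\<in>A'. pt \<beta> (contract B \<beta> t))"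
      using c add.hyps cl by (intro TM.finsum_addf Pi_I) (simp_all add: T.pure_closed)
    also have "\<dots> = s \<oplus>\<^bsub>H2\<^esub> t"
      using A1(3)[of A', unfolded expands_def] A2(3)[of A', unfolded expands_def] A' by auto
    finally show ?thesis unfolding expands_def ..
  qed
  then show ?case using A1 A2 by (intro exI[of _ "A1 \<union> A2"]) auto
qed

text \<open>Both tensors are rebuilt from their contractions over one common finite set.\<close>

lemma contract_inject:
  assumes "s \<in> carrier H2" "t \<in> carrier H2" "\<And>\<beta>. \<beta> \<in> B \<Longrightarrow> contract B \<beta> s = contract B \<beta> t"
  shows "s = t"
proof -
  obtain A1 where A1: "finite A1" "A1 \<subseteq> B"
    "\<And>A'. finite A' \<Longrightarrow> A1 \<subseteq> A' \<Longrightarrow> A' \<subseteq> B \<Longrightarrow> expands B s A'"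
    using contract_expansion[OF assms(1)] by (elim exE conjE) (rule that, assumption, assumption, simp)
  obtain A2 where A2: "finite A2" "A2 \<subseteq> B"
    "\<And>A'. finite A' \<Longrightarrow> A2 \<subseteq> A' \<Longrightarrow> A' \<subseteq> B \<Longrightarrow> expands B t A'"
    using contract_expansion[OF assms(2)] by (elim exE conjE) (rule that, assumption, assumption, simp)
  have "s = (\<Oplus>\<^bsub>H2\<^esub>\<beta>\<in>A1 \<union> A2. pt \<beta> (contract B \<beta> s))"
    using A1(3)[of "A1 \<union> A2", unfolded expands_def] A1(1,2) A2(1,2) by blast
  also have "\<dots> = (\<Oplus>\<^bsub>H2\<^esub>\<beta>\<in>A1 \<union> A2. pt \<beta> (contract B \<beta> t))"
    using assms A1 A2 basis_carrier linear_mapsD(1)[OF contract_linear]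
    by (intro TM.finsum_cong' refl Pi_I) (auto intro!: T.pure_closed)
  also have "\<dots> = t" using A2(3)[of "A1 \<union> A2", unfolded expands_def] A1(1,2) A2(1,2) by auto
  finally show ?thesis .
qed

lemma basis_nonzero:
  assumes "b \<in> B"
  shows "b \<noteq> \<zero>\<^bsub>H\<^esub>"
proof
  assume "b = \<zero>\<^bsub>H\<^esub>"
  then have "coord K H B b b = \<zero> \<otimes> coord K H B b b"
    using coord_smult[OF B, of \<zero> b b] basis_carrier[OF assms] by simp
  then show False using assms by (simp add: coord_basis[OF B assms] single_fun_def)
qed

end

lemma comult_set_theoretic_basis:
  assumes "noncomm_domain H" "Phi_set_theoretic_basis K H B" "b \<in> B"
  shows "counit H b \<noteq> \<zero>"
    and "comult H b = inv (counit H b) \<odot>\<^bsub>H2\<^esub> pt b b"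
proof -
  have B: "linear_basis K H B" using assms(2) by (simp add: Phi_set_theoretic_basis_def)
  note carr = basis_carrier[OF B]
  note con = contract_basis[OF B] contract_mult_right[OF B]
  have b: "b \<in> carrier H" by (rule carr[OF assms(3)])
  have \<Delta>: "comult H b \<in> carrier H2" by (rule linear_mapsD(1)[OF comult_linear b])
  \<comment> \<open>The second argument of \<open>\<Phi>\<close> only has to be a nonzero basis
    element, so that it can be cancelled from \<open>h_\<beta> c = 0\<close>; \<open>b\<close>
    itself serves.\<close>
  obtain b' c' where b': "b' \<in> B" "c' \<in> B" "hopf_Phi K H (pt b b) = pt b' c'"
    using assms(2,3) unfolding Phi_set_theoretic_basis_def by blast
  define h where "h = contract B b' (comult H b)"
  have h: "h \<in> carrier H" unfolding h_def by (rule linear_mapsD(1)[OF contract_linear[OF B] \<Delta>])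
  have zero: "contract B \<beta> (comult H b) = \<zero>\<^bsub>H\<^esub>" if "\<beta> \<noteq> b'" for \<beta>
  proof -
    have "contract B \<beta> (comult H b) \<otimes>\<^bsub>H\<^esub> b = contract B \<beta> (pt b' c')"
      using b'(3) by (simp add: hopf_Phi_pure b con(2)[symmetric] \<Delta>)
    also have "\<dots> = \<zero>\<^bsub>H\<^esub>" using that b' carr by (simp add: con(1))
    finally show ?thesis
      using assms(1) basis_nonzero[OF B assms(3)] b linear_mapsD(1)[OF contract_linear[OF B] \<Delta>]
      unfolding noncomm_domain_def by blast
  qed
  have eq: "comult H b = pt b' h"
  proof (rule contract_inject[OF B \<Delta>])
    show "pt b' h \<in> carrier H2" using carr b' h by (intro T.pure_closed) auto
    show "contract B \<beta> (comult H b) = contract B \<beta> (pt b' h)" if "\<beta> \<in> B" for \<beta>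
      using zero[of \<beta>] b' h by (auto simp: con(1) h_def)
  qed
  have b'c: "b' \<in> carrier H" by (rule carr[OF b'(1)])
  note counit_bilinear = functional_bilinear[OF counit_closed counit_add counit_smult]
  from T.tensor_lift_pure[OF module_axioms counit_bilinear(1) b'c h]
  have l: "counit H b' \<odot>\<^bsub>H\<^esub> h = b" using counit_left[OF b] by (simp add: eq)
  from T.tensor_lift_pure[OF module_axioms counit_bilinear(2) b'c h]
  have r: "counit H h \<odot>\<^bsub>H\<^esub> b' = b" using counit_right[OF b] by (simp add: eq)
  \<comment> \<open>Comparing \<open>b\<close>-coordinates in \<open>\<epsilon>(h) b' = b\<close>:
    the left-hand side has coordinate zero unless \<open>b' = b\<close>.\<close>
  have "\<one> = coord K H B b b" by (simp add: coord_basis[OF B assms(3)] single_fun_def)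
  also have "\<dots> = counit H h \<otimes> coord K H B b' b"
    using coord_smult[OF B counit_closed[OF h] b'c, of b] r by simp
  also have "\<dots> = (if b = b' then counit H h else \<zero>)"
    using counit_closed[OF h] by (simp add: coord_basis[OF B b'(1)] single_fun_def)
  finally have bb: "b' = b" using one_not_zero by (auto split: if_splits)
  \<comment> \<open>Otherwise \<open>b = \<epsilon>(b) h\<close> would be zero.\<close>
  show nz: "counit H b \<noteq> \<zero>"
    using l h basis_nonzero[OF B assms(3)] by (auto simp: bb)
  then have u: "counit H b \<in> Units K" using counit_closed[OF b] by (simp add: field_Units)
  have "inv (counit H b) \<odot>\<^bsub>H\<^esub> b = inv (counit H b) \<odot>\<^bsub>H\<^esub> (counit H b \<odot>\<^bsub>H\<^esub> h)"
    using l bb by simp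
  also have "\<dots> = h"
    using u h counit_closed[OF b] by (simp add: smult_assoc1[symmetric])
  finally show "comult H b = inv (counit H b) \<odot>\<^bsub>H2\<^esub> pt b b"
    using eq bb u b linear_mapsD(3)[OF T.pure_linear(2)[OF b], of "inv (counit H b)" b] by simp
qed

text \<open>The unit has a nonzero coordinate \<open>c\<close> at some \<open>\<beta>\<close>.
  Substituting \<open>\<epsilon>(\<beta>)^-1 \<beta> = 1\<close> into the identity for
  \<open>x\<close> turns it into \<open>\<beta>*(x) 1 = \<beta>*(x) 1 + c x\<close>, so
  \<open>c x = 0\<close>.\<close>

lemma primitive_zero:
  assumes "noncomm_domain H" "Phi_set_theoretic_basis K H B" "x \<in> carrier H"
    and "comult H x = pt x \<one>\<^bsub>H\<^esub> \<oplus>\<^bsub>H2\<^esub> pt \<one>\<^bsub>H\<^esub> x"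
  shows "x = \<zero>\<^bsub>H\<^esub>"
proof -
  have B: "linear_basis K H B" using assms(2) by (simp add: Phi_set_theoretic_basis_def)
  let ?e = "\<lambda>\<beta>. inv (counit H \<beta>)"
  have inv: "?e b \<in> carrier K" "?e b \<otimes> counit H b = \<one>" "counit H b \<otimes> ?e b = \<one>" if "b \<in> B" for b
    using comult_set_theoretic_basis(1)[OF assms(1,2) that] counit_closed[OF basis_carrier[OF B that]]
    by (simp_all add: field_Units)
  \<comment> \<open>Both sides are linear in \<open>y\<close>. On a basis element \<open>b\<close>
    the contraction of \<open>\<epsilon>(b)^-1 b \<otimes> b\<close> at \<open>\<beta>\<close> is
    zero unless \<open>b = \<beta>\<close>.\<close>
  have con: "contract B \<beta> (comult H y) = (coord K H B y \<beta> \<otimes> ?e \<beta>) \<odot>\<^bsub>H\<^esub> \<beta>"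
    if \<beta>: "\<beta> \<in> B" and y: "y \<in> carrier H" for \<beta> y
  proof (rule linear_maps_eq_on_basis[OF B module_axioms
        linear_maps_comp[OF comult_linear contract_linear[OF B]] _ _ y])
    note \<beta>' = basis_carrier[OF B \<beta>]
    show "(\<lambda>y. (coord K H B y \<beta> \<otimes> ?e \<beta>) \<odot>\<^bsub>H\<^esub> \<beta>) \<in> linear_maps K H H"
      using inv[OF \<beta>] \<beta>'
      by (intro linear_mapsI) (simp_all add: coord_closed[OF B] coord_add[OF B] coord_smult[OF B]
          R.l_distr smult_l_distr smult_assoc1)
    show "contract B \<beta> (comult H b) = (coord K H B b \<beta> \<otimes> ?e \<beta>) \<odot>\<^bsub>H\<^esub> \<beta>" if b: "b \<in> B" for b
    proof -
      note b' = basis_carrier[OF B b]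
      have "contract B \<beta> (comult H b) = ?e b \<odot>\<^bsub>H\<^esub> contract B \<beta> (pt b b)"
        using inv(1)[OF b] b'
        by (simp add: comult_set_theoretic_basis(2)[OF assms(1,2) b] linear_mapsD(3)[OF contract_linear[OF B]]
            T.pure_closed)
      then show ?thesis
        using inv(1)[OF b] inv(1)[OF \<beta>] b' \<beta>'
        by (simp add: contract_basis[OF B b b'] coord_basis[OF B b] single_fun_def)
    qed
  qed
  have one: "(coord K H B \<one>\<^bsub>H\<^esub> \<beta> \<otimes> ?e \<beta>) \<odot>\<^bsub>H\<^esub> \<beta> = coord K H B \<one>\<^bsub>H\<^esub> \<beta> \<odot>\<^bsub>H\<^esub> \<one>\<^bsub>H\<^esub>" if "\<beta> \<in> B" for \<beta>
    using con[OF that, of "\<one>\<^bsub>H\<^esub>"] by (simp add: comult_one contract_pure[OF B])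
  have prim: "(coord K H B x \<beta> \<otimes> ?e \<beta>) \<odot>\<^bsub>H\<^esub> \<beta> =
      coord K H B x \<beta> \<odot>\<^bsub>H\<^esub> \<one>\<^bsub>H\<^esub> \<oplus>\<^bsub>H\<^esub> coord K H B \<one>\<^bsub>H\<^esub> \<beta> \<odot>\<^bsub>H\<^esub> x" if "\<beta> \<in> B" for \<beta>
    using con[OF that assms(3)] assms(3,4)
    by (simp add: contract_pure[OF B] linear_mapsD(2)[OF contract_linear[OF B]] T.pure_closed)
  \<comment> \<open>If all coordinates of the unit vanished it would be zero, which the definition
    of a domain rules out.\<close>
  have "coord K H B \<one>\<^bsub>H\<^esub> \<noteq> (\<lambda>x. \<zero>)"
    using assms(1) coord_props(2)[OF B A.one_closed] by (auto simp: lin_comb_zero noncomm_domain_def)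
  then obtain \<beta> where \<beta>0: "coord K H B \<one>\<^bsub>H\<^esub> \<beta> \<noteq> \<zero>" by auto
  then have \<beta>: "\<beta> \<in> B" using fin_funsD(5)[OF coord_props(1)[OF B A.one_closed]] by auto
  define c where "c = coord K H B \<one>\<^bsub>H\<^esub> \<beta>"
  have c: "c \<in> carrier K" "inv c \<in> carrier K" "inv c \<otimes> c = \<one>"
    using \<beta>0 coord_closed[OF B A.one_closed] by (auto simp: c_def field_Units)
  note cancel = arg_cong[of _ _ "\<lambda>y. inv c \<odot>\<^bsub>H\<^esub> y"]
  have \<beta>': "?e \<beta> \<odot>\<^bsub>H\<^esub> \<beta> = \<one>\<^bsub>H\<^esub>"
    using cancel[OF one[OF \<beta>]] c inv(1)[OF \<beta>] basis_carrier[OF B \<beta>]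
    by (simp add: c_def[symmetric] smult_assoc1[symmetric] R.m_assoc[symmetric])
  have "coord K H B x \<beta> \<odot>\<^bsub>H\<^esub> \<one>\<^bsub>H\<^esub> = coord K H B x \<beta> \<odot>\<^bsub>H\<^esub> \<one>\<^bsub>H\<^esub> \<oplus>\<^bsub>H\<^esub> c \<odot>\<^bsub>H\<^esub> x"
    using prim[OF \<beta>] \<beta>' inv(1)[OF \<beta>] basis_carrier[OF B \<beta>] coord_closed[OF B assms(3)]
    by (simp add: c_def[symmetric] smult_assoc1)
  then have "c \<odot>\<^bsub>H\<^esub> x = \<zero>\<^bsub>H\<^esub>"
    using c assms(3) coord_closed[OF B assms(3)] by (simp add: M.add.r_cancel_one')
  then have "inv c \<odot>\<^bsub>H\<^esub> (c \<odot>\<^bsub>H\<^esub> x) = \<zero>\<^bsub>H\<^esub>" using c by simp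
  then show ?thesis using c assms(3) by (simp add: smult_assoc1[symmetric])
qed

end

lemma hopf_algebra_counital: "counital_algebra K H" if "hopf_algebra K H"
proof -
  interpret hopf_algebra K H by fact
  have kalg: "kalgebra K H"
    by (intro kalgebra.intro kalgebra_axioms.intro module_axioms hopf_algebra.axioms(3)[OF that] smult_mult_left smult_mult_right)
  interpret T: tensor_algebra K H H by (intro tensor_algebra.intro kalg)
  show ?thesis
    using comult_hom counit_hom
    by (intro counital_algebra.intro counital_algebra_axioms.intro kalg field_axioms comult_linear
        counit_smult counit_left counit_right)
      (auto simp: ring_hom_def T.one_tensor)
qed

section \<open>The enveloping algebra as a counital algebra\<close>

text \<open>Scalar multiplication by \<open>a\<close> is multiplication by
  \<open>a \<odot> 1\<close>, under which an ideal is closed.\<close>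

lemma (in kalgebra) ideal_submodule:
  assumes "ideal I A"
  shows "submodule I K A"
proof -
  interpret I: ideal I A by fact
  have "a \<odot>\<^bsub>A\<^esub> x = (a \<odot>\<^bsub>A\<^esub> \<one>\<^bsub>A\<^esub>) \<otimes>\<^bsub>A\<^esub> x" if "a \<in> carrier K" "x \<in> I" for a x
    using that by (simp add: smult_mult_left)
  then have "a \<odot>\<^bsub>A\<^esub> x \<in> I" if "a \<in> carrier K" "x \<in> I" for a x
    using that by (metis A.one_closed I.I_l_closed smult_closed)
  then show ?thesis
    using I.a_subset by (intro submoduleI) auto
qed

lemma (in module) add_minus_cancel:
  "x \<in> carrier M \<Longrightarrow> y \<in> carrier M \<Longrightarrow> x \<oplus>\<^bsub>M\<^esub> y \<ominus>\<^bsub>M\<^esub> x = y"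
  by (simp add: a_minus_def M.a_comm[of x y] M.a_assoc M.r_neg)

text \<open>For records of different types that agree on the algebra fields: the enveloping algebra
  extends \<open>U\<close> by the Hopf structure maps.\<close>

lemma kalgebra_cong:
  assumes "kalgebra K A" "carrier B = carrier A" "monoid.mult B = monoid.mult A" "one B = one A"
    "zero B = zero A" "add B = add A" "smult B = smult A"
  shows "kalgebra K B"
proof -
  interpret A: kalgebra K A by fact
  have "abelian_group B"
  proof (rule abelian_groupI)
    fix x assume "x \<in> carrier B"
    then show "\<exists>y\<in>carrier B. y \<oplus>\<^bsub>B\<^esub> x = \<zero>\<^bsub>B\<^esub>"
      using assms(2-) A.M.l_neg[of x] by (intro bexI[of _ "\<ominus>\<^bsub>A\<^esub> x"]) simp_all
  qed (use assms(2-) in \<open>simp_all add: A.M.a_ac\<close>)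
  then have "module K B"
    using assms(2-)
    by (intro moduleI A.R.is_cring)
      (simp_all add: A.smult_l_distr A.smult_r_distr A.smult_assoc1)
  moreover have "Group.monoid B"
    using assms(2-) by (intro monoidI) (simp_all add: A.A.m_assoc)
  ultimately show ?thesis
    using assms(2-)
    by (intro kalgebraI)
      (simp_all add: A.A.l_distr A.A.r_distr A.smult_mult_left A.smult_mult_right)
qed

section \<open>The word algebra and its quotient \<open>U\<close>\<close>

lemma monoid_word_monoid: "Group.monoid (word_monoid S)"
  by (rule monoidI) (auto simp: word_monoid_def)

lemma word_monoid_simps:
  "carrier (word_monoid S) = lists S" "u \<otimes>\<^bsub>word_monoid S\<^esub> v = u @ v" "\<one>\<^bsub>word_monoid S\<^esub> = []"
  by (simp_all add: word_monoid_def)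

context lie_algebra
begin

abbreviation "W \<equiv> word_algebra K L"
abbreviation "I \<equiv> env_ideal K L"
abbreviation "U \<equiv> env_algebra K L"
abbreviation "ew \<equiv> env_word K L"

sublocale W: monoid_alg K "word_monoid (carrier L)"
  by (intro monoid_alg.intro R.is_cring monoid_word_monoid)

lemma kalgebra_word: "kalgebra K W"
  unfolding word_algebra_def by (rule W.kalgebra)

sublocale W: kalgebra K W by (rule kalgebra_word)

lemma single_word: "w \<in> lists (carrier L) \<Longrightarrow> single_fun K w \<in> carrier W"
  unfolding word_algebra_def by (rule W.single_closed) (simp add: word_monoid_simps)

lemma single_word_mult:
  "v \<in> lists (carrier L) \<Longrightarrow> w \<in> lists (carrier L) \<Longrightarrow>
    single_fun K v \<otimes>\<^bsub>W\<^esub> single_fun K w = single_fun K (v @ w)"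
  unfolding word_algebra_def by (subst W.single_mult) (simp_all add: word_monoid_simps)

lemma bracket_closed: "x \<in> carrier L \<Longrightarrow> y \<in> carrier L \<Longrightarrow> bracket L x y \<in> carrier L"
  using linear_mapsD(1)[OF bracket_linear_left] .

lemma env_relsI:
  "\<lbrakk>x \<in> carrier L; y \<in> carrier L\<rbrakk> \<Longrightarrow>
    single_fun K [x \<oplus>\<^bsub>L\<^esub> y] \<ominus>\<^bsub>W\<^esub> (single_fun K [x] \<oplus>\<^bsub>W\<^esub> single_fun K [y]) \<in> env_rels K L"
  "\<lbrakk>a \<in> carrier K; x \<in> carrier L\<rbrakk> \<Longrightarrow>
    single_fun K [a \<odot>\<^bsub>L\<^esub> x] \<ominus>\<^bsub>W\<^esub> a \<odot>\<^bsub>W\<^esub> single_fun K [x] \<in> env_rels K L"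
  "\<lbrakk>x \<in> carrier L; y \<in> carrier L\<rbrakk> \<Longrightarrow>
    (single_fun K [x, y] \<ominus>\<^bsub>W\<^esub> single_fun K [y, x]) \<ominus>\<^bsub>W\<^esub> single_fun K [bracket L x y] \<in> env_rels K L"
  unfolding env_rels_def Let_def by blast+

lemma env_rels_cases:
  assumes "s \<in> env_rels K L"
  obtains
    x y where "x \<in> carrier L" "y \<in> carrier L"
      "s = single_fun K [x \<oplus>\<^bsub>L\<^esub> y] \<ominus>\<^bsub>W\<^esub> (single_fun K [x] \<oplus>\<^bsub>W\<^esub> single_fun K [y])"
  | a x where "a \<in> carrier K" "x \<in> carrier L"
      "s = single_fun K [a \<odot>\<^bsub>L\<^esub> x] \<ominus>\<^bsub>W\<^esub> a \<odot>\<^bsub>W\<^esub> single_fun K [x]"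
  | x y where "x \<in> carrier L" "y \<in> carrier L"
      "s = (single_fun K [x, y] \<ominus>\<^bsub>W\<^esub> single_fun K [y, x]) \<ominus>\<^bsub>W\<^esub> single_fun K [bracket L x y]"
  using assms unfolding env_rels_def Let_def
  by (elim UnE CollectE exE conjE)
    ((rule that(1); assumption), (rule that(2); assumption), (rule that(3); assumption))

lemma env_rels_carrier: "env_rels K L \<subseteq> carrier W"
  by (rule subsetI, erule env_rels_cases) (simp_all add: single_word bracket_closed)

lemma ideal_env: "ideal I W"
  unfolding env_ideal_def by (rule W.A.genideal_ideal[OF env_rels_carrier])

lemma env_rels_ideal: "env_rels K L \<subseteq> I"
  unfolding env_ideal_def by (rule W.A.genideal_self[OF env_rels_carrier])

lemma env_ideal_minimal: "ideal J W \<Longrightarrow> env_rels K L \<subseteq> J \<Longrightarrow> I \<subseteq> J"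
  unfolding env_ideal_def by (rule W.A.genideal_minimal)

sublocale E: quotient_of_module K W I
  by (intro quotient_of_module.intro quotient_of_module_axioms.intro W.module_axioms
      W.ideal_submodule ideal_env)

lemma kalgebra_env: "kalgebra K U"
  unfolding env_algebra_def by (rule E.kalgebra_quot(1)[OF kalgebra_word ideal_env])

sublocale U: kalgebra K U by (rule kalgebra_env)

lemma env_cases:
  assumes "c \<in> carrier U"
  obtains u where "u \<in> carrier W" "c = E.cls u"
  using E.quot_cases assms unfolding env_algebra_def by blast

lemma cls_linear: "E.cls \<in> linear_maps K W U"
  unfolding env_algebra_def by (rule E.cls_linear)

lemma cls_mult: "u \<in> carrier W \<Longrightarrow> v \<in> carrier W \<Longrightarrow> E.cls (u \<otimes>\<^bsub>W\<^esub> v) = E.cls u \<otimes>\<^bsub>U\<^esub> E.cls v"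
  unfolding env_algebra_def by (rule E.kalgebra_quot(2)[OF kalgebra_word ideal_env, symmetric])

lemma env_word_closed: "w \<in> lists (carrier L) \<Longrightarrow> ew w \<in> carrier U"
  unfolding env_word_def by (rule linear_mapsD(1)[OF cls_linear single_word])

lemma env_word_append:
  "v \<in> lists (carrier L) \<Longrightarrow> w \<in> lists (carrier L) \<Longrightarrow> ew (v @ w) = ew v \<otimes>\<^bsub>U\<^esub> ew w"
  unfolding env_word_def by (simp add: cls_mult[symmetric] single_word single_word_mult)

lemma env_word_Nil: "ew [] = \<one>\<^bsub>U\<^esub>"
  unfolding env_word_def
  using E.kalgebra_quot(3)[OF kalgebra_word ideal_env]
  by (simp add: env_algebra_def word_algebra_def monoid_algebra_simps(2) word_monoid_simps)

lemma env_word_Cons: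
  "x \<in> carrier L \<Longrightarrow> w \<in> lists (carrier L) \<Longrightarrow> ew (x # w) = ew [x] \<otimes>\<^bsub>U\<^esub> ew w"
  using env_word_append[of "[x]" w] by simp

lemma cls_eq_zero_iff: "u \<in> carrier W \<Longrightarrow> E.cls u = \<zero>\<^bsub>U\<^esub> \<longleftrightarrow> u \<in> I"
  unfolding env_algebra_def by (rule E.cls_eq_zero_iff)

lemma cls_eqI:
  assumes "u \<ominus>\<^bsub>W\<^esub> v \<in> env_rels K L" "u \<in> carrier W" "v \<in> carrier W"
  shows "E.cls u = E.cls v"
  using assms env_rels_ideal by (simp add: E.cls_eq_iff subset_iff)

lemma env_letter_linear: "(\<lambda>x. ew [x]) \<in> linear_maps K L U"
  unfolding env_word_def
  by (intro linear_mapsI)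
    (simp_all add: linear_mapsD(2,3)[OF cls_linear, symmetric] linear_mapsD(1)[OF cls_linear]
      single_word cls_eqI env_relsI)

lemma env_letter_commute:
  assumes "x \<in> carrier L" "y \<in> carrier L"
  shows "ew [x] \<otimes>\<^bsub>U\<^esub> ew [y] = ew [y] \<otimes>\<^bsub>U\<^esub> ew [x] \<oplus>\<^bsub>U\<^esub> ew [bracket L x y]"
proof -
  have "single_fun K [x, y] \<ominus>\<^bsub>W\<^esub> (single_fun K [y, x] \<oplus>\<^bsub>W\<^esub> single_fun K [bracket L x y]) \<in> env_rels K L"
    using env_relsI(3)[OF assms] assms
    by (simp add: a_minus_def W.M.minus_add W.M.a_assoc single_word bracket_closed)
  from cls_eqI[OF this] have "ew [x, y] = ew [y, x] \<oplus>\<^bsub>U\<^esub> ew [bracket L x y]"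
    using assms by (simp add: env_word_def single_word bracket_closed linear_mapsD[OF cls_linear])
  then show ?thesis
    using env_word_append[of "[x]" "[y]"] env_word_append[of "[y]" "[x]"] assms by simp
qed

end

subsection \<open>Actions of a Lie algebra\<close>

text \<open>Three modules will carry such an action: \<open>U\<close> by left multiplication,
  \<open>U \<otimes> U\<close> by left multiplication with
  \<open>x \<otimes> 1 + 1 \<otimes> x\<close>, and the polynomials. The first two yield the
  coproduct and its counit laws, the third the Poincare-Birkhoff-Witt theorem.\<close>

locale lie_rep = lie_algebra K L + P: module K P
  for K (structure) and L (structure) and P (structure) +
  fixes \<rho>
  assumes bilinear: "bilinear K L P P \<rho>"
    and commute: "\<lbrakk>x \<in> carrier L; y \<in> carrier L; p \<in> carrier P\<rbrakk> \<Longrightarrow>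
      \<rho> x (\<rho> y p) = \<rho> y (\<rho> x p) \<oplus>\<^bsub>P\<^esub> \<rho> (bracket L x y) p"
begin

definition "act u p = lin_comb K P (\<lambda>w. foldr \<rho> w p) u"

lemma rho_closed: "x \<in> carrier L \<Longrightarrow> p \<in> carrier P \<Longrightarrow> \<rho> x p \<in> carrier P"
  by (rule bilinearD(1)[OF bilinear])

lemma foldr_closed: "w \<in> lists (carrier L) \<Longrightarrow> p \<in> carrier P \<Longrightarrow> foldr \<rho> w p \<in> carrier P"
  by (induction w) (auto simp: rho_closed)

lemma foldr_linear: "w \<in> lists (carrier L) \<Longrightarrow> foldr \<rho> w \<in> linear_maps K P P"
proof (induction w)
  case Nil
  then show ?case by (auto simp: linear_maps_def)
next
  case (Cons x w)
  then have "x \<in> carrier L" "foldr \<rho> w \<in> linear_maps K P P" by simp_all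
  from linear_maps_comp[OF this(2) bilinearD(3)[OF bilinear this(1)]]
  show ?case by (simp add: comp_def)
qed

lemma act_linear: "p \<in> carrier P \<Longrightarrow> (\<lambda>u. act u p) \<in> linear_maps K W P"
  unfolding act_def word_algebra_def
  by (intro P.lin_comb_linear) (simp add: word_monoid_simps foldr_closed)

lemma act_single: "w \<in> lists (carrier L) \<Longrightarrow> p \<in> carrier P \<Longrightarrow> act (single_fun K w) p = foldr \<rho> w p"
  unfolding act_def by (rule P.lin_comb_single) (rule foldr_closed)

lemma act_eqI:
  assumes "f \<in> linear_maps K W P" "g \<in> linear_maps K W P" "u \<in> carrier W"
    and "\<And>w. w \<in> lists (carrier L) \<Longrightarrow> f (single_fun K w) = g (single_fun K w)"
  shows "f u = g u"
  by (rule P.linear_maps_eq_on_singles[OF assms(1,2)[unfolded word_algebra_def] _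
        assms(3)[unfolded word_algebra_def]])
    (simp add: assms(4) word_monoid_simps)

lemma act_linear_right:
  assumes u: "u \<in> carrier W"
  shows "act u \<in> linear_maps K P P"
proof (rule linear_mapsI)
  note L = act_linear
  show "act u p \<in> carrier P" if "p \<in> carrier P" for p by (rule linear_mapsD(1)[OF L[OF that] u])
  show "act u (p \<oplus>\<^bsub>P\<^esub> q) = act u p \<oplus>\<^bsub>P\<^esub> act u q" if p: "p \<in> carrier P" and q: "q \<in> carrier P" for p q
    by (rule act_eqI[OF L[OF P.M.a_closed[OF p q]] linear_maps_add[OF P.module_axioms L[OF p] L[OF q]] u])
      (use p q in \<open>simp add: act_single linear_mapsD[OF foldr_linear]\<close>)
  show "act u (a \<odot>\<^bsub>P\<^esub> p) = a \<odot>\<^bsub>P\<^esub> act u p" if a: "a \<in> carrier K" and p: "p \<in> carrier P" for a p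
    by (rule act_eqI[OF L[OF P.smult_closed[OF a p]] linear_maps_smult[OF P.module_axioms L[OF p] a] u])
      (use a p in \<open>simp add: act_single linear_mapsD[OF foldr_linear]\<close>)
qed

lemma act_closed: "u \<in> carrier W \<Longrightarrow> p \<in> carrier P \<Longrightarrow> act u p \<in> carrier P"
  by (rule linear_mapsD(1)[OF act_linear_right])

lemma act_mult:
  assumes u: "u \<in> carrier W" and v: "v \<in> carrier W" and p: "p \<in> carrier P"
  shows "act (u \<otimes>\<^bsub>W\<^esub> v) p = act u (act v p)"
proof -
  note wl = W.mult_linear[folded word_algebra_def]
  have 1: "act (single_fun K w \<otimes>\<^bsub>W\<^esub> v) p = act (single_fun K w) (act v p)"
    if w: "w \<in> lists (carrier L)" for w
    by (rule act_eqI[OF linear_maps_comp[OF wl(1)[OF single_word[OF w]] act_linear[OF p]]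
          linear_maps_comp[OF act_linear[OF p] act_linear_right[OF single_word[OF w]]] v])
      (use w p in \<open>simp add: single_word_mult act_single foldr_closed\<close>)
  show ?thesis
    by (rule act_eqI[OF linear_maps_comp[OF wl(2)[OF v] act_linear[OF p]]
          act_linear[OF act_closed[OF v p]] u]) (rule 1)
qed

text \<open>The action of words factors through \<open>U\<close>: the words that annihilate the
  whole module form an ideal, and the three kinds of relations lie in it by bilinearity and the
  commutation rule.\<close>

lemma act_ideal:
  assumes "u \<in> I" "p \<in> carrier P"
  shows "act u p = \<zero>\<^bsub>P\<^esub>"
proof -
  \<comment> \<open>Annihilating every \<open>p\<close>, rather than the given one, makes this a
    two-sided ideal: in \<open>u v\<close> the element \<open>v\<close> moves \<open>p\<close>, and
    \<open>u\<close> must still annihilate the result.\<close>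
  let ?J = "{u \<in> carrier W. \<forall>p\<in>carrier P. act u p = \<zero>\<^bsub>P\<^esub>}"
  have zero: "act v \<zero>\<^bsub>P\<^esub> = \<zero>\<^bsub>P\<^esub>" if "v \<in> carrier W" for v
    by (rule linear_maps_zero[OF P.module_axioms P.module_axioms act_linear_right[OF that]])
  have minus: "act (u \<ominus>\<^bsub>W\<^esub> v) p = act u p \<ominus>\<^bsub>P\<^esub> act v p"
    if "u \<in> carrier W" "v \<in> carrier W" "p \<in> carrier P" for u v p
    by (rule linear_maps_minus[OF W.module_axioms P.module_axioms act_linear[OF that(3)] that(1,2)])
  have sub: "submodule ?J K W"
  proof (rule W.submoduleI)
    show "\<zero>\<^bsub>W\<^esub> \<in> ?J"
      using linear_maps_zero[OF W.module_axioms P.module_axioms act_linear] by auto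
    fix u assume u: "u \<in> ?J"
    have "act (\<ominus>\<^bsub>W\<^esub> u) p = \<zero>\<^bsub>P\<^esub>" if p: "p \<in> carrier P" for p
      using minus[of "\<zero>\<^bsub>W\<^esub>" u p] u p linear_maps_zero[OF W.module_axioms P.module_axioms act_linear[OF p]]
      by (simp add: a_minus_def)
    then show "\<ominus>\<^bsub>W\<^esub> u \<in> ?J" using u by auto
  qed (auto simp: linear_mapsD[OF act_linear])
  have "ideal ?J W"
    using submodule.axioms(1)[OF sub]
    by (intro idealI W.A.ring_axioms) (auto simp: act_mult act_closed zero)
  moreover have "env_rels K L \<subseteq> ?J"
  proof
    fix s assume s: "s \<in> env_rels K L"
    have "act s p = \<zero>\<^bsub>P\<^esub>" if p: "p \<in> carrier P" for p
      using s
    proof (cases rule: env_rels_cases)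
      case (1 x y)
      then show ?thesis
        using p linear_mapsD(2)[OF bilinearD(2)[OF bilinear p], of x y]
        by (simp add: minus single_word act_single linear_mapsD[OF act_linear] rho_closed
            P.M.r_neg a_minus_def[of P])
    next
      case (2 a x)
      then show ?thesis
        using p linear_mapsD(3)[OF bilinearD(2)[OF bilinear p], of a x]
        by (simp add: minus single_word act_single linear_mapsD[OF act_linear] rho_closed
            P.M.r_neg a_minus_def[of P])
    next
      case (3 x y)
      then have "act s p = (\<rho> x (\<rho> y p) \<ominus>\<^bsub>P\<^esub> \<rho> y (\<rho> x p)) \<ominus>\<^bsub>P\<^esub> \<rho> (bracket L x y) p"
        using p by (simp add: minus single_word act_single bracket_closed)
      also have "\<dots> = \<zero>\<^bsub>P\<^esub>"
        using 3 p
        by (simp add: commute[of x y] rho_closed bracket_closed P.add_minus_cancel)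
          (simp add: a_minus_def P.M.r_neg rho_closed bracket_closed)
      finally show ?thesis .
    qed
    then show "s \<in> ?J" using s env_rels_carrier by auto
  qed
  ultimately show ?thesis using env_ideal_minimal assms by blast
qed

end

subsection \<open>Coproduct and counit\<close>

context lie_algebra
begin

lemma rep_env: "lie_rep K L U (\<lambda>x p. ew [x] \<otimes>\<^bsub>U\<^esub> p)"
proof (intro lie_rep.intro lie_rep_axioms.intro lie_algebra_axioms U.module_axioms)
  show "bilinear K L U U (\<lambda>x p. ew [x] \<otimes>\<^bsub>U\<^esub> p)"
    using linear_mapsD[OF env_letter_linear]
    by (intro bilinearI) (simp_all add: U.A.l_distr U.A.r_distr U.smult_mult_left U.smult_mult_right)
  show "ew [x] \<otimes>\<^bsub>U\<^esub> (ew [y] \<otimes>\<^bsub>U\<^esub> p) = ew [y] \<otimes>\<^bsub>U\<^esub> (ew [x] \<otimes>\<^bsub>U\<^esub> p) \<oplus>\<^bsub>U\<^esub> ew [bracket L x y] \<otimes>\<^bsub>U\<^esub> p"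
    if "x \<in> carrier L" "y \<in> carrier L" "p \<in> carrier U" for x y p
    using that linear_mapsD(1)[OF env_letter_linear]
    by (simp add: U.A.m_assoc[symmetric] env_letter_commute[of x y] U.A.l_distr bracket_closed)
qed

sublocale T: tensor_algebra K U U
  by (intro tensor_algebra.intro kalgebra_env)

sublocale TM: kalgebra K "tensor K U U" by (rule T.kalgebra_tensor)

definition prim :: "'g \<Rightarrow> _" where
  "prim x = T.pt (ew [x]) \<one>\<^bsub>U\<^esub> \<oplus>\<^bsub>T.T\<^esub> T.pt \<one>\<^bsub>U\<^esub> (ew [x])"

lemma letter_closed: "x \<in> carrier L \<Longrightarrow> ew [x] \<in> carrier U"
  by (rule linear_mapsD(1)[OF env_letter_linear])

lemma prim_linear: "prim \<in> linear_maps K L T.T"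
  unfolding prim_def
  by (intro linear_maps_add TM.module_axioms linear_maps_comp[OF env_letter_linear T.pure_linear(1)]
      linear_maps_comp[OF env_letter_linear T.pure_linear(2)] U.A.one_closed)

lemma prim_closed: "x \<in> carrier L \<Longrightarrow> prim x \<in> carrier T.T"
  by (rule linear_mapsD(1)[OF prim_linear])

text \<open>In the product the mixed terms \<open>x \<otimes> y\<close> and
  \<open>y \<otimes> x\<close> are symmetric in \<open>x\<close> and \<open>y\<close>; only the
  outer terms feel the order, and they differ by the bracket.\<close>

lemma prim_commute:
  assumes "x \<in> carrier L" "y \<in> carrier L"
  shows "prim x \<otimes>\<^bsub>T.T\<^esub> prim y = prim y \<otimes>\<^bsub>T.T\<^esub> prim x \<oplus>\<^bsub>T.T\<^esub> prim (bracket L x y)"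
proof -
  have *: "prim x \<otimes>\<^bsub>T.T\<^esub> prim y = T.pt (ew [x] \<otimes>\<^bsub>U\<^esub> ew [y]) \<one>\<^bsub>U\<^esub> \<oplus>\<^bsub>T.T\<^esub> T.pt (ew [x]) (ew [y])
      \<oplus>\<^bsub>T.T\<^esub> (T.pt (ew [y]) (ew [x]) \<oplus>\<^bsub>T.T\<^esub> T.pt \<one>\<^bsub>U\<^esub> (ew [x] \<otimes>\<^bsub>U\<^esub> ew [y]))"
    if "x \<in> carrier L" "y \<in> carrier L" for x y
    using that
    by (simp add: prim_def TM.A.l_distr TM.A.r_distr T.pure_mult T.pure_closed letter_closed)
      (simp add: TM.M.a_ac T.pure_closed letter_closed)
  show ?thesis
    unfolding *[OF assms] *[OF assms(2,1)] env_letter_commute[OF assms]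
    using assms
    by (simp add: prim_def linear_mapsD(2)[OF T.pure_linear(1)] linear_mapsD(2)[OF T.pure_linear(2)]
        letter_closed bracket_closed T.pure_closed TM.M.a_ac)
qed

lemma rep_tensor: "lie_rep K L T.T (\<lambda>x t. prim x \<otimes>\<^bsub>T.T\<^esub> t)"
proof (intro lie_rep.intro lie_rep_axioms.intro lie_algebra_axioms TM.module_axioms)
  show "bilinear K L T.T T.T (\<lambda>x t. prim x \<otimes>\<^bsub>T.T\<^esub> t)"
    using linear_mapsD[OF prim_linear]
    by (intro bilinearI) (simp_all add: TM.A.l_distr TM.A.r_distr TM.smult_mult_left TM.smult_mult_right)
  show "prim x \<otimes>\<^bsub>T.T\<^esub> (prim y \<otimes>\<^bsub>T.T\<^esub> p) = prim y \<otimes>\<^bsub>T.T\<^esub> (prim x \<otimes>\<^bsub>T.T\<^esub> p) \<oplus>\<^bsub>T.T\<^esub> prim (bracket L x y) \<otimes>\<^bsub>T.T\<^esub> p"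
    if "x \<in> carrier L" "y \<in> carrier L" "p \<in> carrier T.T" for x y p
    using that
    by (simp add: TM.A.m_assoc[symmetric] prim_closed prim_commute[of x y] TM.A.l_distr bracket_closed)
qed

interpretation RU: lie_rep K L U "\<lambda>x p. ew [x] \<otimes>\<^bsub>U\<^esub> p" by (rule rep_env)
interpretation RT: lie_rep K L T.T "\<lambda>x t. prim x \<otimes>\<^bsub>T.T\<^esub> t" by (rule rep_tensor)

abbreviation "\<Delta> \<equiv> lin_ext K T.T (env_comult_word K L)"

lemma env_comult_word_eq: "env_comult_word K L w = foldr (\<lambda>x t. prim x \<otimes>\<^bsub>T.T\<^esub> t) w \<one>\<^bsub>T.T\<^esub>"
  by (simp add: env_comult_word_def Let_def prim_def)

text \<open>The coproduct is the action on the vector \<open>1 \<otimes> 1\<close>, so that it is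
  well defined because the ideal acts by zero.\<close>

lemma comult_cls:
  assumes "u \<in> carrier W"
  shows "\<Delta> (E.cls u) = RT.act u \<one>\<^bsub>T.T\<^esub>"
proof -
  have eq: "RT.act v \<one>\<^bsub>T.T\<^esub> = lin_comb K T.T (env_comult_word K L) v" for v
    by (simp add: RT.act_def env_comult_word_eq[abs_def])
  have "lin_comb K T.T (env_comult_word K L) v = \<zero>\<^bsub>T.T\<^esub>" if "v \<in> I" for v
    using RT.act_ideal[OF that TM.A.one_closed] by (simp add: eq)
  moreover have "env_comult_word K L \<in> carrier (word_monoid (carrier L)) \<rightarrow> carrier T.T"
    using RT.foldr_closed[OF _ TM.A.one_closed] by (simp add: env_comult_word_eq word_monoid_simps)
  ultimately show ?thesis
    using assms E.submodule unfolding eq word_algebra_def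
    by (intro lin_ext_cls[OF TM.module_axioms]) auto
qed

lemma comult_env_linear: "\<Delta> \<in> linear_maps K U T.T"
  using linear_mapsD[OF RT.act_linear[OF TM.A.one_closed]]
  by (intro linear_mapsI)
    (auto elim!: env_cases simp: comult_cls linear_mapsD(2,3)[OF cls_linear, symmetric])

lemma comult_env_word:
  assumes "w \<in> lists (carrier L)"
  shows "\<Delta> (ew w) = foldr (\<lambda>x t. prim x \<otimes>\<^bsub>T.T\<^esub> t) w \<one>\<^bsub>T.T\<^esub>"
  unfolding env_word_def using assms by (simp add: comult_cls single_word RT.act_single)

text \<open>The counit field of \<open>enveloping_algebra\<close>: the coefficient of the empty word
  in a chosen representative, which is the constant term.\<close>

definition env_counit :: "('g list \<Rightarrow> 'k) set \<Rightarrow> 'k" where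
  "env_counit C = (SOME u. u \<in> C) []"

text \<open>The empty word factors only as the product of two empty words.\<close>

lemma word_mult_Nil:
  assumes "u [] = \<zero> \<or> v [] = \<zero>"
  shows "(u \<otimes>\<^bsub>W\<^esub> v) [] = \<zero>"
proof -
  let ?S = "{p \<in> fun_support K u \<times> fun_support K v. fst p \<otimes>\<^bsub>word_monoid (carrier L)\<^esub> snd p = []}"
  have S: "?S = {}"
    using assms by (auto simp: fun_support_def word_monoid_simps)
  have "(u \<otimes>\<^bsub>W\<^esub> v) [] = (\<Oplus>p\<in>?S. u (fst p) \<otimes> v (snd p))"
    by (simp add: word_algebra_def monoid_algebra_def)
  then show ?thesis unfolding S by simp
qed

lemma word_eval_simps:
  "(u \<oplus>\<^bsub>W\<^esub> v) w = u w \<oplus> v w" "(a \<odot>\<^bsub>W\<^esub> u) w = a \<otimes> u w" "\<zero>\<^bsub>W\<^esub> w = \<zero>"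
  by (simp_all add: word_algebra_def monoid_algebra_simps)

lemma word_eval_closed: "u \<in> carrier W \<Longrightarrow> u w \<in> carrier K"
  unfolding word_algebra_def by (rule W.carrierD)

lemma word_eval_minus:
  assumes "u \<in> carrier W" "v \<in> carrier W"
  shows "(u \<ominus>\<^bsub>W\<^esub> v) w = u w \<ominus> v w"
proof -
  have "\<ominus>\<^bsub>W\<^esub> v = (\<ominus> \<one>) \<odot>\<^bsub>W\<^esub> v" using assms by (simp add: W.smult_l_minus)
  then show ?thesis
    using assms by (simp add: a_minus_def word_eval_simps word_eval_closed R.l_minus)
qed

text \<open>Words without constant term form an ideal, and no defining relation involves the empty
  word. Hence the constant term does not depend on the representative.\<close>

lemma ideal_Nil:
  assumes "u \<in> I"
  shows "u [] = \<zero>"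
proof -
  let ?J = "{u \<in> carrier W. u [] = \<zero>}"
  have "\<ominus>\<^bsub>W\<^esub> u \<in> ?J" if "u \<in> ?J" for u
    using word_eval_minus[of "\<zero>\<^bsub>W\<^esub>" u "[]"] that by (auto simp: a_minus_def word_eval_simps)
  then have sub: "submodule ?J K W"
    by (intro W.submoduleI) (auto simp: word_eval_simps)
  have "ideal ?J W"
    using submodule.axioms(1)[OF sub]
    by (intro idealI W.A.ring_axioms) (auto simp: word_mult_Nil)
  moreover have "env_rels K L \<subseteq> ?J"
    using env_rels_carrier
    by (auto elim!: env_rels_cases simp: word_eval_minus word_eval_simps single_word bracket_closed)
      (auto simp: single_fun_def a_minus_def)
  ultimately show ?thesis using env_ideal_minimal assms by blast
qed

lemma env_counit_cls:
  assumes "u \<in> carrier W"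
  shows "env_counit (E.cls u) = u []"
proof -
  define v where "v = (SOME v. v \<in> E.cls u)"
  have "u \<in> E.cls u"
    using abelian_subgroup.a_rcos_self[OF E.abelian_subgroup assms] .
  then have "v \<in> E.cls u" unfolding v_def by (rule someI[where P = "\<lambda>v. v \<in> E.cls u"])
  then obtain h where h: "h \<in> I" "v = h \<oplus>\<^bsub>W\<^esub> u" unfolding mem_a_r_coset by auto
  then show ?thesis
    using ideal_Nil[of h] word_eval_closed[OF assms]
    by (simp add: env_counit_def v_def[symmetric] word_eval_simps)
qed

lemma env_counit_closed: "x \<in> carrier U \<Longrightarrow> env_counit x \<in> carrier K"
  by (auto elim!: env_cases simp: env_counit_cls word_eval_closed)

lemma env_counit_add:
  "x \<in> carrier U \<Longrightarrow> y \<in> carrier U \<Longrightarrow> env_counit (x \<oplus>\<^bsub>U\<^esub> y) = env_counit x \<oplus> env_counit y"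
  by (auto elim!: env_cases simp: env_counit_cls linear_mapsD(2,3)[OF cls_linear, symmetric] word_eval_simps)

lemma env_counit_smult:
  "a \<in> carrier K \<Longrightarrow> x \<in> carrier U \<Longrightarrow> env_counit (a \<odot>\<^bsub>U\<^esub> x) = a \<otimes> env_counit x"
  by (auto elim!: env_cases simp: env_counit_cls linear_mapsD(2,3)[OF cls_linear, symmetric] word_eval_simps)

lemma env_counit_letter:
  assumes "x \<in> carrier L" "y \<in> carrier U"
  shows "env_counit (ew [x] \<otimes>\<^bsub>U\<^esub> y) = \<zero>"
proof -
  obtain v where "v \<in> carrier W" "y = E.cls v" using assms(2) by (rule env_cases)
  moreover have "single_fun K [x] [] = \<zero>" by (simp add: single_fun_def)
  ultimately show ?thesis
    using assms by (simp add: env_word_def cls_mult[symmetric] single_word env_counit_cls word_mult_Nil)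
qed

lemma env_counit_one: "env_counit \<one>\<^bsub>U\<^esub> = \<one>"
proof -
  have "single_fun K [] [] = \<one>" by (simp add: single_fun_def)
  then show ?thesis
    by (simp add: env_word_Nil[symmetric]) (simp add: env_word_def env_counit_cls single_word)
qed

text \<open>Treats both counit laws at once, with \<open>f\<close> either
  \<open>\<epsilon> \<otimes> id\<close> or \<open>id \<otimes> \<epsilon>\<close>. The last
  condition on \<open>f\<close> says that it carries multiplication by
  \<open>x \<otimes> 1 + 1 \<otimes> x\<close> to multiplication by \<open>x\<close>; peeling off
  the letters of a word then reduces the claim to the empty one.\<close>

lemma counit_comult:
  assumes f: "f \<in> linear_maps K T.T U" and f1: "f \<one>\<^bsub>T.T\<^esub> = \<one>\<^bsub>U\<^esub>"
    and fx: "\<And>x y z. \<lbrakk>x \<in> carrier L; y \<in> carrier U; z \<in> carrier U\<rbrakk> \<Longrightarrow>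
      f (T.pt (ew [x] \<otimes>\<^bsub>U\<^esub> y) z) \<oplus>\<^bsub>U\<^esub> f (T.pt y (ew [x] \<otimes>\<^bsub>U\<^esub> z)) = ew [x] \<otimes>\<^bsub>U\<^esub> f (T.pt y z)"
    and c: "c \<in> carrier U"
  shows "f (\<Delta> c) = c"
proof -
  have lin: "(\<lambda>t. prim x \<otimes>\<^bsub>T.T\<^esub> t) \<in> linear_maps K T.T T.T" "(\<lambda>y. ew [x] \<otimes>\<^bsub>U\<^esub> y) \<in> linear_maps K U U"
    if "x \<in> carrier L" for x
    using bilinearD(3)[OF RT.bilinear that] bilinearD(3)[OF RU.bilinear that] by auto
  have step: "f (prim x \<otimes>\<^bsub>T.T\<^esub> t) = ew [x] \<otimes>\<^bsub>U\<^esub> f t" if x: "x \<in> carrier L" and t: "t \<in> carrier T.T" for x t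
    by (rule T.tensor_linear_eq[OF linear_maps_comp[OF lin(1)[OF x] f] linear_maps_comp[OF f lin(2)[OF x]] t])
      (use x in \<open>simp add: prim_def TM.A.l_distr T.pure_mult T.pure_closed letter_closed linear_mapsD[OF f] fx\<close>)
  obtain u where u: "u \<in> carrier W" "c = E.cls u" using c by (rule env_cases)
  have "f (\<Delta> (E.cls u)) = E.cls u"
  proof (rule RU.act_eqI[OF linear_maps_comp[OF linear_maps_comp[OF cls_linear comult_env_linear] f] cls_linear u(1)])
    fix w assume w: "w \<in> lists (carrier L)"
    then have "f (foldr (\<lambda>x t. prim x \<otimes>\<^bsub>T.T\<^esub> t) w \<one>\<^bsub>T.T\<^esub>) = ew w"
    proof (induction w)
      case (Cons x w)
      then show ?case by (simp add: env_word_Cons[of x w] step RT.foldr_closed)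
    qed (simp add: f1 env_word_Nil)
    then show "f (\<Delta> (E.cls (single_fun K w))) = E.cls (single_fun K w)"
      using comult_env_word[OF w] by (simp add: env_word_def)
  qed
  then show ?thesis using u by simp
qed

lemma env_counit_left:
  assumes "c \<in> carrier U"
  shows "tensor_lift K U (\<lambda>y z. env_counit y \<odot>\<^bsub>U\<^esub> z) (\<Delta> c) = c"
proof -
  have b: "bilinear K U U U (\<lambda>y z. env_counit y \<odot>\<^bsub>U\<^esub> z)"
    by (rule U.functional_bilinear(1)[OF env_counit_closed env_counit_add env_counit_smult])
  note p = T.tensor_lift_pure[OF U.module_axioms b]
  show ?thesis
    by (rule counit_comult[OF T.tensor_lift_linear[OF U.module_axioms b] _ _ assms])
      (simp_all add: T.one_tensor p env_counit_one env_counit_letter letter_closed U.smult_mult_right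
        env_counit_closed)
qed

lemma env_counit_right:
  assumes "c \<in> carrier U"
  shows "tensor_lift K U (\<lambda>y z. env_counit z \<odot>\<^bsub>U\<^esub> y) (\<Delta> c) = c"
proof -
  have b: "bilinear K U U U (\<lambda>y z. env_counit z \<odot>\<^bsub>U\<^esub> y)"
    by (rule U.functional_bilinear(2)[OF env_counit_closed env_counit_add env_counit_smult])
  note p = T.tensor_lift_pure[OF U.module_axioms b]
  show ?thesis
    by (rule counit_comult[OF T.tensor_lift_linear[OF U.module_axioms b] _ _ assms])
      (simp_all add: T.one_tensor p env_counit_one env_counit_letter letter_closed U.smult_mult_right
        env_counit_closed)
qed

section \<open>Transfer from \<open>U\<close> to the record with the Hopf structure\<close>

lemma enveloping_simps:
  "carrier (enveloping_algebra K L) = carrier U" "monoid.mult (enveloping_algebra K L) = monoid.mult U"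
  "one (enveloping_algebra K L) = one U" "zero (enveloping_algebra K L) = zero U"
  "add (enveloping_algebra K L) = add U" "smult (enveloping_algebra K L) = smult U"
  "comult (enveloping_algebra K L) = \<Delta>" "counit (enveloping_algebra K L) = env_counit"
  by (simp_all add: enveloping_algebra_def Let_def module.defs hopf.defs env_counit_def[abs_def])

text \<open>The tensor product is built from fields on which \<open>U\<close> and the extended
  record agree, so the two constructions are equal and not merely isomorphic.\<close>

lemma tensor_enveloping:
  "tensor K (enveloping_algebra K L) (enveloping_algebra K L) = T.T"
  "pure_tensor K (enveloping_algebra K L) (enveloping_algebra K L) = T.pt"
  by (simp_all add: fun_eq_iff tensor_def pure_tensor_def tensor_null_def tensor_rels_def tensor_free_def
      DirProd_def Let_def enveloping_simps)

lemma tensor_lift_enveloping: "tensor_lift K (enveloping_algebra K L) f = tensor_lift K U f"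
  by (simp add: fun_eq_iff tensor_lift_def lin_ext_def finsum_def finprod_def Let_def enveloping_simps)

lemma counital_enveloping: "counital_algebra K (enveloping_algebra K L)"
proof (intro counital_algebra.intro counital_algebra_axioms.intro field_axioms)
  show "kalgebra K (enveloping_algebra K L)"
    by (rule kalgebra_cong[OF kalgebra_env]) (simp_all add: enveloping_simps)
  show "comult (enveloping_algebra K L) \<in> linear_maps K (enveloping_algebra K L)
      (tensor K (enveloping_algebra K L) (enveloping_algebra K L))"
    using comult_env_linear by (simp add: linear_maps_def tensor_enveloping enveloping_simps)
qed (simp_all add: enveloping_simps tensor_enveloping tensor_lift_enveloping env_counit_closed env_counit_add
    env_counit_smult env_counit_left env_counit_right comult_env_word[of "[]", simplified env_word_Nil]
    T.one_tensor)

lemma comult_letter: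
  "x \<in> carrier L \<Longrightarrow> \<Delta> (ew [x]) = T.pt (ew [x]) \<one>\<^bsub>U\<^esub> \<oplus>\<^bsub>T.T\<^esub> T.pt \<one>\<^bsub>U\<^esub> (ew [x])"
  using comult_env_word[of "[x]"] prim_closed[of x] by (simp add: prim_def)

end

section \<open>The action on polynomials\<close>

lemma fin_funs_mono: "S \<subseteq> S' \<Longrightarrow> u \<in> fin_funs K S \<Longrightarrow> u \<in> fin_funs K S'"
  by (auto simp: fin_funs_def)

context module
begin

lemma submodule_fin_funs:
  assumes "S \<subseteq> carrier G"
  shows "submodule (fin_funs R S) R (monoid_algebra R G)"
proof -
  interpret F: module R "monoid_algebra R G" by (rule module_monoid_algebra[OF R.is_cring])
  have "\<ominus>\<^bsub>monoid_algebra R G\<^esub> u = \<ominus> \<one> \<odot>\<^bsub>monoid_algebra R G\<^esub> u" if "u \<in> fin_funs R S" for u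
    using fin_funs_mono[OF assms that] by (simp add: F.smult_l_minus monoid_algebra_simps(1))
  then show ?thesis
    using fin_funs_mono[OF assms]
    by (intro F.submoduleI) (auto simp: monoid_algebra_simps fin_funs_zero fin_funs_add fin_funs_smult)
qed

lemma submodule_zero: "submodule V R M \<Longrightarrow> \<zero>\<^bsub>M\<^esub> \<in> V"
  using subgroup.one_closed[OF submodule.axioms(1)] by fastforce

lemma submodule_lin_comb:
  assumes "submodule V R M" "\<phi> \<in> S \<rightarrow> V" "u \<in> fin_funs R S"
  shows "lin_comb R M \<phi> u \<in> V"
proof -
  note V = submoduleE[OF assms(1)]
  have \<phi>: "\<phi> \<in> S \<rightarrow> carrier M" using assms(2) V(1) by auto
  show ?thesis
    using assms(3)
  proof (induction rule: fin_funs_induct)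
    case zero
    show ?case by (simp add: lin_comb_zero submodule_zero[OF assms(1)])
  next
    case (add a x v)
    have "lin_comb R M \<phi> (\<lambda>y. a \<otimes> single_fun R x y \<oplus> v y) = a \<odot>\<^bsub>M\<^esub> \<phi> x \<oplus>\<^bsub>M\<^esub> lin_comb R M \<phi> v"
      using lin_comb_add[OF fin_funs_smult[OF single_fin_funs[OF add.hyps(2)] add.hyps(1)] add.hyps(3) \<phi>]
        lin_comb_smult[OF single_fin_funs[OF add.hyps(2)] add.hyps(1) \<phi>] lin_comb_single[of \<phi> x, OF funcset_mem[OF \<phi> add.hyps(2)]]
      by simp
    moreover have "\<phi> x \<in> V" using add.hyps assms(2) by auto
    ultimately show ?case using V(4)[OF add.hyps(1)] V(5) add.IH by simp
  qed
qed

lemma lin_comb_fun_add: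
  assumes "u \<in> fin_funs R S" "\<phi> \<in> S \<rightarrow> carrier M" "\<psi> \<in> S \<rightarrow> carrier M"
  shows "lin_comb R M (\<lambda>x. \<phi> x \<oplus>\<^bsub>M\<^esub> \<psi> x) u = lin_comb R M \<phi> u \<oplus>\<^bsub>M\<^esub> lin_comb R M \<psi> u"
proof -
  note D = fin_funsD[OF assms(1)]
  have c: "\<phi> x \<in> carrier M" "\<psi> x \<in> carrier M" if "x \<in> fun_support R u" for x
    using that D assms by auto
  have "lin_comb R M (\<lambda>x. \<phi> x \<oplus>\<^bsub>M\<^esub> \<psi> x) u =
      (\<Oplus>\<^bsub>M\<^esub>x\<in>fun_support R u. u x \<odot>\<^bsub>M\<^esub> \<phi> x \<oplus>\<^bsub>M\<^esub> u x \<odot>\<^bsub>M\<^esub> \<psi> x)"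
    unfolding lin_comb_def using D(1) c by (intro finsum_cong' refl Pi_I) (simp_all add: smult_r_distr)
  also have "\<dots> = lin_comb R M \<phi> u \<oplus>\<^bsub>M\<^esub> lin_comb R M \<psi> u"
    unfolding lin_comb_def using D(1) c by (intro finsum_addf Pi_I) simp_all
  finally show ?thesis .
qed

lemma lin_comb_fun_smult:
  assumes "u \<in> fin_funs R S" "\<phi> \<in> S \<rightarrow> carrier M" "a \<in> carrier R"
  shows "lin_comb R M (\<lambda>x. a \<odot>\<^bsub>M\<^esub> \<phi> x) u = a \<odot>\<^bsub>M\<^esub> lin_comb R M \<phi> u"
proof -
  have "(\<lambda>x. a \<odot>\<^bsub>M\<^esub> x) \<in> linear_maps R M M"
    using assms(3) by (intro linear_mapsI) (simp_all add: smult_r_distr smult_assoc1[symmetric] R.m_comm)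
  from linear_maps_lin_comb[OF module_axioms this assms(1,2)] show ?thesis by simp
qed

lemma lin_comb_fun_linear:
  assumes "u \<in> fin_funs R S" "\<And>x. x \<in> S \<Longrightarrow> T x \<in> linear_maps R N M"
  shows "(\<lambda>p. lin_comb R M (\<lambda>x. T x p) u) \<in> linear_maps R N M"
proof (rule linear_mapsI)
  note T = linear_mapsD[OF assms(2)]
  have c: "(\<lambda>x. T x p) \<in> S \<rightarrow> carrier M" if "p \<in> carrier N" for p
    using that T(1) by auto
  show "lin_comb R M (\<lambda>x. T x p) u \<in> carrier M" if "p \<in> carrier N" for p
    by (rule lin_comb_closed[OF assms(1) c[OF that]])
  show "lin_comb R M (\<lambda>x. T x (p \<oplus>\<^bsub>N\<^esub> q)) u = lin_comb R M (\<lambda>x. T x p) u \<oplus>\<^bsub>M\<^esub> lin_comb R M (\<lambda>x. T x q) u"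
    if pq: "p \<in> carrier N" "q \<in> carrier N" for p q
    unfolding lin_comb_fun_add[OF assms(1) c[OF pq(1)] c[OF pq(2)], symmetric]
    by (rule lin_comb_cong[OF assms(1)]) (use pq T in auto)
  show "lin_comb R M (\<lambda>x. T x (a \<odot>\<^bsub>N\<^esub> p)) u = a \<odot>\<^bsub>M\<^esub> lin_comb R M (\<lambda>x. T x p) u"
    if ap: "a \<in> carrier R" "p \<in> carrier N" for a p
    unfolding lin_comb_fun_smult[OF assms(1) c[OF ap(2)] ap(1), symmetric]
    by (rule lin_comb_cong[OF assms(1)]) (use ap T in auto)
qed

end

text \<open>The free commutative monoid on \<open>n\<close> generators. Its monoid algebra is the
  polynomial ring in \<open>n\<close> variables, with multisets of indices as monomials.\<close>

definition index_monoid :: "nat \<Rightarrow> nat multiset monoid" where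
  "index_monoid n = \<lparr>carrier = {m. set_mset m \<subseteq> {..<n}}, monoid.mult = (+), one = {#}\<rparr>"

lemma carrier_index_monoid: "carrier (index_monoid n) = {m. set_mset m \<subseteq> {..<n}}"
  by (simp add: index_monoid_def)

locale lie_algebra_basis = lie_algebra K L
  for K :: "('k, 'r) ring_scheme" (structure) and L :: "('k, 'g, 's) lie_scheme" (structure) +
  fixes n :: nat and g :: "nat \<Rightarrow> 'g"
  assumes basis: "linear_basis K L (g ` {..<n})" and inj: "inj_on g {..<n}"
begin

abbreviation "B \<equiv> g ` {..<n}"
abbreviation "P \<equiv> monoid_algebra K (index_monoid n)"
abbreviation "idx \<equiv> inv_into {..<n} g"
abbreviation z :: "nat multiset \<Rightarrow> nat multiset \<Rightarrow> 'k" where "z m \<equiv> single_fun K m"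
abbreviation "br \<equiv> bracket L"

text \<open>The bound is strict, so that \<open>fin_funs K (D d)\<close> consists of the terms that
  are lower than degree \<open>d\<close>, and \<open>D 0\<close> is empty.\<close>

definition D :: "nat \<Rightarrow> nat multiset set" where
  "D d = {m. set_mset m \<subseteq> {..<n} \<and> size m < d}"

text \<open>
  \<open>rho i m\<close> is \<open>g\<^sub>i \<cdot> z\<^sub>m\<close>. If \<open>i\<close> is not the least index, then \<open>m = {j} + N\<close> with \<open>j < i\<close> minimal, and
  \<open>g\<^sub>i g\<^sub>j z\<^sub>N\<close> has to be \<open>g\<^sub>j (g\<^sub>i z\<^sub>N) + [g\<^sub>i, g\<^sub>j] z\<^sub>N\<close>, where \<open>g\<^sub>i z\<^sub>N\<close> is \<open>z\<^bsub>i+N\<^esub>\<close> up to lower terms and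
  \<open>g\<^sub>j z\<^bsub>i+N\<^esub> = z\<^bsub>i+m\<^esub>\<close>. The size test only serves termination.
\<close>

function rho :: "nat \<Rightarrow> nat multiset \<Rightarrow> nat multiset \<Rightarrow> 'k" where
  "rho i m =
    (if \<forall>k\<in>#m. i \<le> k then z (add_mset i m)
     else z (add_mset i m) \<oplus>\<^bsub>P\<^esub>
       (lin_comb K P (\<lambda>q. if size q < size m then rho (Min_mset m) q else \<zero>\<^bsub>P\<^esub>)
          (rho i (m - {#Min_mset m#}) \<ominus>\<^bsub>P\<^esub> z (add_mset i (m - {#Min_mset m#}))) \<oplus>\<^bsub>P\<^esub>
        lin_comb K P (\<lambda>b. rho (idx b) (m - {#Min_mset m#})) (coord K L B (br (g i) (g (Min_mset m))))))"
  by auto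
termination
proof (relation "measure (\<lambda>(i, m). size m)"; (simp; fail)?)
  fix i :: nat and m :: "nat multiset"
  assume "\<not> (\<forall>k\<in>#m. i \<le> k)"
  then have "Min_mset m \<in># m" by (intro Min_in) auto
  then have *: "size (m - {#Min_mset m#}) < size m" by (rule size_Diff1_less)
  then show "((i, m - {#Min_mset m#}), (i, m)) \<in> measure (\<lambda>(i, m). size m)" by simp
  from * show "((idx b, m - {#Min_mset m#}), (i, m)) \<in> measure (\<lambda>(i, m). size m)" for b by simp
qed

declare rho.simps [simp del]

definition R :: "'g \<Rightarrow> (nat multiset \<Rightarrow> 'k) \<Rightarrow> nat multiset \<Rightarrow> 'k" where
  "R y p = lin_comb K P (\<lambda>b. lin_comb K P (rho (idx b)) p) (coord K L B y)"

sublocale P: module K P by (rule module_monoid_algebra[OF R.is_cring])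

lemma carrier_P: "carrier P = fin_funs K {m. set_mset m \<subseteq> {..<n}}"
  by (simp add: monoid_algebra_simps carrier_index_monoid)

lemma z_closed: "set_mset m \<subseteq> {..<n} \<Longrightarrow> z m \<in> carrier P"
  by (simp add: carrier_P P.single_fin_funs)

lemma submodule_D: "submodule (fin_funs K (D d)) K P"
  by (rule P.submodule_fin_funs) (auto simp: D_def carrier_index_monoid)

lemma D_mono: "d \<le> e \<Longrightarrow> u \<in> fin_funs K (D d) \<Longrightarrow> u \<in> fin_funs K (D e)"
  by (rule fin_funs_mono[of "D d"]) (auto simp: D_def)

lemma D_carrier: "u \<in> fin_funs K (D d) \<Longrightarrow> u \<in> carrier P"
  unfolding carrier_P by (rule fin_funs_mono[of "D d"]) (auto simp: D_def)

lemma z_D: "set_mset m \<subseteq> {..<n} \<Longrightarrow> size m < d \<Longrightarrow> z m \<in> fin_funs K (D d)"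
  by (rule P.single_fin_funs) (simp add: D_def)

lemma idx_less: "b \<in> B \<Longrightarrow> idx b < n"
  using inv_into_into[of b g "{..<n}"] by simp

lemma idx_g: "i < n \<Longrightarrow> idx (g i) = i"
  by (simp add: inv_into_f_f[OF inj])

lemma g_closed: "i < n \<Longrightarrow> g i \<in> carrier L"
  using basis by (auto simp: linear_basis_def)

lemma rho_le: "\<forall>k\<in>#m. i \<le> k \<Longrightarrow> rho i m = z (add_mset i m)"
  by (subst rho.simps) simp

lemma rho_gt:
  assumes "j < i" "\<forall>k\<in>#N. j \<le> k"
  shows "rho i (add_mset j N) = z (add_mset i (add_mset j N)) \<oplus>\<^bsub>P\<^esub>
      (lin_comb K P (\<lambda>q. if size q < Suc (size N) then rho j q else \<zero>\<^bsub>P\<^esub>)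
          (rho i N \<ominus>\<^bsub>P\<^esub> z (add_mset i N)) \<oplus>\<^bsub>P\<^esub>
        lin_comb K P (\<lambda>b. rho (idx b) N) (coord K L B (br (g i) (g j))))"
proof -
  have M: "Min_mset (add_mset j N) = j" using assms(2) by (intro Min_eqI) auto
  have "\<not> (\<forall>k\<in>#add_mset j N. i \<le> k)" using assms(1) by auto
  then show ?thesis by (subst rho.simps) (simp only: M if_False size_add_mset add_mset_remove_trivial)
qed

lemma multiset_min_cases:
  fixes m :: "nat multiset"
  assumes "\<not> (\<forall>k\<in>#m. i \<le> k)"
  obtains j N where "m = add_mset j N" "j < i" "\<forall>k\<in>#N. j \<le> k"
proof -
  from assms have ne: "set_mset m \<noteq> {}" by auto
  define j where "j = Min_mset m"
  have j: "j \<in># m" unfolding j_def using ne by (intro Min_in) auto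
  then obtain N where N: "m = add_mset j N" by (metis insert_DiffM)
  have "\<forall>k\<in>#m. j \<le> k" unfolding j_def by auto
  with assms have "j < i" "\<forall>k\<in>#N. j \<le> k" using N by (auto simp: not_le intro: le_less_trans)
  with N show ?thesis by (rule that)
qed

text \<open>For \<open>m = {j} + N\<close> the argument of the first sum has degree at most
  \<open>size N\<close>, and the second sum acts on \<open>z N\<close>; one more letter raises
  either to at most \<open>size N + 1 = size m\<close>, below the degree of the leading term. Both
  claims enter the induction: the second bounds the argument, the first bounds what is applied to
  it.\<close>

lemma rho_degree:
  assumes "i < n" "set_mset m \<subseteq> {..<n}"
  shows "rho i m \<in> fin_funs K (D (size m + 2))"
    and "rho i m \<ominus>\<^bsub>P\<^esub> z (add_mset i m) \<in> fin_funs K (D (Suc (size m)))"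
proof -
  have "rho i m \<in> fin_funs K (D (size m + 2)) \<and>
      rho i m \<ominus>\<^bsub>P\<^esub> z (add_mset i m) \<in> fin_funs K (D (Suc (size m)))"
    using assms
  proof (induction "size m" arbitrary: i m rule: less_induct)
    case less
    have z: "z (add_mset i m) \<in> fin_funs K (D (size m + 2))" "z (add_mset i m) \<in> carrier P"
      using less.prems by (auto intro!: z_D z_closed)
    show ?case
    proof (cases "\<forall>k\<in>#m. i \<le> k")
      case True
      then show ?thesis
        using z P.submodule_zero[OF submodule_D] by (simp add: rho_le a_minus_def P.M.r_neg)
    next
      case False
      then obtain j N where m: "m = add_mset j N" "j < i" "\<forall>k\<in>#N. j \<le> k"
        by (rule multiset_min_cases)
      have N: "set_mset N \<subseteq> {..<n}" "j < n" using less.prems m by auto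
      let ?A = "lin_comb K P (\<lambda>q. if size q < Suc (size N) then rho j q else \<zero>\<^bsub>P\<^esub>)
          (rho i N \<ominus>\<^bsub>P\<^esub> z (add_mset i N))"
      let ?C = "lin_comb K P (\<lambda>b. rho (idx b) N) (coord K L B (br (g i) (g j)))"
      have "?A \<in> fin_funs K (D (Suc (size m)))"
      proof (rule P.submodule_lin_comb[OF submodule_D])
        show "rho i N \<ominus>\<^bsub>P\<^esub> z (add_mset i N) \<in> fin_funs K (D (Suc (size N)))"
          using less.hyps[of N i] less.prems m N by simp
        have "rho j q \<in> fin_funs K (D (Suc (size m)))" if q: "q \<in> D (Suc (size N))" for q
          using less.hyps[of q j] q m N D_mono[of "size q + 2" "Suc (size m)" "rho j q"]
          by (simp add: D_def)
        then show "(\<lambda>q. if size q < Suc (size N) then rho j q else \<zero>\<^bsub>P\<^esub>)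
            \<in> D (Suc (size N)) \<rightarrow> fin_funs K (D (Suc (size m)))"
          by (auto simp: D_def)
      qed
      moreover have "?C \<in> fin_funs K (D (Suc (size m)))"
      proof (rule P.submodule_lin_comb[OF submodule_D])
        show "coord K L B (br (g i) (g j)) \<in> fin_funs K B"
          using less.prems N by (intro coord_props[OF basis] bracket_closed g_closed) auto
        show "(\<lambda>b. rho (idx b) N) \<in> B \<rightarrow> fin_funs K (D (Suc (size m)))"
          using less.hyps[of N] m N idx_less by simp
      qed
      ultimately have AC: "?A \<oplus>\<^bsub>P\<^esub> ?C \<in> fin_funs K (D (Suc (size m)))"
        by (rule P.submoduleE(5)[OF submodule_D])
      have eq: "rho i m = z (add_mset i m) \<oplus>\<^bsub>P\<^esub> (?A \<oplus>\<^bsub>P\<^esub> ?C)"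
        unfolding m(1) by (rule rho_gt[OF m(2,3)])
      have "rho i m \<in> fin_funs K (D (size m + 2))"
        unfolding eq using AC by (intro P.submoduleE(5)[OF submodule_D z(1)] D_mono[OF _ AC]) simp
      moreover have "rho i m \<ominus>\<^bsub>P\<^esub> z (add_mset i m) = ?A \<oplus>\<^bsub>P\<^esub> ?C"
        unfolding eq using z(2) D_carrier[OF AC] by (rule P.add_minus_cancel)
      ultimately show ?thesis using AC by simp
    qed
  qed
  then show "rho i m \<in> fin_funs K (D (size m + 2))"
    "rho i m \<ominus>\<^bsub>P\<^esub> z (add_mset i m) \<in> fin_funs K (D (Suc (size m)))" by auto
qed

lemma rho_closed: "i < n \<Longrightarrow> set_mset m \<subseteq> {..<n} \<Longrightarrow> rho i m \<in> carrier P"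
  by (rule D_carrier[OF rho_degree(1)])

section \<open>The bilinear extension of the action\<close>

lemma rho_linear: "i < n \<Longrightarrow> lin_comb K P (rho i) \<in> linear_maps K P P"
  by (rule P.lin_comb_linear) (simp add: carrier_index_monoid rho_closed)

lemma R_g:
  assumes "i < n" "p \<in> carrier P"
  shows "R (g i) p = lin_comb K P (rho i) p"
proof -
  have "R (g i) p = lin_comb K P (\<lambda>b. lin_comb K P (rho (idx b)) p) (single_fun K (g i))"
    using assms by (simp add: R_def coord_basis[OF basis])
  also have "\<dots> = lin_comb K P (rho (idx (g i))) p"
    using assms linear_mapsD(1)[OF rho_linear] by (intro P.lin_comb_single) (simp add: idx_g)
  finally show ?thesis using assms by (simp add: idx_g)
qed

lemma R_g_z: "i < n \<Longrightarrow> set_mset m \<subseteq> {..<n} \<Longrightarrow> R (g i) (z m) = rho i m"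
  by (simp add: R_g z_closed P.lin_comb_single rho_closed)

lemma R_linear_right: "y \<in> carrier L \<Longrightarrow> R y \<in> linear_maps K P P"
  unfolding R_def by (rule P.lin_comb_fun_linear[OF coord_props(1)[OF basis]]) (auto intro: rho_linear idx_less)

lemma R_linear_left:
  assumes "p \<in> carrier P"
  shows "(\<lambda>y. R y p) \<in> linear_maps K L P"
proof -
  have \<phi>: "(\<lambda>b. lin_comb K P (rho (idx b)) p) \<in> B \<rightarrow> carrier P"
    using assms linear_mapsD(1)[OF rho_linear] idx_less by auto
  have add: "coord K L B (x \<oplus>\<^bsub>L\<^esub> y) = (\<lambda>b. coord K L B x b \<oplus> coord K L B y b)"
    if "x \<in> carrier L" "y \<in> carrier L" for x y
    using coord_add[OF basis that] by auto
  have smult: "coord K L B (a \<odot>\<^bsub>L\<^esub> x) = (\<lambda>b. a \<otimes> coord K L B x b)"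
    if "a \<in> carrier K" "x \<in> carrier L" for a x
    using coord_smult[OF basis that] by auto
  note c = coord_props(1)[OF basis]
  show ?thesis
    unfolding R_def
    by (rule linear_mapsI)
      (simp_all add: add smult P.lin_comb_closed[OF c \<phi>] P.lin_comb_add[OF c c \<phi>] P.lin_comb_smult[OF c _ \<phi>])
qed

lemma R_bilinear: "bilinear K L P P R"
  using R_linear_left R_linear_right by (simp add: bilinear_def)

lemma R_closed: "y \<in> carrier L \<Longrightarrow> p \<in> carrier P \<Longrightarrow> R y p \<in> carrier P"
  by (rule linear_mapsD(1)[OF R_linear_right])

lemmas R_add = linear_mapsD(2)[OF R_linear_right]
lemmas R_add_left = linear_mapsD(2)[OF R_linear_left]

lemma R_eq_on_basis:
  assumes "f \<in> linear_maps K L P" "h \<in> linear_maps K L P" "y \<in> carrier L"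
    and "\<And>i. i < n \<Longrightarrow> f (g i) = h (g i)"
  shows "f y = h y"
  by (rule linear_maps_eq_on_basis[OF basis P.module_axioms assms(1,2) _ assms(3)]) (use assms(4) in auto)

text \<open>The instance of the commutation rule that the recursion was designed to satisfy:
  \<open>j\<close> is least in the monomial, so \<open>g_j\<close> acts on \<open>z N\<close> by
  plain multiplication.\<close>

lemma R_swap:
  assumes "i < n" "j < n" "j < i" "set_mset N \<subseteq> {..<n}" "\<forall>k\<in>#N. j \<le> k"
  shows "R (g i) (R (g j) (z N)) = R (g j) (R (g i) (z N)) \<oplus>\<^bsub>P\<^esub> R (br (g i) (g j)) (z N)"
proof -
  let ?y = "rho i N \<ominus>\<^bsub>P\<^esub> z (add_mset i N)"
  let ?m = "add_mset j N"
  have ij: "set_mset ?m \<subseteq> {..<n}" "set_mset (add_mset i N) \<subseteq> {..<n}" "set_mset (add_mset i ?m) \<subseteq> {..<n}"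
    using assms by auto
  have y: "?y \<in> fin_funs K (D (Suc (size N)))" by (rule rho_degree(2)[OF assms(1,4)])
  have "R (g i) (R (g j) (z N)) = rho i ?m"
    using assms ij by (simp add: R_g_z rho_le)
  also have "\<dots> = z (add_mset i ?m) \<oplus>\<^bsub>P\<^esub> (lin_comb K P (\<lambda>q. if size q < Suc (size N) then rho j q else \<zero>\<^bsub>P\<^esub>) ?y
      \<oplus>\<^bsub>P\<^esub> lin_comb K P (\<lambda>b. rho (idx b) N) (coord K L B (br (g i) (g j))))"
    by (rule rho_gt[OF assms(3,5)])
  \<comment> \<open>By the degree bound every monomial of \<open>?y\<close> passes the size
    test.\<close>
  also have "lin_comb K P (\<lambda>q. if size q < Suc (size N) then rho j q else \<zero>\<^bsub>P\<^esub>) ?y = lin_comb K P (rho j) ?y"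
    using assms by (intro P.lin_comb_cong[OF y]) (auto simp: D_def rho_closed)
  also have "\<dots> = R (g j) ?y" using assms D_carrier[OF y] by (simp add: R_g)
  also have "\<dots> = R (g j) (rho i N) \<ominus>\<^bsub>P\<^esub> R (g j) (z (add_mset i N))"
    using assms ij by (intro linear_maps_minus[OF P.module_axioms P.module_axioms R_linear_right])
      (simp_all add: g_closed rho_closed z_closed)
  also have "R (g j) (z (add_mset i N)) = z (add_mset i ?m)"
    using assms ij by (subst R_g_z) (auto simp: rho_le add_mset_commute)
  also have "rho i N = R (g i) (z N)" using assms by (simp add: R_g_z)
  also have "lin_comb K P (\<lambda>b. rho (idx b) N) (coord K L B (br (g i) (g j))) = R (br (g i) (g j)) (z N)"
    unfolding R_def
    using assms coord_props(1)[OF basis bracket_closed[OF g_closed g_closed]]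
    by (intro P.lin_comb_cong[where S = B]) (auto simp: P.lin_comb_single rho_closed idx_less)
  also have "z (add_mset i ?m) \<oplus>\<^bsub>P\<^esub> (R (g j) (R (g i) (z N)) \<ominus>\<^bsub>P\<^esub> z (add_mset i ?m) \<oplus>\<^bsub>P\<^esub> R (br (g i) (g j)) (z N)) =
      R (g j) (R (g i) (z N)) \<oplus>\<^bsub>P\<^esub> R (br (g i) (g j)) (z N)"
  proof -
    have "a \<oplus>\<^bsub>P\<^esub> (b \<ominus>\<^bsub>P\<^esub> a \<oplus>\<^bsub>P\<^esub> c) = b \<oplus>\<^bsub>P\<^esub> c"
      if "a \<in> carrier P" "b \<in> carrier P" "c \<in> carrier P" for a b c
      using that P.add_minus_cancel[of a b]
      by (simp add: a_minus_def P.M.a_assoc[symmetric])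
    then show ?thesis using assms ij z_closed
      by (simp add: R_closed g_closed bracket_closed)
  qed
  finally show ?thesis .
qed

text \<open>The commutation rule at a single vector. It is established by induction on the degree of
  \<open>p\<close>, and both sides are linear in each of \<open>x\<close>, \<open>y\<close> and
  \<open>p\<close>.\<close>

definition comm_at :: "'g \<Rightarrow> 'g \<Rightarrow> (nat multiset \<Rightarrow> 'k) \<Rightarrow> bool" where
  "comm_at x y p \<longleftrightarrow> R x (R y p) = R y (R x p) \<oplus>\<^bsub>P\<^esub> R (br x y) p"

section \<open>Bracket identities, and the commutation rule at all monomials\<close>

lemma bracket_antisym:
  assumes "x \<in> carrier L" "y \<in> carrier L"
  shows "br x y \<oplus>\<^bsub>L\<^esub> br y x = \<zero>\<^bsub>L\<^esub>"
proof -
  have xy: "x \<oplus>\<^bsub>L\<^esub> y \<in> carrier L" using assms by simp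
  have "\<zero>\<^bsub>L\<^esub> = br (x \<oplus>\<^bsub>L\<^esub> y) (x \<oplus>\<^bsub>L\<^esub> y)" by (rule bracket_self[OF xy, symmetric])
  also have "\<dots> = br x (x \<oplus>\<^bsub>L\<^esub> y) \<oplus>\<^bsub>L\<^esub> br y (x \<oplus>\<^bsub>L\<^esub> y)"
    by (rule linear_mapsD(2)[OF bracket_linear_left[OF xy] assms])
  also have "br x (x \<oplus>\<^bsub>L\<^esub> y) = br x y"
    using assms by (simp add: linear_mapsD(2)[OF bracket_linear_right[OF assms(1)]] bracket_self bracket_closed)
  also have "br y (x \<oplus>\<^bsub>L\<^esub> y) = br y x"
    using assms by (simp add: linear_mapsD(2)[OF bracket_linear_right[OF assms(2)]] bracket_self bracket_closed)
  finally show ?thesis ..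
qed

text \<open>The derivation form of the Jacobi identity, arranged without signs so that it can be
  applied under \<open>R\<close>.\<close>

lemma jacobi_leibniz:
  assumes "x \<in> carrier L" "y \<in> carrier L" "w \<in> carrier L"
  shows "br x (br y w) \<oplus>\<^bsub>L\<^esub> br w (br x y) = br y (br x w)"
proof -
  have wx: "br w x \<in> carrier L" "br x w \<in> carrier L" using assms bracket_closed by auto
  have "br y (br x w) \<oplus>\<^bsub>L\<^esub> br y (br w x) = br y (br x w \<oplus>\<^bsub>L\<^esub> br w x)"
    using linear_mapsD(2)[OF bracket_linear_right[OF assms(2)] wx(2,1)] by simp
  also have "\<dots> = \<zero>\<^bsub>L\<^esub>"
    using linear_maps_zero[OF module_axioms module_axioms bracket_linear_right[OF assms(2)]] assms
    by (simp add: bracket_antisym)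
  finally have 1: "br y (br x w) \<oplus>\<^bsub>L\<^esub> br y (br w x) = \<zero>\<^bsub>L\<^esub>" .
  have 2: "(br x (br y w) \<oplus>\<^bsub>L\<^esub> br w (br x y)) \<oplus>\<^bsub>L\<^esub> br y (br w x) = \<zero>\<^bsub>L\<^esub>"
    using jacobi[OF assms] assms by (simp add: M.a_ac bracket_closed)
  have "br y (br w x) \<in> carrier L" "br y (br x w) \<in> carrier L"
    "br x (br y w) \<oplus>\<^bsub>L\<^esub> br w (br x y) \<in> carrier L"
    using assms by (simp_all add: bracket_closed)
  then show ?thesis using M.minus_equality[OF 1] M.minus_equality[OF 2] M.minus_minus by metis
qed

lemma comm_at_sym:
  assumes "comm_at x y p" "x \<in> carrier L" "y \<in> carrier L" "p \<in> carrier P"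
  shows "comm_at y x p"
proof -
  have "R (br x y) p \<oplus>\<^bsub>P\<^esub> R (br y x) p = R \<zero>\<^bsub>L\<^esub> p"
    using assms R_add_left[OF assms(4), of "br x y" "br y x"] by (simp add: bracket_closed bracket_antisym)
  also have "\<dots> = \<zero>\<^bsub>P\<^esub>"
    by (rule linear_maps_zero[OF module_axioms P.module_axioms R_linear_left[OF assms(4)]])
  finally have "R (br x y) p \<oplus>\<^bsub>P\<^esub> R (br y x) p = \<zero>\<^bsub>P\<^esub>" .
  then show ?thesis
    using assms by (simp add: comm_at_def P.M.a_assoc R_closed bracket_closed)
qed

lemma comm_at_linear:
  assumes "x \<in> carrier L" "y \<in> carrier L"
  shows "(\<lambda>p. R x (R y p)) \<in> linear_maps K P P"
    and "(\<lambda>p. R y (R x p) \<oplus>\<^bsub>P\<^esub> R (br x y) p) \<in> linear_maps K P P"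
  using assms R_linear_right
  by (auto intro!: linear_maps_add P.module_axioms bracket_closed
      linear_maps_comp[of "R x" K P P "R y"] linear_maps_comp[of "R y" K P P "R x"])

lemma comm_at_degree:
  assumes "\<And>N. N \<in> D d \<Longrightarrow> comm_at x y (z N)" "p \<in> fin_funs K (D d)" "x \<in> carrier L" "y \<in> carrier L"
  shows "comm_at x y p"
  unfolding comm_at_def
  by (rule P.linear_maps_eq_on_fin_funs[OF comm_at_linear[OF assms(3,4)] _ _ assms(2)])
    (use assms(1) in \<open>auto simp: D_def carrier_index_monoid comm_at_def\<close>)

lemma comm_at_add:
  assumes "comm_at x y p" "comm_at x y q" "x \<in> carrier L" "y \<in> carrier L" "p \<in> carrier P" "q \<in> carrier P"
  shows "comm_at x y (p \<oplus>\<^bsub>P\<^esub> q)"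
  unfolding comm_at_def
  using linear_mapsD(2)[OF comm_at_linear(1)[OF assms(3,4)] assms(5,6)]
    linear_mapsD(2)[OF comm_at_linear(2)[OF assms(3,4)] assms(5,6)] assms(1,2)
  by (simp add: comm_at_def)

lemma comm_at_basis:
  assumes "\<And>i j. i < n \<Longrightarrow> j < n \<Longrightarrow> comm_at (g i) (g j) p"
    and x: "x \<in> carrier L" and y: "y \<in> carrier L" and p: "p \<in> carrier P"
  shows "comm_at x y p"
proof -
  have 1: "comm_at x (g j) p" if j: "j < n" for j
    unfolding comm_at_def
  proof (rule R_eq_on_basis[where f = "\<lambda>x. R x (R (g j) p)"
        and h = "\<lambda>x. R (g j) (R x p) \<oplus>\<^bsub>P\<^esub> R (br x (g j)) p", OF _ _ x])
    show "(\<lambda>x. R x (R (g j) p)) \<in> linear_maps K L P"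
      using p j by (intro R_linear_left R_closed g_closed)
    show "(\<lambda>x. R (g j) (R x p) \<oplus>\<^bsub>P\<^esub> R (br x (g j)) p) \<in> linear_maps K L P"
      by (rule linear_maps_add[OF P.module_axioms
            linear_maps_comp[OF R_linear_left[OF p] R_linear_right[OF g_closed[OF j]]]
            linear_maps_comp[OF bracket_linear_left[OF g_closed[OF j]] R_linear_left[OF p]]])
  qed (rule assms(1)[unfolded comm_at_def, OF _ j])
  show ?thesis
    unfolding comm_at_def
  proof (rule R_eq_on_basis[where f = "\<lambda>y. R x (R y p)"
        and h = "\<lambda>y. R y (R x p) \<oplus>\<^bsub>P\<^esub> R (br x y) p", OF _ _ y])
    show "(\<lambda>y. R x (R y p)) \<in> linear_maps K L P"
      by (rule linear_maps_comp[OF R_linear_left[OF p] R_linear_right[OF x]])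
    show "(\<lambda>y. R y (R x p) \<oplus>\<^bsub>P\<^esub> R (br x y) p) \<in> linear_maps K L P"
      by (rule linear_maps_add[OF P.module_axioms R_linear_left[OF R_closed[OF x p]]
            linear_maps_comp[OF bracket_linear_right[OF x] R_linear_left[OF p]]])
  qed (rule 1[unfolded comm_at_def])
qed

lemma R_g_decomp:
  assumes "i < n" "set_mset N \<subseteq> {..<n}"
  obtains y where "y \<in> fin_funs K (D (Suc (size N)))" "R (g i) (z N) = z (add_mset i N) \<oplus>\<^bsub>P\<^esub> y"
proof
  show "rho i N \<ominus>\<^bsub>P\<^esub> z (add_mset i N) \<in> fin_funs K (D (Suc (size N)))" by (rule rho_degree(2)[OF assms])
  show "R (g i) (z N) = z (add_mset i N) \<oplus>\<^bsub>P\<^esub> (rho i N \<ominus>\<^bsub>P\<^esub> z (add_mset i N))"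
    using assms z_closed[of "add_mset i N"] rho_closed[OF assms]
    by (simp add: R_g_z a_minus_def P.M.a_comm[of "rho i N"] P.M.a_assoc[symmetric] P.M.r_neg)
qed

text \<open>Induction on the size of the monomial, for all \<open>x\<close> and \<open>y\<close> at
  once, since brackets of basis vectors are arbitrary elements. For \<open>j < i\<close> there is an
  obstacle only if \<open>N\<close> contains some \<open>k < j\<close>. Then
  \<open>z N = g_k z_Q\<close> with \<open>k\<close> least, and \<open>g_k\<close> is moved to the
  front of both \<open>g_i g_j z_N\<close> and \<open>g_j g_i z_N\<close>; the double brackets that
  appear cancel by the Jacobi identity.\<close>

lemma comm_at_z:
  assumes "set_mset N \<subseteq> {..<n}" "x \<in> carrier L" "y \<in> carrier L"
  shows "comm_at x y (z N)"
  using assms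
proof (induction "size N" arbitrary: N x y rule: less_induct)
  case less
  have swap: "comm_at (g i) (g j) (z M)"
    if "i < n" "j < n" "j < i" "set_mset M \<subseteq> {..<n}" "\<forall>k\<in>#M. j \<le> k" for i j M
    using R_swap[OF that] by (simp add: comm_at_def)
  have low: "comm_at x y p"
    if "x \<in> carrier L" "y \<in> carrier L" "p \<in> fin_funs K (D (size N))" for x y p
    using that less.hyps by (intro comm_at_degree[OF _ that(3)]) (auto simp: D_def)
  have lt: "comm_at (g i) (g j) (z N)" if i: "i < n" and j: "j < n" and ij: "j < i" for i j
  proof (cases "\<forall>k\<in>#N. j \<le> k")
    case True
    show ?thesis by (rule swap[OF i j ij less.prems(1) True])
  next
    case False
    then obtain k Q where N: "N = add_mset k Q" "k < j" "\<forall>l\<in>#Q. k \<le> l" by (rule multiset_min_cases)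
    have k: "k < n" "k < i" and Q: "set_mset Q \<subseteq> {..<n}" using N less.prems ij by auto
    let ?q = "z Q"
    let ?X = "R (g i)" and ?Y = "R (g j)" and ?Z = "R (g k)"
    note gc = g_closed[OF i] g_closed[OF j] g_closed[OF k(1)]
    note bc = bracket_closed
    have q: "?q \<in> carrier P" "?q \<in> fin_funs K (D (size N))"
      using Q N by (auto intro!: z_closed z_D)
    have zN: "z N = ?Z ?q" using k Q N by (simp add: R_g_z rho_le)
    \<comment> \<open>\<open>g_b z_Q\<close> is \<open>z_(b+Q)\<close> plus lower terms. At the
      former, \<open>k\<close> is still least and the rule is built in; the latter have size below
      that of \<open>N\<close> and fall under the induction hypothesis.\<close>
    have step: "comm_at (g a) (g k) (R (g b) ?q)" if a: "a < n" "k < a" and b: "b < n" "k < b" for a b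
    proof -
      obtain y where y: "y \<in> fin_funs K (D (Suc (size Q)))" "R (g b) ?q = z (add_mset b Q) \<oplus>\<^bsub>P\<^esub> y"
        using R_g_decomp[OF b(1) Q] by blast
      have "comm_at (g a) (g k) (z (add_mset b Q))"
        using a b k N Q by (intro swap) auto
      moreover have "comm_at (g a) (g k) y"
        using y N a k by (intro low g_closed) auto
      ultimately show ?thesis
        unfolding y(2) using a k b Q D_carrier[OF y(1)]
        by (intro comm_at_add g_closed z_closed) auto
    qed
    have E: "R x (R y ?q) = R y (R x ?q) \<oplus>\<^bsub>P\<^esub> R (br x y) ?q" if "x \<in> carrier L" "y \<in> carrier L" for x y
      using low[OF that q(2)] by (simp add: comm_at_def)
    \<comment> \<open>Used for \<open>(a, b) = (i, j)\<close> and \<open>(j, i)\<close>. The two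
      terms with a single bracket are exchanged by swapping \<open>a\<close> and \<open>b\<close>,
      so they agree in both expansions.\<close>
    have F: "R (g a) (R (g b) (z N)) = ?Z (R (g a) (R (g b) ?q)) \<oplus>\<^bsub>P\<^esub> R (br (g a) (g k)) (R (g b) ?q)
        \<oplus>\<^bsub>P\<^esub> (R (br (g b) (g k)) (R (g a) ?q) \<oplus>\<^bsub>P\<^esub> R (br (g a) (br (g b) (g k))) ?q)"
      if a: "a < n" "k < a" and b: "b < n" "k < b" for a b
    proof -
      note ga = g_closed[OF a(1)] and gb = g_closed[OF b(1)]
      have "R (g b) (z N) = ?Z (R (g b) ?q) \<oplus>\<^bsub>P\<^esub> R (br (g b) (g k)) ?q"
        unfolding zN by (rule E[OF gb gc(3)])
      then have "R (g a) (R (g b) (z N)) = R (g a) (?Z (R (g b) ?q)) \<oplus>\<^bsub>P\<^esub> R (g a) (R (br (g b) (g k)) ?q)"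
        using ga gb gc q by (simp add: R_add R_closed bc)
      also have "R (g a) (?Z (R (g b) ?q)) = ?Z (R (g a) (R (g b) ?q)) \<oplus>\<^bsub>P\<^esub> R (br (g a) (g k)) (R (g b) ?q)"
        using step[OF a b] by (simp add: comm_at_def)
      also have "R (g a) (R (br (g b) (g k)) ?q) = R (br (g b) (g k)) (R (g a) ?q) \<oplus>\<^bsub>P\<^esub> R (br (g a) (br (g b) (g k))) ?q"
        by (rule E[OF ga bc[OF gb gc(3)]])
      finally show ?thesis .
    qed
    \<comment> \<open>The rule for \<open>g_i\<close> and \<open>g_j\<close> is known at
      \<open>z_Q\<close>. Moving \<open>g_k\<close> past \<open>[g_i, g_j]\<close> produces the
      wanted term at \<open>z N\<close> and one double bracket, which \<open>J\<close>
      absorbs.\<close>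
    have G: "?Z (?X (?Y ?q)) = ?Z (?Y (?X ?q)) \<oplus>\<^bsub>P\<^esub> (R (br (g i) (g j)) (z N) \<oplus>\<^bsub>P\<^esub> R (br (g k) (br (g i) (g j))) ?q)"
      unfolding zN E[OF gc(1,2)] E[OF gc(3) bc[OF gc(1,2)], symmetric]
      using gc q by (simp add: R_add R_closed bc)
    have J: "R (br (g j) (br (g i) (g k))) ?q =
        R (br (g i) (br (g j) (g k))) ?q \<oplus>\<^bsub>P\<^esub> R (br (g k) (br (g i) (g j))) ?q"
      using gc by (simp add: R_add_left[OF q(1), symmetric] bc jacobi_leibniz)
    show ?thesis
      unfolding comm_at_def F[OF i k(2) j N(2)] F[OF j N(2) i k(2)] G J
      using gc q z_closed[OF less.prems(1)] by (simp add: R_closed bc P.M.a_ac)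
  qed
  have "comm_at (g i) (g j) (z N)" if "i < n" "j < n" for i j
  proof -
    consider "j < i" | "i < j" | "i = j" by linarith
    then show ?thesis
    proof cases
      case 2
      then show ?thesis
        using that less.prems by (intro comm_at_sym[OF lt] g_closed z_closed)
    next
      case 3
      have "R \<zero>\<^bsub>L\<^esub> (z N) = \<zero>\<^bsub>P\<^esub>"
        using z_closed[OF less.prems(1)]
        by (intro linear_maps_zero[OF module_axioms P.module_axioms R_linear_left])
      then show ?thesis
        using 3 that z_closed[OF less.prems(1)] by (simp add: comm_at_def bracket_self g_closed R_closed)
    qed (use lt that in auto)
  qed
  then show ?case by (rule comm_at_basis[OF _ less.prems(2,3) z_closed[OF less.prems(1)]])
qed

lemma rep_polynomials: "lie_rep K L P R"
proof (intro lie_rep.intro lie_rep_axioms.intro lie_algebra_axioms P.module_axioms R_bilinear)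
  fix x y p assume x: "x \<in> carrier L" and y: "y \<in> carrier L" and p: "p \<in> carrier P"
  have "comm_at x y p"
    unfolding comm_at_def
    by (rule P.linear_maps_eq_on_singles[OF comm_at_linear[OF x y] _ p])
      (use comm_at_z[OF _ x y] in \<open>simp add: carrier_index_monoid comm_at_def\<close>)
  then show "R x (R y p) = R y (R x p) \<oplus>\<^bsub>P\<^esub> R (br x y) p" by (simp add: comm_at_def)
qed

end

section \<open>The enveloping algebra has no zero divisors\<close>

text \<open>Sizes add up, so both size comparisons must be equalities; then strict monotonicity of
  addition in the multiset order forbids a strict inequality. In a product of polynomials the
  leading monomials thus meet at \<open>a + b\<close> without competition.\<close>

lemma pairs_dominated:
  fixes a b M N :: "'i :: linorder multiset"
  assumes "size M < size a \<or> size M = size a \<and> M \<le> a" "size N < size b \<or> size N = size b \<and> N \<le> b"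
    and "M + N = a + b"
  shows "M = a \<and> N = b"
proof -
  have "size M + size N = size a + size b" using arg_cong[OF assms(3), of size] by simp
  then have le: "M \<le> a" "N \<le> b" using assms(1,2) by auto
  have "\<not> M < a"
  proof
    assume "M < a"
    from add_less_le_mono[OF this le(2)] show False using assms(3) by simp
  qed
  then have "M = a" using le(1) le_neq_trans by blast
  then show ?thesis using assms(3) by simp
qed

lemma leading_index:
  fixes S :: "'i :: linorder multiset set"
  assumes "finite S" "S \<noteq> {}"
  obtains a where "a \<in> S" "\<And>m. m \<in> S \<Longrightarrow> size m < size a \<or> size m = size a \<and> m \<le> a"
proof -
  let ?d = "Max (size ` S)"
  let ?S = "{m \<in> S. size m = ?d}"
  have "?d \<in> size ` S" using assms by (intro Max_in) auto
  then have ne: "?S \<noteq> {}" by auto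
  have a: "Max ?S \<in> ?S" using assms ne by (intro Max_in) auto
  have le: "size m \<le> ?d" if "m \<in> S" for m using assms that by (intro Max_ge) auto
  have "size m < size (Max ?S) \<or> size m = size (Max ?S) \<and> m \<le> Max ?S" if m: "m \<in> S" for m
  proof (cases "size m = ?d")
    case True
    then have "m \<le> Max ?S" using assms m by (intro Max_ge) auto
    then show ?thesis using True a by simp
  next
    case False
    then show ?thesis using le[OF m] a by simp
  qed
  with a show ?thesis by (intro that[of "Max ?S"]) auto
qed

context lie_algebra_basis
begin

interpretation rep: lie_rep K L P R by (rule rep_polynomials)

section \<open>Leading terms of the action of words\<close>

abbreviation word :: "nat multiset \<Rightarrow> 'g list" where
  "word m \<equiv> map g (sorted_list_of_multiset m)"

lemma word_closed: "set_mset m \<subseteq> {..<n} \<Longrightarrow> word m \<in> lists (carrier L)"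
  using g_closed by (auto simp: subset_iff)

text \<open>\<open>foldr\<close> applies the largest letters first, so each letter meets only
  indices at least as large as itself and acts without lower terms. On the constant \<open>1\<close>
  a sorted word therefore gives exactly its monomial.\<close>

lemma foldr_sorted:
  "sorted l \<Longrightarrow> set l \<subseteq> {..<n} \<Longrightarrow> foldr R (map g l) (z {#}) = z (mset l)"
  by (induction l) (auto simp: R_g_z rho_le)

lemma R_degree:
  assumes "i < n" "p \<in> fin_funs K (D d)"
  shows "R (g i) p \<in> fin_funs K (D (Suc d))"
  unfolding R_g[OF assms(1) D_carrier[OF assms(2)]]
proof (rule P.submodule_lin_comb[OF submodule_D Pi_I assms(2)])
  fix q assume "q \<in> D d"
  then have q: "set_mset q \<subseteq> {..<n}" "size q + 2 \<le> Suc d" by (auto simp: D_def)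
  show "rho i q \<in> fin_funs K (D (Suc d))" by (rule D_mono[OF q(2) rho_degree(1)[OF assms(1) q(1)]])
qed

lemma foldr_leading:
  assumes "set l \<subseteq> {..<n}" "set_mset N \<subseteq> {..<n}"
  obtains y where "y \<in> fin_funs K (D (length l + size N))"
    "foldr R (map g l) (z N) = z (mset l + N) \<oplus>\<^bsub>P\<^esub> y"
proof -
  have "\<exists>y. y \<in> fin_funs K (D (length l + size N)) \<and> foldr R (map g l) (z N) = z (mset l + N) \<oplus>\<^bsub>P\<^esub> y"
    using assms(1)
  proof (induction l)
    case Nil
    show ?case
      using P.submodule_zero[OF submodule_D] assms(2) by (intro exI[of _ "\<zero>\<^bsub>P\<^esub>"]) (simp add: z_closed)
  next
    case (Cons i l)
    then have i: "i < n" and l: "set_mset (mset l + N) \<subseteq> {..<n}" using assms(2) by auto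
    obtain y where y: "y \<in> fin_funs K (D (length l + size N))"
      "foldr R (map g l) (z N) = z (mset l + N) \<oplus>\<^bsub>P\<^esub> y"
      using Cons by auto
    obtain y' where y': "y' \<in> fin_funs K (D (Suc (size (mset l + N))))"
      "R (g i) (z (mset l + N)) = z (add_mset i (mset l + N)) \<oplus>\<^bsub>P\<^esub> y'"
      using R_g_decomp[OF i l] by blast
    have R: "R (g i) y \<in> fin_funs K (D (length (i # l) + size N))" using R_degree[OF i y(1)] by simp
    have y'': "y' \<in> fin_funs K (D (length (i # l) + size N))" using y'(1) by simp
    have zc: "z (add_mset i (mset l + N)) \<in> carrier P" "z (mset l + N) \<in> carrier P"
      using i l by (auto intro!: z_closed)
    have "foldr R (map g (i # l)) (z N) = z (add_mset i (mset l + N)) \<oplus>\<^bsub>P\<^esub> y' \<oplus>\<^bsub>P\<^esub> R (g i) y"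
      using y' i zc D_carrier[OF y(1)] by (simp add: y(2) R_add g_closed)
    also have "\<dots> = z (add_mset i (mset l + N)) \<oplus>\<^bsub>P\<^esub> (y' \<oplus>\<^bsub>P\<^esub> R (g i) y)"
      using zc D_carrier[OF y''] D_carrier[OF R] by (simp add: P.M.a_assoc)
    finally show ?case
      using P.submoduleE(5)[OF submodule_D y'' R] by auto
  qed
  then show ?thesis using that by blast
qed

text \<open>At or above the top degree \<open>size M + size N\<close> only the leading term can
  contribute.\<close>

lemma foldr_coeff:
  assumes "set_mset M \<subseteq> {..<n}" "set_mset N \<subseteq> {..<n}" "size M + size N \<le> size t"
  shows "foldr R (word M) (z N) t = (if t = M + N then \<one> else \<zero>)"
proof -
  have "size (mset (sorted_list_of_multiset M)) = size M" by simp
  then have len: "length (sorted_list_of_multiset M) = size M" by (simp only: size_mset)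
  obtain y where y: "y \<in> fin_funs K (D (size M + size N))"
    "foldr R (word M) (z N) = z (M + N) \<oplus>\<^bsub>P\<^esub> y"
    using foldr_leading[of "sorted_list_of_multiset M" N] assms(1,2) by (auto simp: len)
  have "t \<notin> D (size M + size N)" using assms(3) by (simp add: D_def)
  then have "y t = \<zero>" by (rule fin_funsD(5)[OF y(1)])
  then show ?thesis unfolding y(2) by (simp add: monoid_algebra_simps(4) single_fun_def)
qed

text \<open>A lift of polynomials to the word algebra, sending each monomial to its sorted word. It
  allows the action, which is defined on words, to be applied to polynomials.\<close>

definition lift_word :: "(nat multiset \<Rightarrow> 'k) \<Rightarrow> 'g list \<Rightarrow> 'k" where
  "lift_word = lin_comb K W (\<lambda>m. single_fun K (word m))"

text \<open>The Poincare-Birkhoff-Witt isomorphism; its inverse is induced by \<open>u \<mapsto> act u (z {#})\<close>.\<close>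

definition pbw :: "(nat multiset \<Rightarrow> 'k) \<Rightarrow> ('g list \<Rightarrow> 'k) set" where
  "pbw p = E.cls (lift_word p)"

lemma lift_word_linear: "lift_word \<in> linear_maps K P W"
  unfolding lift_word_def
  by (rule W.lin_comb_linear) (auto simp: carrier_index_monoid intro!: single_word word_closed)

lemma lift_word_z: "set_mset m \<subseteq> {..<n} \<Longrightarrow> lift_word (z m) = single_fun K (word m)"
  unfolding lift_word_def by (rule W.lin_comb_single) (rule single_word[OF word_closed])

lemma pbw_linear: "pbw \<in> linear_maps K P U"
  unfolding pbw_def by (rule linear_maps_comp[OF lift_word_linear cls_linear])

lemma pbw_z: "set_mset m \<subseteq> {..<n} \<Longrightarrow> pbw (z m) = ew (word m)"
  by (simp add: pbw_def lift_word_z env_word_def)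

lemma env_mult_linear: "y \<in> carrier L \<Longrightarrow> (\<lambda>c. ew [y] \<otimes>\<^bsub>U\<^esub> c) \<in> linear_maps K U U"
  using bilinearD(3)[OF lie_rep.bilinear[OF rep_env]] .

lemma pbw_R_linear:
  assumes "y \<in> carrier L"
  shows "(\<lambda>p. pbw (R y p)) \<in> linear_maps K P U" "(\<lambda>p. ew [y] \<otimes>\<^bsub>U\<^esub> pbw p) \<in> linear_maps K P U"
  by (rule linear_maps_comp[OF R_linear_right[OF assms] pbw_linear])
    (rule linear_maps_comp[OF pbw_linear env_mult_linear[OF assms]])

text \<open>The rule that governs \<open>R\<close> also holds for letters in \<open>U\<close>, so
  the two sides obey the same recursion. If \<open>i\<close> is at most every index, prefixing
  \<open>i\<close> keeps the word sorted; otherwise the least \<open>j\<close> is moved out by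
  \<open>R_swap\<close> on the left and by \<open>env_letter_commute\<close> on the right, leaving
  terms of smaller size.\<close>

lemma pbw_R_z:
  assumes "y \<in> carrier L" "set_mset m \<subseteq> {..<n}"
  shows "pbw (R y (z m)) = ew [y] \<otimes>\<^bsub>U\<^esub> pbw (z m)"
  using assms
proof (induction "size m" arbitrary: y m rule: less_induct)
  case less
  note m = less.prems(2)
  have low: "pbw (R y p) = ew [y] \<otimes>\<^bsub>U\<^esub> pbw p" if "y \<in> carrier L" "p \<in> fin_funs K (D (size m))" for y p
    by (rule U.linear_maps_eq_on_fin_funs[OF pbw_R_linear[OF that(1)] _ _ that(2)])
      (use less.hyps that(1) in \<open>auto simp: D_def carrier_index_monoid\<close>)
  have le: "pbw (R (g i) (z m)) = ew [g i] \<otimes>\<^bsub>U\<^esub> pbw (z m)"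
    if "i < n" "\<forall>k\<in>#m. i \<le> k" "set_mset m \<subseteq> {..<n}" for i m
  proof -
    have "sorted_list_of_multiset (add_mset i m) = i # sorted_list_of_multiset m"
      using that(2) by (simp add: insort_is_Cons)
    then show ?thesis
      using that env_word_Cons[OF g_closed[OF that(1)] word_closed[OF that(3)]]
      by (simp add: R_g_z rho_le pbw_z)
  qed
  have gen: "pbw (R (g i) (z m)) = ew [g i] \<otimes>\<^bsub>U\<^esub> pbw (z m)" if i: "i < n" for i
  proof (cases "\<forall>k\<in>#m. i \<le> k")
    case True
    then show ?thesis by (rule le[OF i _ m])
  next
    case False
    then obtain j N where N: "m = add_mset j N" "j < i" "\<forall>k\<in>#N. j \<le> k" by (rule multiset_min_cases)
    have j: "j < n" and N': "set_mset N \<subseteq> {..<n}" using N i m by auto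
    note gi = g_closed[OF i] and gj = g_closed[OF j]
    let ?X = "ew [g i]" and ?Y = "ew [g j]" and ?N = "pbw (z N)"
    have c: "?X \<in> carrier U" "?Y \<in> carrier U" "ew [br (g i) (g j)] \<in> carrier U" "?N \<in> carrier U"
      using gi gj N' by (auto intro!: env_word_closed bracket_closed linear_mapsD(1)[OF pbw_linear] z_closed)
    have zN: "z N \<in> fin_funs K (D (size m))" "z N \<in> carrier P" using N N' by (auto intro!: z_D z_closed)
    obtain y where y: "y \<in> fin_funs K (D (Suc (size N)))" "R (g i) (z N) = z (add_mset i N) \<oplus>\<^bsub>P\<^esub> y"
      using R_g_decomp[OF i N'] by blast
    have y': "y \<in> fin_funs K (D (size m))" "y \<in> carrier P" using y(1) N D_carrier by auto
    have zi: "set_mset (add_mset i N) \<subseteq> {..<n}" using i N' by auto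
    have "pbw (R (g j) (R (g i) (z N))) = pbw (R (g j) (z (add_mset i N))) \<oplus>\<^bsub>U\<^esub> pbw (R (g j) y)"
      using y'(2) gj z_closed[OF zi]
      by (simp add: y(2) R_add R_closed linear_mapsD(2)[OF pbw_linear])
    also have "pbw (R (g j) (z (add_mset i N))) = ?Y \<otimes>\<^bsub>U\<^esub> pbw (z (add_mset i N))"
      using N by (intro le[OF j _ zi]) auto
    also have "pbw (R (g j) y) = ?Y \<otimes>\<^bsub>U\<^esub> pbw y" by (rule low[OF gj y'(1)])
    also have "?Y \<otimes>\<^bsub>U\<^esub> pbw (z (add_mset i N)) \<oplus>\<^bsub>U\<^esub> ?Y \<otimes>\<^bsub>U\<^esub> pbw y = ?Y \<otimes>\<^bsub>U\<^esub> pbw (R (g i) (z N))"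
      using c y'(2) z_closed[OF zi] linear_mapsD(1)[OF pbw_linear]
      by (simp add: y(2) linear_mapsD(2)[OF pbw_linear] U.A.r_distr)
    also have "pbw (R (g i) (z N)) = ?X \<otimes>\<^bsub>U\<^esub> ?N" by (rule low[OF gi zN(1)])
    finally have 1: "pbw (R (g j) (R (g i) (z N))) = ?Y \<otimes>\<^bsub>U\<^esub> (?X \<otimes>\<^bsub>U\<^esub> ?N)" .
    have zm: "z m = R (g j) (z N)" using N j N' by (simp add: R_g_z rho_le)
    have "pbw (R (g i) (z m)) = pbw (R (g j) (R (g i) (z N)) \<oplus>\<^bsub>P\<^esub> R (br (g i) (g j)) (z N))"
      unfolding zm by (simp add: R_swap[OF i j N(2) N' N(3)])
    also have "\<dots> = ?Y \<otimes>\<^bsub>U\<^esub> (?X \<otimes>\<^bsub>U\<^esub> ?N) \<oplus>\<^bsub>U\<^esub> ew [br (g i) (g j)] \<otimes>\<^bsub>U\<^esub> ?N"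
      using gi gj zN
      by (simp add: linear_mapsD(2)[OF pbw_linear] R_closed bracket_closed 1 low)
    also have "\<dots> = (?Y \<otimes>\<^bsub>U\<^esub> ?X \<oplus>\<^bsub>U\<^esub> ew [br (g i) (g j)]) \<otimes>\<^bsub>U\<^esub> ?N"
      using c by (simp add: U.A.l_distr U.A.m_assoc)
    also have "\<dots> = ?X \<otimes>\<^bsub>U\<^esub> (?Y \<otimes>\<^bsub>U\<^esub> ?N)"
      using c by (simp add: env_letter_commute[OF gi gj, symmetric] U.A.m_assoc)
    also have "?Y \<otimes>\<^bsub>U\<^esub> ?N = pbw (z m)" unfolding zm by (rule low[OF gj zN(1), symmetric])
    finally show ?thesis .
  qed
  have zm: "z m \<in> carrier P" by (rule z_closed[OF m])
  have f: "(\<lambda>y. pbw (R y (z m))) \<in> linear_maps K L U"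
    by (rule linear_maps_comp[OF R_linear_left[OF zm] pbw_linear])
  have h: "(\<lambda>y. ew [y] \<otimes>\<^bsub>U\<^esub> pbw (z m)) \<in> linear_maps K L U"
    by (rule bilinearD(2)[OF lie_rep.bilinear[OF rep_env] linear_mapsD(1)[OF pbw_linear zm]])
  show ?case
    by (rule linear_maps_eq_on_basis[OF basis U.module_axioms f h _ less.prems(1)]) (use gen in auto)
qed

lemma pbw_R:
  assumes "y \<in> carrier L" "p \<in> carrier P"
  shows "pbw (R y p) = ew [y] \<otimes>\<^bsub>U\<^esub> pbw p"
  by (rule U.linear_maps_eq_on_singles[OF pbw_R_linear[OF assms(1)] _ assms(2)])
    (use pbw_R_z[OF assms(1)] in \<open>simp add: carrier_index_monoid\<close>)

lemma one_closed_P: "z {#} \<in> carrier P"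
  by (simp add: z_closed)

text \<open>The spanning half of the Poincare-Birkhoff-Witt theorem: every class comes from a
  polynomial, namely from its action on the constant \<open>1\<close>.\<close>

lemma pbw_act:
  assumes "u \<in> carrier W"
  shows "pbw (rep.act u (z {#})) = E.cls u"
proof -
  have f: "(\<lambda>u. pbw (rep.act u (z {#}))) \<in> linear_maps K W U"
    by (rule linear_maps_comp[OF rep.act_linear[OF one_closed_P] pbw_linear])
  have "pbw (foldr R w (z {#})) = ew w" if "w \<in> lists (carrier L)" for w
    using that
  proof (induction w)
    case Nil
    show ?case by (simp add: pbw_z)
  next
    case (Cons y w)
    then show ?case
      by (simp add: pbw_R rep.foldr_closed[OF _ one_closed_P] env_word_Cons[of y w])
  qed
  then have eq: "pbw (rep.act (single_fun K w) (z {#})) = E.cls (single_fun K w)" if "w \<in> lists (carrier L)" for w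
    using that by (simp add: rep.act_single one_closed_P) (simp add: env_word_def)
  show ?thesis by (rule lie_rep.act_eqI[OF rep_env f cls_linear assms eq])
qed

text \<open>The independence half: since the ideal acts by zero, a polynomial whose lift lies in the
  ideal must vanish.\<close>

lemma act_lift_one:
  assumes "p \<in> carrier P"
  shows "rep.act (lift_word p) (z {#}) = p"
proof -
  have i: "(\<lambda>p. p) \<in> linear_maps K P P" by (simp add: linear_maps_def)
  show ?thesis
    by (rule P.linear_maps_eq_on_singles[OF
          linear_maps_comp[OF lift_word_linear rep.act_linear[OF one_closed_P]] i _ assms])
      (simp add: carrier_index_monoid lift_word_z rep.act_single[OF word_closed one_closed_P] foldr_sorted)
qed

lemma eval_lin_comb:
  assumes "p \<in> fin_funs K S" "\<phi> \<in> S \<rightarrow> carrier P"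
  shows "lin_comb K P \<phi> p t = (\<Oplus>m\<in>fun_support K p. p m \<otimes> \<phi> m t)"
proof -
  have "(\<lambda>m. p m \<odot>\<^bsub>P\<^esub> \<phi> m) \<in> fun_support K p \<rightarrow> carrier P"
    using fin_funsD[OF assms(1)] assms(2) by (intro Pi_I P.smult_closed) auto
  then show ?thesis
    unfolding lin_comb_def
    by (subst monoid_algebra_finsum[OF R.is_cring]) (simp_all add: monoid_algebra_simps(1,5))
qed

text \<open>The coefficient at \<open>a + b\<close>, for the leading monomials \<open>a\<close> of
  \<open>p\<close> and \<open>b\<close> of \<open>q\<close>, is \<open>p a \<otimes> q b\<close>.
  Lower terms of the action do not reach the size of \<open>a + b\<close>, and no other pair of
  monomials adds up to it.\<close>

lemma act_lift_nonzero:
  assumes p: "p \<in> carrier P" "p \<noteq> \<zero>\<^bsub>P\<^esub>" and q: "q \<in> carrier P" "q \<noteq> \<zero>\<^bsub>P\<^esub>"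
  shows "rep.act (lift_word p) q \<noteq> \<zero>\<^bsub>P\<^esub>"
proof -
  let ?C = "{m. set_mset m \<subseteq> {..<n}}"
  have pf: "p \<in> fin_funs K ?C" and qf: "q \<in> fin_funs K ?C" using p q by (simp_all add: carrier_P)
  note pD = fin_funsD[OF pf] and qD = fin_funsD[OF qf]
  have ne: "fun_support K p \<noteq> {}" "fun_support K q \<noteq> {}"
    using p(2) q(2) by (auto simp: fun_support_def monoid_algebra_simps(3))
  obtain a where a: "a \<in> fun_support K p"
    "\<And>m. m \<in> fun_support K p \<Longrightarrow> size m < size a \<or> size m = size a \<and> m \<le> a"
    using leading_index[OF pD(2) ne(1)] by blast
  obtain b where b: "b \<in> fun_support K q"
    "\<And>m. m \<in> fun_support K q \<Longrightarrow> size m < size b \<or> size m = size b \<and> m \<le> b"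
    using leading_index[OF qD(2) ne(2)] by blast
  have coeff: "foldr R (word m) q (a + b) = (if m = a then q b else \<zero>)" if m: "m \<in> fun_support K p" for m
  proof -
    have mC: "set_mset m \<subseteq> {..<n}" using m pD(3) by auto
    \<comment> \<open>\<open>q\<close> is rewritten as the combination of its own monomials, so that
      the action can be evaluated on each.\<close>
    have "foldr R (word m) q = foldr R (word m) (lin_comb K P z q)"
    proof -
      have i: "(\<lambda>p. p) \<in> linear_maps K P P" by (simp add: linear_maps_def)
      have "lin_comb K P z \<in> linear_maps K P P"
        by (rule P.lin_comb_linear) (simp add: carrier_index_monoid z_closed)
      then have "lin_comb K P z q = q"
        by (rule P.linear_maps_eq_on_singles[OF _ i _ q(1)])
          (simp add: carrier_index_monoid P.lin_comb_single z_closed)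
      then show ?thesis by simp
    qed
    also have "\<dots> = lin_comb K P (\<lambda>N. foldr R (word m) (z N)) q"
      by (rule P.linear_maps_lin_comb[OF P.module_axioms rep.foldr_linear[OF word_closed[OF mC]] qf])
        (simp add: z_closed)
    finally have "foldr R (word m) q (a + b) =
        (\<Oplus>N\<in>fun_support K q. q N \<otimes> foldr R (word m) (z N) (a + b))"
      using eval_lin_comb[OF qf, of "\<lambda>N. foldr R (word m) (z N)" "a + b"]
        rep.foldr_closed[OF word_closed[OF mC] z_closed] by auto
    also have "\<dots> = (\<Oplus>N\<in>fun_support K q. if N = b then (if m = a then q N else \<zero>) else \<zero>)"
    proof (rule R.finsum_cong'[OF refl])
      fix N assume N: "N \<in> fun_support K q"
      have "foldr R (word m) (z N) (a + b) = (if a + b = m + N then \<one> else \<zero>)"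
        using mC N qD(3) a(2)[OF m] b(2)[OF N] by (intro foldr_coeff) auto
      moreover have "a + b = m + N \<longleftrightarrow> m = a \<and> N = b"
        using pairs_dominated[OF a(2)[OF m] b(2)[OF N]] by auto
      ultimately show "q N \<otimes> foldr R (word m) (z N) (a + b) =
          (if N = b then (if m = a then q N else \<zero>) else \<zero>)"
        using qD(1) by simp
    qed (use qD(1) in auto)
    also have "\<dots> = (if m = a then q b else \<zero>)"
      using qD(1) by (intro R.add.finprod_singleton_swap[OF b(1) qD(2)]) auto
    finally show ?thesis .
  qed
  have lw: "lift_word p = lin_comb K W (\<lambda>m. single_fun K (word m)) p" by (simp add: lift_word_def)
  have "rep.act (lift_word p) q = lin_comb K P (\<lambda>m. rep.act (single_fun K (word m)) q) p"
    unfolding lw by (rule W.linear_maps_lin_comb[OF P.module_axioms rep.act_linear[OF q(1)] pf])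
      (auto intro!: single_word word_closed)
  also have "\<dots> = lin_comb K P (\<lambda>m. foldr R (word m) q) p"
    by (rule P.lin_comb_cong[OF pf])
      (use rep.foldr_closed[OF word_closed q(1)] rep.act_single[OF word_closed q(1)] in auto)
  finally have "rep.act (lift_word p) q (a + b) = (\<Oplus>m\<in>fun_support K p. p m \<otimes> foldr R (word m) q (a + b))"
    using eval_lin_comb[OF pf, of "\<lambda>m. foldr R (word m) q" "a + b"] rep.foldr_closed[OF word_closed q(1)] by auto
  also have "\<dots> = (\<Oplus>m\<in>fun_support K p. if m = a then p m \<otimes> q b else \<zero>)"
    using pD(1) qD(1) by (intro R.finsum_cong') (auto simp: coeff)
  also have "\<dots> = p a \<otimes> q b"
    using pD(1) qD(1) by (intro R.add.finprod_singleton_swap[OF a(1) pD(2)]) auto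
  also have "\<dots> \<noteq> \<zero>"
    using a(1) b(1) pD(1) qD(1) integral[of "p a" "q b"] by (auto simp: fun_support_def)
  finally show ?thesis by (auto simp: monoid_algebra_simps(3))
qed

lemma pbw_surj:
  assumes "c \<in> carrier U"
  obtains p where "p \<in> carrier P" "c = pbw p"
proof -
  obtain u where "u \<in> carrier W" "c = E.cls u" using assms by (rule env_cases)
  then show ?thesis
    using that[of "rep.act u (z {#})"] rep.act_closed[OF _ one_closed_P] pbw_act by simp
qed

lemma pbw_nonzero:
  assumes "p \<in> carrier P" "pbw p = \<zero>\<^bsub>U\<^esub>"
  shows "p = \<zero>\<^bsub>P\<^esub>"
proof -
  have "lift_word p \<in> I"
    using assms linear_mapsD(1)[OF lift_word_linear] by (simp add: pbw_def cls_eq_zero_iff)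
  then have "rep.act (lift_word p) (z {#}) = \<zero>\<^bsub>P\<^esub>" by (rule rep.act_ideal[OF _ one_closed_P])
  then show ?thesis using act_lift_one[OF assms(1)] by simp
qed

lemma z_nonzero: "z m \<noteq> \<zero>\<^bsub>P\<^esub>"
proof
  assume "z m = \<zero>\<^bsub>P\<^esub>"
  then have "z m m = \<zero>" by (simp add: monoid_algebra_simps(3))
  then show False by (simp add: single_fun_def)
qed

text \<open>Write the factors as images of \<open>p\<close> and \<open>q\<close>. If their product
  is zero, the product of the lifts lies in the ideal and annihilates the constant \<open>1\<close>;
  the lift of \<open>q\<close> takes that constant to \<open>q\<close>, so the lift of
  \<open>p\<close> annihilates \<open>q\<close>.\<close>

lemma env_domain: "noncomm_domain U"
  unfolding noncomm_domain_def
proof (intro conjI ballI impI)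
  show "ring U" by (rule U.A.ring_axioms)
  have "\<one>\<^bsub>U\<^esub> = pbw (z {#})" by (simp add: pbw_z env_word_Nil)
  then show "\<one>\<^bsub>U\<^esub> \<noteq> \<zero>\<^bsub>U\<^esub>" using pbw_nonzero[OF one_closed_P] z_nonzero by auto
  fix c d assume c: "c \<in> carrier U" and d: "d \<in> carrier U" and cd: "c \<otimes>\<^bsub>U\<^esub> d = \<zero>\<^bsub>U\<^esub>"
  obtain p where p: "p \<in> carrier P" "c = pbw p" using c by (rule pbw_surj)
  obtain q where q: "q \<in> carrier P" "d = pbw q" using d by (rule pbw_surj)
  note l = linear_mapsD(1)[OF lift_word_linear]
  have "lift_word p \<otimes>\<^bsub>W\<^esub> lift_word q \<in> I"
    using cd p q l by (simp add: pbw_def cls_mult[symmetric] cls_eq_zero_iff)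
  then have "rep.act (lift_word p \<otimes>\<^bsub>W\<^esub> lift_word q) (z {#}) = \<zero>\<^bsub>P\<^esub>" by (rule rep.act_ideal[OF _ one_closed_P])
  then have "rep.act (lift_word p) q = \<zero>\<^bsub>P\<^esub>"
    using rep.act_mult[OF l[OF p(1)] l[OF q(1)] one_closed_P] act_lift_one[OF q(1)] by simp
  then have "p = \<zero>\<^bsub>P\<^esub> \<or> q = \<zero>\<^bsub>P\<^esub>" using act_lift_nonzero p q by blast
  then show "c = \<zero>\<^bsub>U\<^esub> \<or> d = \<zero>\<^bsub>U\<^esub>"
    using p q linear_maps_zero[OF P.module_axioms U.module_axioms pbw_linear] by auto
qed

lemma letter_nonzero:
  assumes "i < n"
  shows "ew [g i] \<noteq> \<zero>\<^bsub>U\<^esub>"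
proof -
  have "ew [g i] = pbw (z {#i#})" using assms by (simp add: pbw_z)
  then show ?thesis using pbw_nonzero[of "z {#i#}"] z_nonzero z_closed[of "{#i#}"] assms by auto
qed

end

section \<open>Finite bases\<close>

text \<open>A spanning set of least cardinality is independent, for a nontrivial relation would
  express one of its elements by the others and allow its removal.\<close>

lemma finite_basis:
  assumes "field K" "module K M" "finite_dimensional K M"
  obtains B where "finite B" "linear_basis K M B"
proof -
  interpret K: field K by fact
  interpret module K M by fact
  let ?spans = "\<lambda>S. finite S \<and> S \<subseteq> carrier M \<and> module_span K M S = carrier M"
  obtain S0 where "?spans S0" using assms(3) by (auto simp: finite_dimensional_def)
  then obtain S where S: "?spans S" and min: "\<And>S'. ?spans S' \<Longrightarrow> card S \<le> card S'"
    using ex_has_least_nat[of ?spans S0 card] by blast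
  have "c w = \<zero>\<^bsub>K\<^esub>"
    if A: "finite A" "A \<subseteq> S" "c \<in> A \<rightarrow> carrier K" and sum: "(\<Oplus>\<^bsub>M\<^esub>v\<in>A. c v \<odot>\<^bsub>M\<^esub> v) = \<zero>\<^bsub>M\<^esub>"
      and w: "w \<in> A" for A c w
  proof (rule ccontr)
    assume cw: "c w \<noteq> \<zero>\<^bsub>K\<^esub>"
    have carr: "v \<in> carrier M" "c v \<in> carrier K" if "v \<in> A" for v using that A S by auto
    let ?S = "S - {w}" and ?r = "\<Oplus>\<^bsub>M\<^esub>v\<in>A - {w}. c v \<odot>\<^bsub>M\<^esub> v"
    let ?V = "module_span K M ?S"
    have S': "?S \<subseteq> carrier M" using S by auto
    have V: "submodule ?V K M" by (rule submodule_span[OF S'])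
    have r: "?r \<in> ?V"
      unfolding module_span_def using A by (intro CollectI exI[of _ "A - {w}"] exI[of _ c]) auto
    have r': "?r \<in> carrier M" using submoduleE(1)[OF V] r by auto
    have "\<zero>\<^bsub>M\<^esub> = (\<Oplus>\<^bsub>M\<^esub>v\<in>insert w (A - {w}). c v \<odot>\<^bsub>M\<^esub> v)" using sum w by (simp add: insert_absorb)
    also have "\<dots> = c w \<odot>\<^bsub>M\<^esub> w \<oplus>\<^bsub>M\<^esub> ?r" using A w carr by (intro M.finsum_insert) auto
    finally have "c w \<odot>\<^bsub>M\<^esub> w \<oplus>\<^bsub>M\<^esub> ?r = \<zero>\<^bsub>M\<^esub>" ..
    then have "\<ominus>\<^bsub>M\<^esub> ?r = c w \<odot>\<^bsub>M\<^esub> w" using r' carr[OF w] by (intro M.minus_equality) auto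
    then have "c w \<odot>\<^bsub>M\<^esub> w \<in> ?V" using submoduleE(3)[OF V r] by simp
    moreover have u: "inv\<^bsub>K\<^esub> (c w) \<in> carrier K" "inv\<^bsub>K\<^esub> (c w) \<otimes>\<^bsub>K\<^esub> c w = \<one>\<^bsub>K\<^esub>"
      using cw carr[OF w] by (simp_all add: K.field_Units)
    ultimately have "inv\<^bsub>K\<^esub> (c w) \<odot>\<^bsub>M\<^esub> (c w \<odot>\<^bsub>M\<^esub> w) \<in> ?V" using submoduleE(4)[OF V] by blast
    then have "w \<in> ?V" using u carr[OF w] by (simp add: smult_assoc1[symmetric])
    then have "S \<subseteq> ?V" using span_superset[OF S'] by auto
    then have "carrier M \<subseteq> ?V" using span_minimal[OF V] S by metis
    then have "?spans ?S" using S submoduleE(1)[OF V] by auto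
    from min[OF this] show False using S w A card_Diff1_less[of S w] by auto
  qed
  then have "lin_independent K M S" unfolding lin_independent_def by blast
  then show ?thesis using S that[of S] by (auto simp: linear_basis_def)
qed

text \<open>The letter of a basis vector is primitive and, by the Poincare-Birkhoff-Witt theorem,
  nonzero. For \<open>L = 0\<close> there is no such letter: \<open>U(L)\<close> is then the ground
  field, and \<open>{1}\<close> is a set-theoretic basis.\<close>

lemma enveloping_no_set_theoretic_basis:
  assumes "lie_algebra K L" "finite_dimensional K L" "carrier L \<noteq> {\<zero>\<^bsub>L\<^esub>}"
  shows "\<not> Phi_set_theoretic_basis K (enveloping_algebra K L) B"
proof
  assume B: "Phi_set_theoretic_basis K (enveloping_algebra K L) B"
  interpret lie_algebra K L by fact
  obtain C where C: "finite C" "linear_basis K L C"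
    using finite_basis[OF field_axioms module_axioms assms(2)] .
  obtain g where g: "bij_betw g {0..<card C} C" using ex_bij_betw_nat_finite[OF C(1)] by blast
  then have "g ` {..<card C} = C" "inj_on g {..<card C}"
    by (simp_all add: bij_betw_def atLeast0LessThan)
  then interpret lie_algebra_basis K L "card C" g
    using C(2) by unfold_locales simp_all
  \<comment> \<open>The empty set spans only zero, so a nonzero \<open>L\<close> has a basis vector
    numbered \<open>0\<close>.\<close>
  have "C \<noteq> {}"
  proof
    assume "C = {}"
    then have "carrier L = module_span K L {}" using C(2) by (simp add: linear_basis_def)
    then show False using assms(3) by (auto simp: module_span_def)
  qed
  then have n: "0 < card C" using C(1) by (simp add: card_gt_0_iff)
  interpret H: counital_algebra K "enveloping_algebra K L" by (rule counital_enveloping)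
  have "noncomm_domain (enveloping_algebra K L)"
    using env_domain H.A.ring_axioms by (simp add: noncomm_domain_def enveloping_simps)
  from H.primitive_zero[OF this B, of "ew [g 0]"]
  have "ew [g 0] = \<zero>\<^bsub>U\<^esub>"
    using n g_closed[OF n] comult_letter[of "g 0"]
    by (simp add: enveloping_simps tensor_enveloping letter_closed)
  then show False using letter_nonzero[OF n] by simp
qed

text \<open>Since \<open>inv\<close> is a total function, the nonvanishing of
  \<open>\<epsilon>(b)\<close>, which the notation \<open>\<epsilon>(b)^-1\<close> presupposes, is
  stated as part of the conclusion.\<close>

theorem theorem6:
  fixes K :: "('k, 'r) ring_scheme"
    and H :: "('k, 'h, 's) hopf_scheme"
    and L :: "('k, 'g, 't) lie_scheme"
  assumes "field K"
  shows
    "(hopf_algebra K H \<and> noncomm_domain H \<longrightarrow>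
       (\<forall>B. Phi_set_theoretic_basis K H B \<longrightarrow>
          (\<forall>b\<in>B. counit H b \<noteq> \<zero>\<^bsub>K\<^esub> \<and>
             comult H b = inv\<^bsub>K\<^esub> (counit H b) \<odot>\<^bsub>tensor K H H\<^esub> pure_tensor K H H b b)))
     \<and>
     (lie_algebra K L \<and> finite_dimensional K L \<and> carrier L \<noteq> {\<zero>\<^bsub>L\<^esub>} \<longrightarrow>
       \<not> (\<exists>B. Phi_set_theoretic_basis K (enveloping_algebra K L) B))"
proof (intro conjI impI allI ballI notI; (elim conjE exE)?)
  fix B b
  assume "hopf_algebra K H" "noncomm_domain H" "Phi_set_theoretic_basis K H B" "b \<in> B"
  note * = counital_algebra.comult_set_theoretic_basis[OF hopf_algebra_counital[OF this(1)] this(2-4)]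
  show "counit H b = \<zero>\<^bsub>K\<^esub> \<Longrightarrow> False" using *(1) by simp
  show "comult H b = inv\<^bsub>K\<^esub> (counit H b) \<odot>\<^bsub>tensor K H H\<^esub> pure_tensor K H H b b" by (rule *(2))
next
  fix B
  assume "lie_algebra K L" "finite_dimensional K L" "carrier L \<noteq> {\<zero>\<^bsub>L\<^esub>}"
    "Phi_set_theoretic_basis K (enveloping_algebra K L) B"
  then show False using enveloping_no_set_theoretic_basis by blast
qed

end
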